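(* Let $\ell$ be a prime number and let $F$ be a global function field of characteristic $\ell$ which has a prime $P_\infty$ of degree $1$. Let $\mathcal{O}_F$ be the ring of functions in $F$ with no poles outside $\{P_\infty\}$, and let $\kappa$ be the field of constants of $F$. Let $p$ and $q$ be prime numbers and assume that all of the following conditions are satisfied: (1) $p\neq \ell$ and $q\neq \ell$; (2) if $p\neq q$, then either $q\nmid h_{F(\mu_p)}$ or $p\nmid h_{F(\mu_q)}$; (3) if $q=2$, $p\neq 2$ and $q\mid h_{F(\mu_p)}$, then $p\nmid h_{F(\mu_4)}$. Then there are no non-constant solutions to $X^p-Y^q=1$ in $\mathcal{O}_F$; that is, every $(X,Y)\in \mathcal{O}_F^2$ with $X^p-Y^q=1$ satisfies $X,Y\in\kappa$. More generally, if $m>1$ and $n>1$ are integers such that $m$ is divisible by a prime $p$ and $n$ is divisible by a prime $q$ for which conditions (1), (2), (3) are satisfied, then there are no non-constant solutions to $X^m-Y^n=1$ in $\mathcal{O}_F$.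
   Context: A global function field $F$ of characteristic $\ell$ is a finitely generated field extension of $\mathbb{F}_\ell$ of transcendence degree $1$. Its field of constants $\kappa$ is the algebraic closure of $\mathbb{F}_\ell$ in $F$, which is a finite field. A prime of $F$ is the maximal ideal $v$ of a discrete valuation ring $R\subset F$ with fraction field $F$; its degree is $\dim_\kappa R/v$, and the associated valuation is $\operatorname{ord}_v:F\to\mathbb{Z}\cup\{\infty\}$. Thus $\mathcal{O}_F$ is the set of $g\in F$ with $\operatorname{ord}_v(g)\ge 0$ for every prime $v\neq P_\infty$ of $F$. A solution $(X,Y)\in\mathcal{O}_F^2$ of $X^m-Y^n=1$ is called constant if both $X$ and $Y$ lie in $\kappa$, and non-constant otherwise. For a global function field $K$, a divisor is a finite integral linear combination of primes of $K$, two divisors are equivalent if they differ by a principal divisor, and the class number $h_K$ is the (finite) cardinality of the group of divisor classes of degree $0$ of $K$. For an integer $r\geq 2$ not divisible by $\ell$, $\mu_r$ denotes the group of $r$-th roots of unity in an algebraic closure of $F$, and $F(\mu_r)$ is the field obtained by adjoining $\mu_r$ to $F$; it is a global function field with constant field $\kappa(\mu_r)$. *)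

theory Defs
  imports "HOL-Algebra.Algebra" "HOL-Computational_Algebra.Primes"
begin

text \<open>
  A field is a record \<^term>\<open>K\<close>; a subfield \<^term>\<open>F\<close> of a field \<^term>\<open>L\<close> is viewed as a field in
  its own right through \<^term>\<open>L\<lparr>carrier := F\<rparr>\<close>.
\<close>

definition prime_subfield :: "('a, 'b) ring_scheme \<Rightarrow> 'a set" where
  "prime_subfield K = generate_field K {}"

text \<open>
  For a prime \<^term>\<open>l\<close>, characteristic \<^term>\<open>l\<close> amounts to \<open>l \<cdot> 1 = 0\<close>, and the prime subfield is
  then the field with \<^term>\<open>l\<close> elements.  The last conjunct says that \<open>{t}\<close> is a transcendence basis.
\<close>

definition global_function_field :: "nat \<Rightarrow> ('a, 'b) ring_scheme \<Rightarrow> bool" where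
  "global_function_field l K \<longleftrightarrow>
     field K \<and> Factorial_Ring.prime l \<and> [l] \<cdot>\<^bsub>K\<^esub> \<one>\<^bsub>K\<^esub> = \<zero>\<^bsub>K\<^esub> \<and>
     (\<exists>S. finite S \<and> S \<subseteq> carrier K \<and> carrier K = generate_field K S) \<and>
     (\<exists>t \<in> carrier K. (ring.transcendental K over prime_subfield K) t \<and>
        (\<forall>x \<in> carrier K. (ring.algebraic K over generate_field K {t}) x))"

definition field_of_constants :: "('a, 'b) ring_scheme \<Rightarrow> 'a set" where
  "field_of_constants K = {x \<in> carrier K. (ring.algebraic K over prime_subfield K) x}"

definition discrete_valuation_ring :: "('a, 'b) ring_scheme \<Rightarrow> bool" where
  "discrete_valuation_ring A \<longleftrightarrow>
     principal_domain A \<and> \<not> field A \<and> (\<exists>!v. maximalideal v A)"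

definition discrete_valuation_subring :: "('a, 'b) ring_scheme \<Rightarrow> 'a set \<Rightarrow> bool" where
  "discrete_valuation_subring K R \<longleftrightarrow>
     subring R K \<and> discrete_valuation_ring (K\<lparr>carrier := R\<rparr>) \<and>
     carrier K = {a \<otimes>\<^bsub>K\<^esub> inv\<^bsub>K\<^esub> b | a b. a \<in> R \<and> b \<in> R - {\<zero>\<^bsub>K\<^esub>}}"

definition primes_of :: "('a, 'b) ring_scheme \<Rightarrow> 'a set set" where
  "primes_of K =
     {v. \<exists>R. discrete_valuation_subring K R \<and> maximalideal v (K\<lparr>carrier := R\<rparr>)}"

text \<open>
  The ring \<^term>\<open>R\<close> is determined by its maximal ideal \<^term>\<open>v\<close>: it consists of \<open>0\<close> and of the
  nonzero \<open>x\<close> whose inverse is not in \<^term>\<open>v\<close>.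
\<close>

definition local_ring :: "('a, 'b) ring_scheme \<Rightarrow> 'a set \<Rightarrow> ('a, 'b) ring_scheme" where
  "local_ring K v =
     K\<lparr>carrier := (THE R. discrete_valuation_subring K R \<and> maximalideal v (K\<lparr>carrier := R\<rparr>))\<rparr>"

definition residue_field :: "('a, 'b) ring_scheme \<Rightarrow> 'a set \<Rightarrow> 'a set ring" where
  "residue_field K v = local_ring K v Quot v"

text \<open>The constants are embedded in the residue field through the quotient map.\<close>

definition prime_degree :: "('a, 'b) ring_scheme \<Rightarrow> 'a set \<Rightarrow> nat" where
  "prime_degree K v =
     (ring.dim (residue_field K v) over
        ((\<lambda>a. v +>\<^bsub>local_ring K v\<^esub> a) ` field_of_constants K)) (carrier (residue_field K v))"

text \<open>
  The order at \<^term>\<open>v\<close> of a nonzero \<^term>\<open>x\<close>.  The convention \<open>ord\<^sub>v(0) = \<infinity>\<close> is not encoded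
  in the value; every use below treats \<open>0\<close> separately.
\<close>

definition ord_at :: "('a, 'b) ring_scheme \<Rightarrow> 'a set \<Rightarrow> 'a \<Rightarrow> int" where
  "ord_at K v x =
     (THE n. \<exists>\<pi> u. \<pi> \<in> carrier (local_ring K v) \<and> v = PIdl\<^bsub>local_ring K v\<^esub> \<pi> \<and>
        u \<in> Units (local_ring K v) \<and> x = u \<otimes>\<^bsub>K\<^esub> \<pi> [^]\<^bsub>K\<^esub> n)"

definition regular_outside :: "('a, 'b) ring_scheme \<Rightarrow> 'a set \<Rightarrow> 'a set" where
  "regular_outside K P =
     {g \<in> carrier K. \<forall>v \<in> primes_of K. v \<noteq> P \<longrightarrow> g = \<zero>\<^bsub>K\<^esub> \<or> ord_at K v g \<ge> 0}"

abbreviation divisor_group :: "('a, 'b) ring_scheme \<Rightarrow> ('a set \<Rightarrow>\<^sub>0 int) monoid" where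
  "divisor_group K \<equiv> free_Abelian_group (primes_of K)"

definition divisor_degree :: "('a, 'b) ring_scheme \<Rightarrow> ('a set \<Rightarrow>\<^sub>0 int) \<Rightarrow> int" where
  "divisor_degree K D =
     (\<Sum>v \<in> Poly_Mapping.keys D. Poly_Mapping.lookup D v * int (prime_degree K v))"

definition principal_divisors :: "('a, 'b) ring_scheme \<Rightarrow> ('a set \<Rightarrow>\<^sub>0 int) set" where
  "principal_divisors K =
     {D \<in> carrier (divisor_group K). \<exists>x \<in> carrier K - {\<zero>\<^bsub>K\<^esub>}.
        \<forall>v \<in> primes_of K. Poly_Mapping.lookup D v = ord_at K v x}"

definition degree_zero_divisors :: "('a, 'b) ring_scheme \<Rightarrow> ('a set \<Rightarrow>\<^sub>0 int) monoid" where
  "degree_zero_divisors K =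
     (divisor_group K)\<lparr>carrier := {D \<in> carrier (divisor_group K). divisor_degree K D = 0}\<rparr>"

definition class_number :: "('a, 'b) ring_scheme \<Rightarrow> nat" where
  "class_number K = order (degree_zero_divisors K Mod principal_divisors K)"

text \<open>\<open>F(\<mu>\<^sub>r)\<close>, formed inside an algebraic closure \<^term>\<open>L\<close> of \<^term>\<open>F\<close>.\<close>

definition adjoin_roots_of_unity ::
    "('a, 'b) ring_scheme \<Rightarrow> 'a set \<Rightarrow> nat \<Rightarrow> ('a, 'b) ring_scheme" where
  "adjoin_roots_of_unity L F r =
     L\<lparr>carrier := generate_field L (F \<union> {z \<in> carrier L. z [^]\<^bsub>L\<^esub> r = \<one>\<^bsub>L\<^esub>})\<rparr>"

end

theory Submission
  imports Defs
begin

text \<open>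
  Take a solution of \<open>X\<^sup>p - Y\<^sup>q = 1\<close> with \<open>p \<noteq> q\<close>, and suppose that \<open>q\<close> does not divide the class number
  of \<open>K = F(\<mu>\<^sub>p)\<close>.  For a \<open>p\<close>-th root of unity \<open>\<zeta>\<close>, the factor \<open>X - \<zeta>\<close> of \<open>X\<^sup>p - 1 = Y\<^sup>q\<close> is coprime to
  the cofactor, because \<open>p \<noteq> l\<close>, and a pole of \<open>X\<close> has order divisible by \<open>q\<close>, because \<open>p \<noteq> q\<close>.  So
  the divisor of \<open>X - \<zeta>\<close> is \<open>q\<close> times a divisor, which is principal by the hypothesis on the class
  number, and \<open>X - \<zeta> = u a\<^sup>q\<close> with a constant \<open>u\<close>.  Doing this for two roots of unity and absorbing
  \<open>u\<close> into the power by adjoining constants gives \<open>U\<^sup>q - W\<^sup>q = c\<close> with a constant \<open>c \<noteq> 0\<close>.  The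
  elements \<open>U - W\<close> and \<open>U - \<eta> W\<close>, with \<open>\<eta> \<noteq> 1\<close> a \<open>q\<close>-th root of unity, divide \<open>c\<close> in a ring of elements
  with poles over \<open>P\<^sub>\<infinity>\<close> only; as \<open>P\<^sub>\<infinity>\<close> has degree 1, it does not split after adjoining constants,
  so the units of that ring are constants.  Hence \<open>U\<close>, \<open>W\<close> and \<open>X\<close> are constant.  The other cases are
  the same: if \<open>p\<close> does not divide the class number of \<open>F(\<mu>\<^sub>q)\<close>, or of \<open>F(\<mu>\<^sub>4)\<close> when \<open>q = 2\<close>, the argument
  applies to \<open>Y\<^sup>q + 1 = X\<^sup>p\<close>, and if \<open>p = q\<close>, the last step applies directly to \<open>X\<close> and \<open>Y\<close>.

  Everything rests on valuation subrings, that is, subrings \<open>V\<close> of a field that contain \<open>x\<close> or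
  \<open>1/x\<close> for every \<open>x\<close>.  By \<open>exists_valuation_subring\<close> (Chevalley) an element is algebraic over a
  subfield \<open>E\<close> iff it lies in every valuation subring containing \<open>E\<close>
  (\<open>algebraic_iff_valuation_subrings\<close>); in particular the constants of a field of characteristic \<open>l\<close>
  are the elements of all its valuation subrings.  In a function field every proper valuation
  subring is discrete (\<open>exists_uniformizer\<close>), a function has finitely many zeros (\<open>finite_zeros\<close>), and
  residue fields are finite over the constants (\<open>residue_field_finite_dimension\<close>); all three follow
  from \<open>linear_relation\<close>, which bounds the number of elements that are linearly independent over
  \<open>k(x)\<close>, with \<open>k\<close> the prime subfield, and controls the coefficients of a relation modulo \<open>x\<close>.

  The theorem that principal divisors have degree 0 is obtained in \<open>degree_of_principal_divisor\<close>
  from the hypothesis on the class number alone.  The order of an infinite group counts as 0, so a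
  class number that is not divisible by some prime says that there are finitely many classes of degree
  0, and then a principal divisor of nonzero degree would produce a function whose divisor is a
  nonzero multiple of a single prime.  General exponents reduce to prime ones because
  \<open>X\<^sup>m = (X\<^bsup>m/p\<^esup>)\<^sup>p\<close>, and \<open>X\<close> is constant if one of its powers is.
\<close>

section \<open>Valuation subrings\<close>

definition valuation_subring :: "('a, 'b) ring_scheme \<Rightarrow> 'a set \<Rightarrow> bool" where
  "valuation_subring K V \<longleftrightarrow> subring V K \<and> (\<forall>x \<in> carrier K. x \<notin> V \<longrightarrow> inv\<^bsub>K\<^esub> x \<in> V)"

text \<open>
  The maximal ideal of a valuation subring.
\<close>

definition nonunits :: "('a, 'b) ring_scheme \<Rightarrow> 'a set \<Rightarrow> 'a set" where
  "nonunits K V = {x \<in> V. x = \<zero>\<^bsub>K\<^esub> \<or> inv\<^bsub>K\<^esub> x \<notin> V}"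

context field
begin

lemma nonzero_inv:
  assumes "x \<in> carrier R" "x \<noteq> \<zero>"
  shows "inv x \<in> carrier R" "inv x \<noteq> \<zero>" "x \<otimes> inv x = \<one>" "inv x \<otimes> x = \<one>" "inv (inv x) = x"
proof -
  have x: "x \<in> Units R" using assms field_Units by simp
  show "inv x \<in> carrier R" "x \<otimes> inv x = \<one>" "inv x \<otimes> x = \<one>" "inv (inv x) = x"
    using x by simp_all
  show "inv x \<noteq> \<zero>" using Units_inv_Units[OF x] field_Units by simp
qed

lemma inv_unique_field:
  assumes "x \<in> carrier R" "y \<in> carrier R" "x \<otimes> y = \<one>"
  shows "inv x = y" "x \<noteq> \<zero>"
proof -
  show "x \<noteq> \<zero>" using assms by auto
  show "inv x = y" using comm_inv_char[OF assms] .
qed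

lemma nonzero_inv_mult:
  assumes "x \<in> carrier R" "x \<noteq> \<zero>" "y \<in> carrier R" "y \<noteq> \<zero>"
  shows "inv (x \<otimes> y) = inv x \<otimes> inv y"
proof (rule inv_unique_field)
  show "x \<otimes> y \<in> carrier R" "inv x \<otimes> inv y \<in> carrier R" using assms nonzero_inv(1) by simp_all
  have "x \<otimes> y \<otimes> (inv x \<otimes> inv y) = (x \<otimes> inv x) \<otimes> (y \<otimes> inv y)"
    using assms nonzero_inv(1) by (simp add: m_ac)
  then show "x \<otimes> y \<otimes> (inv x \<otimes> inv y) = \<one>" using assms nonzero_inv(3) by simp
qed

lemma pow_nonzero:
  assumes "x \<in> carrier R" "x \<noteq> \<zero>"
  shows "x [^] (n::nat) \<noteq> \<zero>"
  by (induction n) (use assms integral_iff in auto)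

lemma eq_of_diff:
  assumes "x \<ominus> y = \<zero>" "x \<in> carrier R" "y \<in> carrier R"
  shows "x = y"
  using assms r_right_minus_eq by auto

lemma valuation_subringD:
  assumes "valuation_subring R V"
  shows "subring V R" "V \<subseteq> carrier R" "\<zero> \<in> V" "\<one> \<in> V"
    and "\<And>a b. \<lbrakk>a \<in> V; b \<in> V\<rbrakk> \<Longrightarrow> a \<oplus> b \<in> V"
    and "\<And>a b. \<lbrakk>a \<in> V; b \<in> V\<rbrakk> \<Longrightarrow> a \<otimes> b \<in> V"
    and "\<And>a. a \<in> V \<Longrightarrow> \<ominus> a \<in> V"
    and "\<And>a b. \<lbrakk>a \<in> V; b \<in> V\<rbrakk> \<Longrightarrow> a \<ominus> b \<in> V"
    and "\<And>a n. a \<in> V \<Longrightarrow> a [^] (n::nat) \<in> V"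
    and "\<And>a. \<lbrakk>a \<in> carrier R; a \<notin> V\<rbrakk> \<Longrightarrow> inv a \<in> V"
    and "\<And>a. a \<in> V \<Longrightarrow> a \<in> carrier R"
proof -
  show V: "subring V R" using assms by (simp add: valuation_subring_def)
  note sub = subringE[OF V]
  show "V \<subseteq> carrier R" "\<zero> \<in> V" "\<one> \<in> V" using sub by auto
  show "\<And>a b. \<lbrakk>a \<in> V; b \<in> V\<rbrakk> \<Longrightarrow> a \<oplus> b \<in> V" "\<And>a. a \<in> V \<Longrightarrow> \<ominus> a \<in> V"
    and m: "\<And>a b. \<lbrakk>a \<in> V; b \<in> V\<rbrakk> \<Longrightarrow> a \<otimes> b \<in> V" using sub by auto
  show "\<And>a b. \<lbrakk>a \<in> V; b \<in> V\<rbrakk> \<Longrightarrow> a \<ominus> b \<in> V" using sub by (auto simp: a_minus_def)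
  show "a [^] (n::nat) \<in> V" if "a \<in> V" for a n using that sub m by (induction n) auto
  show "\<And>a. \<lbrakk>a \<in> carrier R; a \<notin> V\<rbrakk> \<Longrightarrow> inv a \<in> V" using assms by (simp add: valuation_subring_def)
  show "\<And>a. a \<in> V \<Longrightarrow> a \<in> carrier R" using sub by auto
qed

lemma nonunits_sub: "a \<in> nonunits R V \<Longrightarrow> a \<in> V"
  by (simp add: nonunits_def)

lemma zero_nonunit: "valuation_subring R V \<Longrightarrow> \<zero> \<in> nonunits R V"
  by (simp add: nonunits_def valuation_subringD)

lemma one_not_nonunit: "\<one> \<notin> nonunits R V"
  by (simp add: nonunits_def)

lemma nonunits_mult:
  assumes V: "valuation_subring R V" and a: "a \<in> nonunits R V" and b: "b \<in> V"
  shows "a \<otimes> b \<in> nonunits R V" "b \<otimes> a \<in> nonunits R V"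
proof -
  note D = valuation_subringD[OF V]
  have c: "a \<in> carrier R" "b \<in> carrier R" and aV: "a \<in> V" using a b D nonunits_sub by auto
  show *: "a \<otimes> b \<in> nonunits R V"
  proof (rule ccontr)
    assume n: "a \<otimes> b \<notin> nonunits R V"
    have ab: "a \<otimes> b \<in> V" using aV b D by auto
    then have nz: "a \<otimes> b \<noteq> \<zero>" and i: "inv (a \<otimes> b) \<in> V" using n by (auto simp: nonunits_def)
    have nz': "a \<noteq> \<zero>" "b \<noteq> \<zero>" using nz c by auto
    have "b \<otimes> inv (a \<otimes> b) = inv a"
      using m_lcomm[of b "inv a" "inv b"] nz' c nonzero_inv by (simp add: nonzero_inv_mult)
    then have "inv a \<in> V" using D(6)[OF b i] by simp
    then show False using a nz' by (simp add: nonunits_def)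
  qed
  then show "b \<otimes> a \<in> nonunits R V" using c by (simp add: m_comm)
qed

lemma nonunit_inv:
  assumes V: "valuation_subring R V" and x: "x \<in> carrier R" "x \<notin> V"
  shows "inv x \<in> nonunits R V" "x \<noteq> \<zero>"
proof -
  show nz: "x \<noteq> \<zero>" using valuation_subringD[OF V] x by auto
  show "inv x \<in> nonunits R V"
    using valuation_subringD(10)[OF V x] nonzero_inv[OF x(1) nz] x by (simp add: nonunits_def)
qed

text \<open>
  One of two nonzero elements divides the other in \<open>V\<close>, so the sum is a multiple of a nonunit.
\<close>

lemma nonunits_add:
  assumes V: "valuation_subring R V" and a: "a \<in> nonunits R V" and b: "b \<in> nonunits R V"
  shows "a \<oplus> b \<in> nonunits R V"
proof -
  note D = valuation_subringD[OF V]
  have *: "x \<oplus> y \<in> nonunits R V"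
    if x: "x \<in> nonunits R V" and y: "y \<in> nonunits R V" "y \<noteq> \<zero>" and q: "x \<otimes> inv y \<in> V" for x y
  proof -
    have c: "x \<in> carrier R" "y \<in> carrier R" using x y D nonunits_sub by auto
    have "y \<otimes> (x \<otimes> inv y \<oplus> \<one>) = x \<oplus> y"
      using c y nonzero_inv[OF c(2)] by (simp add: r_distr m_lcomm)
    moreover have "x \<otimes> inv y \<oplus> \<one> \<in> V" using q D by auto
    ultimately show ?thesis using nonunits_mult(1)[OF V y(1)] by metis
  qed
  have c: "a \<in> carrier R" "b \<in> carrier R" using a b D nonunits_sub by auto
  show ?thesis
  proof (cases "a = \<zero> \<or> b = \<zero>")
    case True then show ?thesis using a b c by auto
  next
    case False
    show ?thesis
    proof (cases "a \<otimes> inv b \<in> V")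
      case True then show ?thesis using *[OF a b] False by auto
    next
      case nV: False
      have ib: "inv b \<in> carrier R" "inv b \<noteq> \<zero>" "inv (inv b) = b"
        using nonzero_inv[OF c(2)] False by auto
      have "inv (a \<otimes> inv b) \<in> V" using D(10)[OF _ nV] c ib by auto
      also have "inv (a \<otimes> inv b) = b \<otimes> inv a"
        using nonzero_inv_mult[OF c(1) _ ib(1,2)] False c ib(3) nonzero_inv(1)[OF c(1)]
        by (simp add: m_comm)
      finally show ?thesis using *[OF b a] False c by (simp add: a_comm)
    qed
  qed
qed

lemma nonunits_minus:
  assumes V: "valuation_subring R V" and a: "a \<in> nonunits R V"
  shows "\<ominus> a \<in> nonunits R V"
proof -
  note D = valuation_subringD[OF V]
  have "(\<ominus> \<one>) \<otimes> a \<in> nonunits R V" using nonunits_mult(2)[OF V a] D by auto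
  then show ?thesis using nonunits_sub[OF a] D by (simp add: l_minus)
qed

lemma nonunits_diff:
  assumes V: "valuation_subring R V" and a: "a \<in> nonunits R V" and b: "b \<in> nonunits R V"
  shows "a \<ominus> b \<in> nonunits R V"
  using nonunits_add[OF V a nonunits_minus[OF V b]] by (simp add: a_minus_def)

lemma unit_inv_mem:
  assumes V: "valuation_subring R V" and u: "u \<in> V" "u \<notin> nonunits R V"
  shows "u \<noteq> \<zero>" "inv u \<in> V" "inv u \<notin> nonunits R V"
proof -
  show nz: "u \<noteq> \<zero>" "inv u \<in> V" using u by (auto simp: nonunits_def)
  show "inv u \<notin> nonunits R V"
    using nz u nonzero_inv[of u] valuation_subringD(11)[OF V] by (auto simp: nonunits_def)
qed

lemma unit_mult:
  assumes V: "valuation_subring R V" and u: "u \<in> V" "u \<notin> nonunits R V" and v: "v \<in> V" "v \<notin> nonunits R V"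
  shows "u \<otimes> v \<notin> nonunits R V"
proof
  assume n: "u \<otimes> v \<in> nonunits R V"
  note D = valuation_subringD[OF V]
  note iu = unit_inv_mem[OF V u]
  have "inv u \<otimes> (u \<otimes> v) \<in> nonunits R V" using nonunits_mult(2)[OF V n] iu by auto
  moreover have "inv u \<otimes> (u \<otimes> v) = v"
    using D u v nonzero_inv[of u] iu by (simp add: m_assoc[symmetric])
  ultimately show False using v by simp
qed

lemma unit_add_nonunit:
  assumes V: "valuation_subring R V" and u: "u \<in> V" "u \<notin> nonunits R V" and m: "m \<in> nonunits R V"
  shows "u \<oplus> m \<in> V" "u \<oplus> m \<notin> nonunits R V"
proof -
  note D = valuation_subringD[OF V]
  show "u \<oplus> m \<in> V" using u m D nonunits_sub by auto
  show "u \<oplus> m \<notin> nonunits R V"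
  proof
    assume "u \<oplus> m \<in> nonunits R V"
    from nonunits_diff[OF V this m] have "u \<oplus> m \<ominus> m \<in> nonunits R V" .
    moreover have "u \<oplus> m \<ominus> m = u" using u m D nonunits_sub by (simp add: a_minus_def a_assoc r_neg)
    ultimately show False using u by simp
  qed
qed

lemma nonunits_pow:
  assumes V: "valuation_subring R V" and a: "a \<in> nonunits R V" and n: "n > 0"
  shows "a [^] (n::nat) \<in> nonunits R V"
proof -
  obtain k where k: "n = Suc k" using n by (cases n) auto
  show ?thesis unfolding k using nonunits_mult(2)[OF V a] valuation_subringD(9)[OF V nonunits_sub[OF a]]
    by simp
qed

lemma valuation_subring_root_closed:
  assumes V: "valuation_subring R V" and x: "x \<in> carrier R" and p: "x [^] (n::nat) \<in> V" and n: "n > 0"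
  shows "x \<in> V"
proof (rule ccontr)
  assume nV: "x \<notin> V"
  note i = nonunit_inv[OF V x nV]
  have "x [^] n \<otimes> (inv x) [^] n \<in> nonunits R V"
    using nonunits_mult(2)[OF V nonunits_pow[OF V i(1) n] p] .
  moreover have "x [^] n \<otimes> (inv x) [^] n = \<one>"
    using x i nonzero_inv[OF x i(2)] by (simp add: nat_pow_distrib[symmetric])
  ultimately show False using one_not_nonunit by simp
qed

lemma valuation_subring_carrier: "valuation_subring R (carrier R)"
  unfolding valuation_subring_def using carrier_is_subring by auto

end

section \<open>Existence of valuation subrings\<close>

context field
begin

text \<open>
  The values at \<open>x\<close> of the polynomials over \<open>A\<close> of degree at most \<open>n\<close>.  Keeping the degree explicit
  allows the descent on degrees by which Chevalley's theorem is proved.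
\<close>

primrec horner_set :: "'a set \<Rightarrow> 'a \<Rightarrow> nat \<Rightarrow> 'a set" where
  "horner_set A x 0 = A"
| "horner_set A x (Suc n) = {k \<otimes> x \<oplus> a | k a. k \<in> horner_set A x n \<and> a \<in> A}"

lemma horner_set_carrier:
  assumes "subring A R" "x \<in> carrier R" "p \<in> horner_set A x n"
  shows "p \<in> carrier R"
  using assms(3) subringE(1)[OF assms(1)] assms(2) by (induction n arbitrary: p) auto

lemma horner_set_Suc_mono:
  assumes "subring A R" "x \<in> carrier R"
  shows "horner_set A x n \<subseteq> horner_set A x (Suc n)"
proof (induction n)
  case 0
  show ?case
  proof
    fix a assume "a \<in> horner_set A x 0"
    then have "a \<in> A" "a = \<zero> \<otimes> x \<oplus> a" using assms subringE[OF assms(1)] by auto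
    then show "a \<in> horner_set A x (Suc 0)" using subringE(2)[OF assms(1)] by auto
  qed
next
  case (Suc n)
  then show ?case by auto
qed

lemma horner_set_add:
  assumes A: "subring A R" "x \<in> carrier R" and "p \<in> horner_set A x n" "q \<in> horner_set A x n"
  shows "p \<oplus> q \<in> horner_set A x n"
  using assms(3,4)
proof (induction n arbitrary: p q)
  case 0
  then show ?case using subringE(7)[OF A(1)] by auto
next
  case (Suc n)
  obtain k a where p: "p = k \<otimes> x \<oplus> a" "k \<in> horner_set A x n" "a \<in> A" using Suc.prems by auto
  obtain k' a' where q: "q = k' \<otimes> x \<oplus> a'" "k' \<in> horner_set A x n" "a' \<in> A" using Suc.prems by auto
  have c: "k \<in> carrier R" "k' \<in> carrier R" "a \<in> carrier R" "a' \<in> carrier R"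
    using horner_set_carrier[OF A] p q subringE(1)[OF A(1)] by auto
  have "p \<oplus> q = (k \<oplus> k') \<otimes> x \<oplus> (a \<oplus> a')"
    unfolding p q using c A(2) by (simp add: l_distr a_ac)
  then show ?case using Suc.IH[OF p(2) q(2)] subringE(7)[OF A(1) p(3) q(3)] by auto
qed

lemma horner_set_smult:
  assumes A: "subring A R" "x \<in> carrier R" and "p \<in> horner_set A x n" "b \<in> A"
  shows "b \<otimes> p \<in> horner_set A x n"
  using assms(3)
proof (induction n arbitrary: p)
  case 0
  then show ?case using subringE(6)[OF A(1)] assms by auto
next
  case (Suc n)
  obtain k a where p: "p = k \<otimes> x \<oplus> a" "k \<in> horner_set A x n" "a \<in> A" using Suc.prems by auto
  have c: "k \<in> carrier R" "a \<in> carrier R" "b \<in> carrier R"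
    using horner_set_carrier[OF A] p assms subringE(1)[OF A(1)] by auto
  have "b \<otimes> p = (b \<otimes> k) \<otimes> x \<oplus> b \<otimes> a"
    unfolding p using c A(2) by (simp add: r_distr m_ac)
  then show ?case using Suc.IH[OF p(2)] subringE(6)[OF A(1) assms(4) p(3)] by auto
qed

lemma horner_set_monomial:
  assumes A: "subring A R" "x \<in> carrier R" and "a \<in> A"
  shows "x [^] n \<otimes> a \<in> horner_set A x n"
proof (induction n)
  case 0
  then show ?case using assms subringE(1)[OF A(1)] by auto
next
  case (Suc n)
  have c: "a \<in> carrier R" using assms subringE(1)[OF A(1)] by auto
  have "x [^] Suc n \<otimes> a = (x [^] n \<otimes> a) \<otimes> x \<oplus> \<zero>" using c A(2) by (simp add: m_ac)
  then show ?case using Suc subringE(2)[OF A(1)] by fastforce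
qed

lemma horner_set_top:
  assumes A: "subring A R" "x \<in> carrier R" and "p \<in> horner_set A x (Suc n)"
  shows "\<exists>r \<in> horner_set A x n. \<exists>a \<in> A. p = r \<oplus> a \<otimes> x [^] Suc n"
  using assms(3)
proof (induction n arbitrary: p)
  case 0
  then obtain k a where p: "p = k \<otimes> x \<oplus> a" "k \<in> A" "a \<in> A" by auto
  have c: "k \<in> carrier R" "a \<in> carrier R" using p subringE(1)[OF A(1)] by auto
  have "p = a \<oplus> k \<otimes> x [^] Suc 0" using c A(2) by (simp add: p a_comm)
  then show ?case using p by auto
next
  case (Suc n)
  obtain k a where p: "p = k \<otimes> x \<oplus> a" "k \<in> horner_set A x (Suc n)" "a \<in> A"
    using Suc.prems by (auto simp del: horner_set.simps simp: horner_set.simps(2)[of A x "Suc n"])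
  obtain r b where k: "r \<in> horner_set A x n" "b \<in> A" "k = r \<oplus> b \<otimes> x [^] Suc n" using Suc.IH[OF p(2)] by auto
  have c: "r \<in> carrier R" "a \<in> carrier R" "b \<in> carrier R" using horner_set_carrier[OF A k(1)] p k subringE(1)[OF A(1)] by auto
  have "p = (r \<otimes> x \<oplus> a) \<oplus> b \<otimes> x [^] Suc (Suc n)"
    unfolding p k using c A(2) by (simp add: l_distr m_assoc a_ac)
  then show ?case using k p by auto
qed

lemma horner_set_reverse:
  assumes A: "subring A R" "x \<in> carrier R" "y \<in> carrier R" "x \<otimes> y = \<one>"
    and "s \<in> horner_set A y j" "j \<le> i"
  shows "x [^] i \<otimes> s \<in> horner_set A x i"
  using assms(5,6)
proof (induction j arbitrary: s i)
  case 0
  then show ?case using horner_set_monomial[OF A(1,2)] by auto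
next
  case (Suc j)
  obtain k a where p: "s = k \<otimes> y \<oplus> a" "k \<in> horner_set A y j" "a \<in> A" using Suc.prems by auto
  obtain i' where i: "i = Suc i'" using Suc.prems by (cases i) auto
  have c: "k \<in> carrier R" "a \<in> carrier R" using horner_set_carrier[OF A(1,3) p(2)] p subringE(1)[OF A(1)] by auto
  have "x [^] i \<otimes> s = (x [^] i' \<otimes> k) \<otimes> (x \<otimes> y) \<oplus> x [^] i \<otimes> a"
    unfolding p i using c A(2,3) by (simp add: r_distr m_ac)
  then have "x [^] i \<otimes> s = x [^] i' \<otimes> k \<oplus> x [^] i \<otimes> a" using A c by simp
  moreover have "x [^] i' \<otimes> k \<in> horner_set A x i"
    using Suc.IH[OF p(2), of i'] Suc.prems(2) horner_set_Suc_mono[OF A(1,2)] unfolding i by auto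
  moreover have "x [^] i \<otimes> a \<in> horner_set A x i" by (rule horner_set_monomial[OF A(1,2) p(3)])
  ultimately show ?case using horner_set_add[OF A(1,2)] by metis
qed

lemma simple_extension_horner:
  assumes A: "subring A R" "x \<in> carrier R" and "p \<in> simple_extension A x"
  shows "\<exists>n. p \<in> horner_set A x n"
  using assms(3)
proof induction
  case zero
  then show ?case using subringE(2)[OF A(1)] by (intro exI[of _ 0]) auto
next
  case (lin k1 k2)
  then obtain n where "k1 \<in> horner_set A x n" by auto
  then have "k1 \<otimes> x \<oplus> k2 \<in> horner_set A x (Suc n)" using lin by auto
  then show ?case by blast
qed

text \<open>
  The descent step of Chevalley's theorem.  The relation in \<open>y = 1/x\<close> has constant coefficient
  \<open>1 - w b\<close>, a unit of \<open>A\<close>, so it can be solved for 1 as a multiple of \<open>w y\<close>.  After multiplication by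
  a power of \<open>x\<close> it expresses the top power of \<open>x\<close> in the other relation by lower powers.
\<close>

lemma inverse_in_horner_sets_reduce:
  assumes A: "subring A R" and x: "x \<in> carrier R" "y \<in> carrier R" "x \<otimes> y = \<one>"
    and w: "w \<in> A" "w \<noteq> \<zero>" and units: "\<And>a. a \<in> A \<Longrightarrow> inv (\<one> \<ominus> w \<otimes> a) \<in> A \<and> \<one> \<ominus> w \<otimes> a \<noteq> \<zero>"
    and n: "inv w \<in> horner_set A x (Suc n)" and m: "inv w \<in> horner_set A y (Suc m)" and "m \<le> n"
  shows "inv w \<in> horner_set A x n"
proof -
  note sub = subringE[OF A]
  have wc: "w \<in> carrier R" "inv w \<in> carrier R" "w \<otimes> inv w = \<one>"
    using w sub(1) nonzero_inv[of w] by auto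
  obtain s b where sb: "inv w = s \<otimes> y \<oplus> b" "s \<in> horner_set A y m" "b \<in> A" using m by auto
  have c: "s \<in> carrier R" "b \<in> carrier R" using horner_set_carrier[OF A x(2) sb(2)] sb sub by auto
  define e where "e = \<one> \<ominus> w \<otimes> b"
  have e: "inv e \<in> A" "e \<noteq> \<zero>" using units[OF sb(3)] by (auto simp: e_def)
  have ec: "e \<in> carrier R" using c wc by (simp add: e_def)
  have iec: "inv e \<in> carrier R" "inv e \<otimes> e = \<one>" using nonzero_inv[OF ec e(2)] by auto
  have "\<one> = w \<otimes> (s \<otimes> y) \<oplus> w \<otimes> b" using wc(3) c x wc(1) by (simp add: sb(1) r_distr)
  then have "e = w \<otimes> (s \<otimes> y) \<oplus> w \<otimes> b \<ominus> w \<otimes> b" by (simp add: e_def)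
  also have "\<dots> = w \<otimes> (s \<otimes> y)" using c x wc by (simp add: a_minus_def a_assoc r_neg)
  finally have e_eq: "e = w \<otimes> (s \<otimes> y)" .
  define s' where "s' = inv e \<otimes> s"
  have s': "s' \<in> horner_set A y m" unfolding s'_def by (rule horner_set_smult[OF A x(2) sb(2) e(1)])
  have s'c: "s' \<in> carrier R" using c iec by (simp add: s'_def)
  have one: "w \<otimes> (s' \<otimes> y) = \<one>"
  proof -
    have "w \<otimes> (s' \<otimes> y) = inv e \<otimes> (w \<otimes> (s \<otimes> y))" using c iec wc x by (simp add: s'_def m_ac)
    then show ?thesis using e_eq iec by simp
  qed
  obtain r a where ra: "r \<in> horner_set A x n" "a \<in> A" "inv w = r \<oplus> a \<otimes> x [^] Suc n"
    using horner_set_top[OF A x(1) n] by auto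
  have rc: "r \<in> carrier R" "a \<in> carrier R" using horner_set_carrier[OF A x(1) ra(1)] ra sub by auto
  have "x [^] Suc n = x [^] Suc n \<otimes> (w \<otimes> (s' \<otimes> y))" using one x by simp
  also have "\<dots> = w \<otimes> (x [^] n \<otimes> s') \<otimes> (x \<otimes> y)" using x(1,2) s'c wc(1) by (simp add: m_ac)
  also have "\<dots> = w \<otimes> (x [^] n \<otimes> s')" using x s'c wc by simp
  finally have pw: "a \<otimes> x [^] Suc n = (a \<otimes> w) \<otimes> (x [^] n \<otimes> s')" using rc wc x s'c by (simp add: m_assoc)
  have "x [^] n \<otimes> s' \<in> horner_set A x n" by (rule horner_set_reverse[OF A x s' assms(10)])
  then have "(a \<otimes> w) \<otimes> (x [^] n \<otimes> s') \<in> horner_set A x n"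
    by (rule horner_set_smult[OF A x(1)]) (rule subringE(6)[OF A ra(2) w(1)])
  from horner_set_add[OF A x(1) ra(1) this] show ?thesis unfolding ra(3) pw .
qed

lemma inverse_in_horner_sets:
  assumes A: "subring A R" and x: "x \<in> carrier R" "y \<in> carrier R" "x \<otimes> y = \<one>"
    and w: "w \<in> A" "w \<noteq> \<zero>" and units: "\<And>a. a \<in> A \<Longrightarrow> inv (\<one> \<ominus> w \<otimes> a) \<in> A \<and> \<one> \<ominus> w \<otimes> a \<noteq> \<zero>"
    and "inv w \<in> horner_set A x n" and "inv w \<in> horner_set A y m"
  shows "inv w \<in> A"
  using assms(8,9)
proof (induction "n + m" arbitrary: n m rule: less_induct)
  case less
  show ?case
  proof (cases "n = 0 \<or> m = 0")
    case True then show ?thesis using less by auto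
  next
    case False
    then obtain n' m' where nm: "n = Suc n'" "m = Suc m'" by (cases n; cases m) auto
    have yx: "y \<otimes> x = \<one>" using x by (simp add: m_comm)
    show ?thesis
    proof (cases "m' \<le> n'")
      case True
      have "inv w \<in> horner_set A x n'"
        by (rule inverse_in_horner_sets_reduce[OF A x w units]) (use less.prems nm True in auto)
      then show ?thesis using less.hyps[of n' m] less.prems nm by auto
    next
      case False
      have "inv w \<in> horner_set A y m'"
        by (rule inverse_in_horner_sets_reduce[OF A x(2,1) yx w units]) (use less.prems nm False in auto)
      then show ?thesis using less.hyps[of n m'] less.prems nm by auto
    qed
  qed
qed

text \<open>
  Inverting \<open>s = 1 - w a\<close> cannot make \<open>w\<close> invertible: the powers of \<open>s\<close> are again of the form \<open>1 - w c\<close>,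
  so if \<open>s\<^sup>n / w\<close> is in \<open>A\<close>, then so is \<open>1/w\<close>.  By maximality \<open>1/s\<close> is already in \<open>A\<close>.
\<close>

lemma maximal_subring_units:
  assumes A: "subring A R" and w: "w \<in> A" "w \<noteq> \<zero>" "inv w \<notin> A"
    and max: "\<And>B. \<lbrakk>subring B R; A \<subseteq> B; inv w \<notin> B\<rbrakk> \<Longrightarrow> B = A" and a: "a \<in> A"
  shows "\<one> \<ominus> w \<otimes> a \<noteq> \<zero>" "inv (\<one> \<ominus> w \<otimes> a) \<in> A"
proof -
  note sub = subringE[OF A]
  have c: "w \<in> carrier R" "a \<in> carrier R" using w a sub by auto
  note wi = nonzero_inv[OF c(1) w(2)]
  define s where "s = \<one> \<ominus> w \<otimes> a"
  have sA: "s \<in> A" using sub w a by (simp add: s_def a_minus_def)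
  have sc: "s \<in> carrier R" using sA sub by auto
  show nz: "\<one> \<ominus> w \<otimes> a \<noteq> \<zero>"
  proof
    assume "\<one> \<ominus> w \<otimes> a = \<zero>"
    then have "w \<otimes> a = \<one>" using c by (simp add: r_right_minus_eq)
    then have "inv w = a" using inv_unique_field c by blast
    then show False using w a by simp
  qed
  then have snz: "s \<noteq> \<zero>" by (simp add: s_def)
  note si = nonzero_inv[OF sc snz]
  define B where "B = simple_extension A (inv s)"
  have B: "subring B R" "A \<subseteq> B" "inv s \<in> B"
    unfolding B_def using simple_extension_is_subring[OF A si(1)] simple_extension_incl[OF sub(1) si(1)]
      simple_extension_mem[OF A si(1)] by auto
  have pow_s: "\<exists>c \<in> A. s [^] n = \<one> \<ominus> w \<otimes> c" for n :: nat
  proof (induction n)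
    case 0
    have "s [^] (0::nat) = \<one> \<ominus> w \<otimes> \<zero>" using c by (simp add: a_minus_def)
    then show ?case using sub by blast
  next
    case (Suc n)
    then obtain d where d: "d \<in> A" "s [^] n = \<one> \<ominus> w \<otimes> d" by auto
    define t where "t = s [^] n"
    have t: "t = \<one> \<ominus> w \<otimes> d" using d(2) by (simp add: t_def)
    have tA: "t \<in> A" unfolding t using sub w d(1) by (simp add: a_minus_def)
    have dc: "d \<in> carrier R" "t \<in> carrier R" using d tA sub by auto
    have "s [^] Suc n = t \<otimes> (\<one> \<ominus> w \<otimes> a)" by (simp add: t_def s_def)
    also have "\<dots> = t \<ominus> w \<otimes> (a \<otimes> t)"
      using c dc(2) by (simp add: a_minus_def r_distr r_minus m_ac)
    also have "\<dots> = (\<one> \<ominus> w \<otimes> d) \<ominus> w \<otimes> (a \<otimes> t)" by (simp only: t[symmetric])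
    also have "\<dots> = \<one> \<ominus> w \<otimes> (d \<oplus> a \<otimes> t)"
      using c dc by (simp add: a_minus_def r_distr minus_add a_assoc)
    finally show ?case using subringE(7)[OF A d(1) subringE(6)[OF A a tA]] by blast
  qed
  have clear: "\<exists>n::nat. s [^] n \<otimes> y \<in> A" if "y \<in> B" for y
    using that unfolding B_def
  proof induction
    case zero
    then show ?case using sub sc by (intro exI[of _ 0]) auto
  next
    case (lin k1 k2)
    then obtain n :: nat where n: "s [^] n \<otimes> k1 \<in> A" by auto
    have k: "k1 \<in> carrier R" "k2 \<in> carrier R" using lin sub simple_extension_in_carrier[OF sub(1) si(1)] by auto
    have "s [^] Suc n \<otimes> (k1 \<otimes> inv s \<oplus> k2) = (s [^] n \<otimes> k1) \<otimes> (s \<otimes> inv s) \<oplus> s [^] Suc n \<otimes> k2"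
      using k sc si(1) by (simp add: r_distr m_ac)
    also have "\<dots> = s [^] n \<otimes> k1 \<oplus> s [^] Suc n \<otimes> k2" using si sc k by simp
    also have "\<dots> \<in> A"
    proof -
      have "s [^] m \<in> A" for m :: nat using sA sub by (induction m) auto
      from subringE(7)[OF A n subringE(6)[OF A this[of "Suc n"] \<open>k2 \<in> A\<close>]] show ?thesis .
    qed
    finally show ?case by blast
  qed
  have "inv w \<notin> B"
  proof
    assume "inv w \<in> B"
    then obtain n :: nat where n: "s [^] n \<otimes> inv w \<in> A" using clear by auto
    obtain d where d: "d \<in> A" "s [^] n = \<one> \<ominus> w \<otimes> d" using pow_s by auto
    have dc: "d \<in> carrier R" using d sub by auto
    have "s [^] n \<otimes> inv w \<oplus> d = inv w \<ominus> (w \<otimes> inv w) \<otimes> d \<oplus> d"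
      unfolding d using c dc wi(1) by (simp add: a_minus_def l_distr r_distr l_minus r_minus m_ac)
    also have "\<dots> = inv w" using dc wi by (simp add: a_minus_def a_assoc l_neg)
    finally have "inv w \<in> A" using sub n d by metis
    then show False using w by simp
  qed
  then have "B = A" using max B by blast
  then show "inv (\<one> \<ominus> w \<otimes> a) \<in> A" using B by (simp add: s_def)
qed

text \<open>
  Chevalley's existence theorem.  A subring that is maximal among those that contain \<open>A0\<close> but not \<open>1/w\<close>
  is a valuation subring: if it contained neither \<open>x\<close> nor \<open>1/x\<close>, adjoining either of them would make
  \<open>w\<close> invertible, which is impossible by descent on the degrees of the two relations.
\<close>

theorem exists_valuation_subring:
  assumes A0: "subring A0 R" and w: "w \<in> A0" "w \<noteq> \<zero>" "inv w \<notin> A0"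
  shows "\<exists>V. valuation_subring R V \<and> A0 \<subseteq> V \<and> w \<in> nonunits R V"
proof -
  define S where "S = {A. subring A R \<and> A0 \<subseteq> A \<and> inv w \<notin> A}"
  have ne: "S \<noteq> {}" using assms by (auto simp: S_def)
  have "\<Union>C \<in> S" if C: "C \<noteq> {}" "subset.chain S C" for C
  proof -
    have CS: "C \<subseteq> S" and ch: "\<And>A B. A \<in> C \<Longrightarrow> B \<in> C \<Longrightarrow> A \<subseteq> B \<or> B \<subseteq> A"
      using C by (auto simp: subset.chain_def)
    have sub: "subring A R" if "A \<in> C" for A using that CS by (auto simp: S_def)
    have two: "\<exists>A \<in> C. a \<in> A \<and> b \<in> A" if "a \<in> \<Union>C" "b \<in> \<Union>C" for a b
      using that ch by (meson UnionE subsetD)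
    have "subring (\<Union>C) R"
    proof (rule subringI)
      show "\<Union>C \<subseteq> carrier R" using subringE(1)[OF sub] by auto
      obtain A where "A \<in> C" using C(1) by auto
      then show "\<one> \<in> \<Union>C" using subringE(3)[OF sub] by auto
      show "\<ominus> h \<in> \<Union>C" if "h \<in> \<Union>C" for h using that subringE(5)[OF sub] by auto
      fix h1 h2 assume h: "h1 \<in> \<Union>C" "h2 \<in> \<Union>C"
      obtain B where B: "B \<in> C" "h1 \<in> B" "h2 \<in> B" using two[OF h] by auto
      show "h1 \<otimes> h2 \<in> \<Union>C" using subringE(6)[OF sub[OF B(1)] B(2,3)] B(1) by auto
      show "h1 \<oplus> h2 \<in> \<Union>C" using subringE(7)[OF sub[OF B(1)] B(2,3)] B(1) by auto
    qed
    moreover have "A0 \<subseteq> \<Union>C" using C(1) CS by (auto simp: S_def)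
    moreover have "inv w \<notin> \<Union>C" using CS by (auto simp: S_def)
    ultimately show ?thesis by (simp add: S_def)
  qed
  then obtain A where A: "A \<in> S" and max: "\<And>B. B \<in> S \<Longrightarrow> A \<subseteq> B \<Longrightarrow> B = A"
    using subset_Zorn_nonempty[OF ne] by blast
  have sA: "subring A R" "A0 \<subseteq> A" "inv w \<notin> A" using A by (auto simp: S_def)
  have max': "B = A" if "subring B R" "A \<subseteq> B" "inv w \<notin> B" for B
    using max[of B] that sA by (auto simp: S_def)
  have wA: "w \<in> A" using w sA by auto
  note units = maximal_subring_units[OF sA(1) wA w(2) sA(3) max']
  have ext: "\<exists>n. inv w \<in> horner_set A x n" if x: "x \<in> carrier R" "x \<notin> A" for x
  proof -
    have "inv w \<in> simple_extension A x"
      using max'[OF simple_extension_is_subring[OF sA(1) x(1)] simple_extension_incl[OF subringE(1)[OF sA(1)] x(1)]]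
        simple_extension_mem[OF sA(1) x(1)] x(2) by auto
    then show ?thesis by (rule simple_extension_horner[OF sA(1) x(1)])
  qed
  have "inv x \<in> A" if x: "x \<in> carrier R" "x \<notin> A" for x
  proof (rule ccontr)
    assume nx: "inv x \<notin> A"
    have x0: "x \<noteq> \<zero>" using x subringE(2)[OF sA(1)] by auto
    note xi = nonzero_inv[OF x(1) x0]
    obtain n m where "inv w \<in> horner_set A x n" "inv w \<in> horner_set A (inv x) m"
      using ext[OF x] ext[OF xi(1) nx] by auto
    then have "inv w \<in> A"
      using inverse_in_horner_sets[OF sA(1) x(1) xi(1,3) wA w(2)] units by blast
    then show False using sA by simp
  qed
  then have "valuation_subring R A" using sA by (auto simp: valuation_subring_def)
  moreover have "w \<in> nonunits R A" using wA sA by (simp add: nonunits_def)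
  ultimately show ?thesis using sA by blast
qed

end

section \<open>Algebraic elements and elements of a simple transcendental extension\<close>

context field
begin

lemma inverse_in_extension_imp_algebraic:
  assumes E: "subfield E R" and w: "w \<in> carrier R" "w \<noteq> \<zero>" and m: "inv w \<in> simple_extension E w"
  shows "(algebraic over E) w"
proof -
  have Es: "subring E R" "E \<subseteq> carrier R" using subfieldE(1,3)[OF E] by auto
  note wi = nonzero_inv[OF w]
  obtain p where p: "p \<in> carrier (E[X])" "inv w = eval p w"
    using m unfolding simple_extension_as_eval_img[OF Es(2) w(1)] by auto
  have ne: "p \<noteq> []" using p(2) wi(2) by auto
  have pE: "set p \<subseteq> E" "lead_coeff p \<noteq> \<zero>"
    using p(1) ne unfolding univ_poly_carrier[symmetric] polynomial_def by auto
  have "\<ominus> \<one> \<in> E" using subringE(3,5)[OF Es(1)] by auto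
  then have q: "p @ [\<ominus> \<one>] \<in> carrier (E[X])"
    using pE ne unfolding univ_poly_carrier[symmetric] polynomial_def by auto
  have "eval (p @ [\<ominus> \<one>]) w = inv w \<otimes> w \<oplus> \<ominus> \<one>"
    unfolding p(2) by (rule eval_append_aux) (use pE Es w in auto)
  also have "\<dots> = \<zero>" using wi by (simp add: r_neg)
  finally show ?thesis by (rule algebraicI[OF q, rotated]) simp
qed

lemma algebraic_inv:
  assumes E: "subfield E R" and z: "z \<in> carrier R" "z \<noteq> \<zero>" "(algebraic over E) z"
  shows "(algebraic over E) (inv z)"
proof -
  have "subfield (simple_extension E z) R" using simple_extension_is_subfield[OF E z(1)] z(3) by simp
  then have "inv z \<in> simple_extension E z"
    using subfield_m_inv(1) simple_extension_mem[OF subfieldE(1)[OF E] z(1)] z(2) by blast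
  then show ?thesis by (rule simple_extesion_mem_imp_algebraic[OF E z(1,3)])
qed

text \<open>
  If \<open>z\<close> is algebraic and not in \<open>V\<close>, then \<open>1/z\<close> is in \<open>V\<close>, and the field \<open>E[1/z]\<close> lies in \<open>V\<close> and
  contains \<open>z\<close>.  If \<open>z\<close> is transcendental, \<open>1/z\<close> is not invertible in \<open>E[1/z]\<close>, and Chevalley's theorem
  applies.
\<close>

theorem algebraic_iff_valuation_subrings:
  assumes E: "subfield E R" and z: "z \<in> carrier R"
  shows "(algebraic over E) z \<longleftrightarrow> (\<forall>V. valuation_subring R V \<and> E \<subseteq> V \<longrightarrow> z \<in> V)"
proof (intro iffI allI impI)
  fix V assume alg: "(algebraic over E) z" and V: "valuation_subring R V \<and> E \<subseteq> V"
  show "z \<in> V"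
  proof (rule ccontr)
    assume nV: "z \<notin> V"
    note D = valuation_subringD[OF conjunct1[OF V]]
    have z0: "z \<noteq> \<zero>" using nV D by auto
    note zi = nonzero_inv[OF z z0]
    have "(algebraic over E) (inv z)" by (rule algebraic_inv[OF E z z0 alg])
    then have sf: "subfield (simple_extension E (inv z)) R"
      using simple_extension_is_subfield[OF E zi(1)] by simp
    have "inv (inv z) \<in> simple_extension E (inv z)"
      using subfield_m_inv(1)[OF sf] simple_extension_mem[OF subfieldE(1)[OF E] zi(1)] zi(2) by blast
    also have "\<dots> \<subseteq> V"
      by (rule simple_extension_subring_incl) (use V D nV z in auto)
    finally show False using nV zi by simp
  qed
next
  assume all: "\<forall>V. valuation_subring R V \<and> E \<subseteq> V \<longrightarrow> z \<in> V"
  show "(algebraic over E) z"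
  proof (rule ccontr)
    assume nalg: "\<not> (algebraic over E) z"
    have Es: "subring E R" "E \<subseteq> carrier R" using subfieldE(1,3)[OF E] by auto
    have z0: "z \<noteq> \<zero>" using nalg zero_is_algebraic[OF Es(1)] by auto
    note zi = nonzero_inv[OF z z0]
    let ?A = "simple_extension E (inv z)"
    have nA: "z \<notin> ?A"
    proof
      assume "z \<in> ?A"
      then have "(algebraic over E) (inv z)"
        using inverse_in_extension_imp_algebraic[OF E zi(1,2)] zi(5) by simp
      from algebraic_inv[OF E zi(1,2) this] show False using nalg zi(5) by simp
    qed
    obtain V where V: "valuation_subring R V" "?A \<subseteq> V" "inv z \<in> nonunits R V"
      using exists_valuation_subring[OF simple_extension_is_subring[OF Es(1) zi(1)]
          simple_extension_mem[OF Es(1) zi(1)] zi(2)] nA zi(5) by auto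
    have "E \<subseteq> V" using simple_extension_incl[OF Es(2) zi(1)] V(2) by auto
    then have "z \<in> V" using all V by auto
    then show False using V(3) zi by (simp add: nonunits_def)
  qed
qed

lemma extension_mem_decomp:
  assumes E: "subring E R" and x: "x \<in> carrier R" and d: "d \<in> simple_extension E x"
  shows "\<exists>c \<in> E. \<exists>d' \<in> simple_extension E x. d = c \<oplus> x \<otimes> d'"
  using d
proof cases
  case zero
  then have "d = \<zero> \<oplus> x \<otimes> \<zero>" using x by simp
  then show ?thesis using subringE(2)[OF E] by blast
next
  case (lin k1 k2)
  have c: "k1 \<in> carrier R" "k2 \<in> carrier R"
    using lin simple_extension_in_carrier[OF subringE(1)[OF E] x] subringE(1)[OF E] by auto
  have "d = k2 \<oplus> x \<otimes> k1" using lin c x by (simp add: a_comm m_comm)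
  then show ?thesis using lin by blast
qed

lemma extension_mem_order:
  assumes E: "subring E R" and x: "x \<in> carrier R" and d: "d \<in> simple_extension E x" "d \<noteq> \<zero>"
  shows "\<exists>k::nat. \<exists>c \<in> E - {\<zero>}. \<exists>d' \<in> simple_extension E x. d = x [^] k \<otimes> (c \<oplus> x \<otimes> d')"
  using d
proof induction
  case zero
  then show ?case by simp
next
  case (lin k1 k2)
  have c: "k1 \<in> carrier R" "k2 \<in> carrier R"
    using lin simple_extension_in_carrier[OF subringE(1)[OF E] x] subringE(1)[OF E] by auto
  show ?case
  proof (cases "k2 = \<zero>")
    case False
    have "k1 \<otimes> x \<oplus> k2 = x [^] (0::nat) \<otimes> (k2 \<oplus> x \<otimes> k1)" using c x by (simp add: a_comm m_comm)
    then show ?thesis using False lin by blast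
  next
    case True
    have "k1 \<noteq> \<zero>" using lin True x by auto
    then obtain k :: nat and c' d' where *: "c' \<in> E - {\<zero>}" "d' \<in> simple_extension E x" "k1 = x [^] k \<otimes> (c' \<oplus> x \<otimes> d')"
      using lin by blast
    have c': "c' \<in> carrier R" "d' \<in> carrier R"
      using * simple_extension_in_carrier[OF subringE(1)[OF E] x] subringE(1)[OF E] by auto
    have "k1 \<otimes> x \<oplus> k2 = x [^] Suc k \<otimes> (c' \<oplus> x \<otimes> d')"
      unfolding True *(3) using c' x by (simp add: m_ac)
    then show ?thesis using * by blast
  qed
qed

text \<open>
  Common factors \<open>x\<close> are taken out of a family of polynomial expressions in \<open>x\<close> until some constant term
  is not 0.  The process ends because one member, \<open>ds j\<close>, comes with a factorization in which the
  power of \<open>x\<close> is followed by a nonzero constant term; the induction is on that power.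
\<close>

lemma extension_family_order:
  assumes E: "subring E R" and x: "x \<in> carrier R" and j: "j \<in> I"
    and "\<And>i. i \<in> I \<Longrightarrow> ds i \<in> simple_extension E x"
    and "ds j = x [^] (k::nat) \<otimes> (c \<oplus> x \<otimes> d')" "c \<in> E - {\<zero>}" "d' \<in> simple_extension E x"
  shows "\<exists>(k::nat) cs ds'. (\<forall>i \<in> I. cs i \<in> E \<and> ds' i \<in> simple_extension E x \<and> ds i = x [^] k \<otimes> (cs i \<oplus> x \<otimes> ds' i))
           \<and> (\<exists>i \<in> I. cs i \<noteq> \<zero>)"
  using assms(4,5)
proof (induction k arbitrary: ds)
  let ?D = "simple_extension E x"
  have Dc: "a \<in> carrier R" if "a \<in> ?D" for a
    using that simple_extension_in_carrier[OF subringE(1)[OF E] x] by auto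
  have Ec: "a \<in> carrier R" if "a \<in> E" for a using that subringE(1)[OF E] by auto
  have choose: "\<exists>cs ds'. \<forall>i \<in> I. cs i \<in> E \<and> ds' i \<in> ?D \<and> ds i = cs i \<oplus> x \<otimes> ds' i"
    if "\<And>i. i \<in> I \<Longrightarrow> ds i \<in> ?D" for ds
  proof -
    have "\<forall>i \<in> I. \<exists>p. fst p \<in> E \<and> snd p \<in> ?D \<and> ds i = fst p \<oplus> x \<otimes> snd p"
      using extension_mem_decomp[OF E x that] by fastforce
    from bchoice[OF this] obtain f where "\<forall>i \<in> I. fst (f i) \<in> E \<and> snd (f i) \<in> ?D \<and> ds i = fst (f i) \<oplus> x \<otimes> snd (f i)"
      by auto
    then show ?thesis by (intro exI[of _ "\<lambda>i. fst (f i)"] exI[of _ "\<lambda>i. snd (f i)"])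
  qed
  {
    case 0
    obtain cs ds' where *: "\<forall>i \<in> I. cs i \<in> E \<and> ds' i \<in> ?D \<and> ds i = cs i \<oplus> x \<otimes> ds' i"
      using choose[of ds] 0(1) by blast
    let ?cs = "cs(j := c)" and ?ds = "ds'(j := d')"
    have "\<forall>i \<in> I. ?cs i \<in> E \<and> ?ds i \<in> ?D \<and> ds i = x [^] (0::nat) \<otimes> (?cs i \<oplus> x \<otimes> ?ds i)"
      using * 0(2) assms(6,7) Dc Ec x by auto
    moreover have "\<exists>i \<in> I. ?cs i \<noteq> \<zero>" using j assms(6) by (intro bexI[of _ j]) auto
    ultimately show ?case by blast
  next
    case (Suc k)
    obtain cs ds' where *: "\<forall>i \<in> I. cs i \<in> E \<and> ds' i \<in> ?D \<and> ds i = cs i \<oplus> x \<otimes> ds' i"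
      using choose[of ds] Suc(2) by blast
    let ?r = "x [^] k \<otimes> (c \<oplus> x \<otimes> d')"
    have pow: "x [^] n \<otimes> a \<in> ?D" if "a \<in> ?D" for n :: nat and a
    proof -
      note DS = simple_extension_is_subring[OF E x]
      have "x [^] n \<in> ?D"
        using simple_extension_mem[OF E x] subringE(3,6)[OF DS] by (induction n) auto
      then show ?thesis using subringE(6)[OF DS] that by auto
    qed
    have rD: "?r \<in> ?D"
    proof (rule pow)
      have "c \<oplus> x \<otimes> d' = d' \<otimes> x \<oplus> c" using assms(6,7) Dc Ec x by (simp add: a_comm m_comm)
      then show "c \<oplus> x \<otimes> d' \<in> ?D" using simple_extension.lin[of d' E x c] assms(6,7) by auto
    qed
    have ds_j: "ds j = \<zero> \<oplus> x \<otimes> ?r"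
      unfolding Suc(3) using assms(6,7) Dc[of d'] Ec[of c] x by (simp add: m_ac)
    \<comment> \<open>at \<open>j\<close> the given decomposition is used; the chosen one need not reflect the order\<close>
    let ?cs = "cs(j := \<zero>)" and ?ds = "ds'(j := ?r)"
    have new: "\<forall>i \<in> I. ?cs i \<in> E \<and> ?ds i \<in> ?D \<and> ds i = ?cs i \<oplus> x \<otimes> ?ds i"
      using * ds_j rD subringE(2)[OF E] by auto
    show ?case
    proof (cases "\<exists>i \<in> I. ?cs i \<noteq> \<zero>")
      case True
      have "\<forall>i \<in> I. ?cs i \<in> E \<and> ?ds i \<in> ?D \<and> ds i = x [^] (0::nat) \<otimes> (?cs i \<oplus> x \<otimes> ?ds i)"
      proof
        fix i assume i: "i \<in> I"
        then have "?cs i \<in> carrier R" "?ds i \<in> carrier R" using new Dc Ec by blast+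
        then show "?cs i \<in> E \<and> ?ds i \<in> ?D \<and> ds i = x [^] (0::nat) \<otimes> (?cs i \<oplus> x \<otimes> ?ds i)"
          using new i x by simp
      qed
      then show ?thesis using True by blast
    next
      case False
      obtain m :: nat and es fs where ef: "\<forall>i \<in> I. es i \<in> E \<and> fs i \<in> ?D \<and> ?ds i = x [^] m \<otimes> (es i \<oplus> x \<otimes> fs i)"
        "\<exists>i \<in> I. es i \<noteq> \<zero>"
        using Suc.IH[of ?ds] new by auto
      have "ds i = x [^] Suc m \<otimes> (es i \<oplus> x \<otimes> fs i)" if "i \<in> I" for i
      proof -
        have c: "es i \<in> carrier R" "fs i \<in> carrier R" using ef that Dc Ec by blast+
        have "ds i = \<zero> \<oplus> x \<otimes> ?ds i" using new False that by metis
        also have "?ds i = x [^] m \<otimes> (es i \<oplus> x \<otimes> fs i)" using ef that by blast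
        also have "\<zero> \<oplus> x \<otimes> (x [^] m \<otimes> (es i \<oplus> x \<otimes> fs i)) = x [^] Suc m \<otimes> (es i \<oplus> x \<otimes> fs i)"
          using c x by (simp add: m_ac)
        finally show ?thesis .
      qed
      then show ?thesis using ef by blast
    qed
  }
qed

lemma generate_field_fractions:
  assumes x: "x \<in> carrier R" and e: "e \<in> generate_field R {x}"
  shows "\<exists>a \<in> simple_extension (generate_field R {}) x. \<exists>b \<in> simple_extension (generate_field R {}) x - {\<zero>}.
           e \<otimes> b = a"
proof -
  let ?k = "generate_field R {}" and ?D = "simple_extension (generate_field R {}) x"
  have k: "subring ?k R" using subfieldE(1)[OF generate_field_is_subfield[of "{}"]] by simp
  note DS = subringE[OF simple_extension_is_subring[OF k x]]
  have c: "e \<in> carrier R" if "e \<in> generate_field R {x}" for e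
    using generate_field_in_carrier[OF _ that] x by auto
  show ?thesis using e
  proof induction
    case one
    show ?case using DS by (intro bexI[of _ \<one>]) auto
  next
    case (incl h)
    then show ?case using DS simple_extension_mem[OF k x] x by (intro bexI[of _ x] bexI[of _ \<one>]) auto
  next
    case (a_inv h)
    then obtain b where b: "b \<in> ?D" "b \<noteq> \<zero>" "h \<otimes> b \<in> ?D" by auto
    have "(\<ominus> h) \<otimes> b = \<ominus> (h \<otimes> b)" using c[OF a_inv(1)] b DS by (simp add: l_minus subsetD)
    then show ?case using b DS by auto
  next
    case (m_inv h)
    then obtain b where b: "b \<in> ?D" "b \<noteq> \<zero>" "h \<otimes> b \<in> ?D" by auto
    have hc: "h \<in> carrier R" "b \<in> carrier R" using c[OF m_inv(1)] b DS by auto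
    note hi = nonzero_inv[OF hc(1) m_inv(2)]
    have "h \<otimes> b \<noteq> \<zero>" using hc b m_inv integral by auto
    moreover have "inv h \<otimes> (h \<otimes> b) = b" using hc hi by (simp add: m_assoc[symmetric])
    ultimately show ?case using b by (intro bexI[of _ b] bexI[of _ "h \<otimes> b"]) auto
  next
    case (eng_add h1 h2)
    then obtain b1 b2 where b: "b1 \<in> ?D" "b1 \<noteq> \<zero>" "h1 \<otimes> b1 \<in> ?D" "b2 \<in> ?D" "b2 \<noteq> \<zero>" "h2 \<otimes> b2 \<in> ?D" by auto
    have hc: "h1 \<in> carrier R" "h2 \<in> carrier R" "b1 \<in> carrier R" "b2 \<in> carrier R"
      using c[OF eng_add(1)] c[OF eng_add(2)] b DS by auto
    have "(h1 \<oplus> h2) \<otimes> (b1 \<otimes> b2) = (h1 \<otimes> b1) \<otimes> b2 \<oplus> (h2 \<otimes> b2) \<otimes> b1"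
      using hc by (simp add: l_distr r_distr m_ac)
    moreover have "(h1 \<otimes> b1) \<otimes> b2 \<oplus> (h2 \<otimes> b2) \<otimes> b1 \<in> ?D"
      by (intro DS(6,7) b)
    moreover have "b1 \<otimes> b2 \<in> ?D - {\<zero>}" using b DS(6) hc integral by auto
    ultimately show ?case by metis
  next
    case (eng_mult h1 h2)
    then obtain b1 b2 where b: "b1 \<in> ?D" "b1 \<noteq> \<zero>" "h1 \<otimes> b1 \<in> ?D" "b2 \<in> ?D" "b2 \<noteq> \<zero>" "h2 \<otimes> b2 \<in> ?D" by auto
    have hc: "h1 \<in> carrier R" "h2 \<in> carrier R" "b1 \<in> carrier R" "b2 \<in> carrier R"
      using c[OF eng_mult(1)] c[OF eng_mult(2)] b DS by auto
    have "(h1 \<otimes> h2) \<otimes> (b1 \<otimes> b2) = (h1 \<otimes> b1) \<otimes> (h2 \<otimes> b2)"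
      using hc by (simp add: m_ac)
    moreover have "(h1 \<otimes> b1) \<otimes> (h2 \<otimes> b2) \<in> ?D" by (intro DS(6) b)
    moreover have "b1 \<otimes> b2 \<in> ?D - {\<zero>}" using b DS(6) hc integral by auto
    ultimately show ?case by metis
  qed
qed

lemma common_denominator:
  assumes x: "x \<in> carrier R" and e: "set es \<subseteq> generate_field R {x}"
  shows "\<exists>b \<in> simple_extension (generate_field R {}) x - {\<zero>}.
           \<forall>e \<in> set es. e \<otimes> b \<in> simple_extension (generate_field R {}) x"
  using e
proof (induction es)
  let ?k = "generate_field R {}" and ?D = "simple_extension (generate_field R {}) x"
  have k: "subring ?k R" using subfieldE(1)[OF generate_field_is_subfield[of "{}"]] by simp
  note DS = subringE[OF simple_extension_is_subring[OF k x]]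
  {
    case Nil
    then show ?case using DS by (intro bexI[of _ \<one>]) auto
  next
    case (Cons e es)
    obtain b where b: "b \<in> ?D" "b \<noteq> \<zero>" "\<forall>e \<in> set es. e \<otimes> b \<in> ?D" using Cons by auto
    obtain b' where b': "b' \<in> ?D" "b' \<noteq> \<zero>" "e \<otimes> b' \<in> ?D"
      using generate_field_fractions[OF x, of e] Cons by auto
    have hc: "b \<in> carrier R" "b' \<in> carrier R" "\<And>e'. e' \<in> set (e # es) \<Longrightarrow> e' \<in> carrier R"
      using b b' DS(1) generate_field_incl[of "{x}"] Cons.prems x by auto
    have "e \<otimes> (b' \<otimes> b) \<in> ?D" using DS(6)[OF b'(3) b(1)] hc by (simp add: m_assoc)
    moreover have "e' \<otimes> (b' \<otimes> b) \<in> ?D" if "e' \<in> set es" for e'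
    proof -
      have "b' \<otimes> (e' \<otimes> b) \<in> ?D" using DS(6) b' b that by auto
      then show ?thesis using hc that by (simp add: m_lcomm)
    qed
    moreover have "b' \<otimes> b \<in> ?D - {\<zero>}" using b b' DS(6) hc(1,2) by (auto simp: integral_iff)
    ultimately show ?case by (intro bexI[of _ "b' \<otimes> b"]) auto
  }
qed

text \<open>
  A family of elements of \<open>k(x)\<close>, where \<open>k\<close> is the prime subfield, can be multiplied by a common factor so
  that the members become congruent modulo \<open>x\<close> to elements of \<open>k\<close>, not all 0.  The form of the
  result does not depend on a valuation subring, so it can be used for several of them at once.
\<close>

lemma scale_list:
  assumes x: "x \<in> carrier R" "x \<noteq> \<zero>" and es: "set es \<subseteq> generate_field R {x}" "\<not> set es \<subseteq> {\<zero>}"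
  shows "\<exists>\<mu> cs ds. \<mu> \<in> carrier R \<and> \<mu> \<noteq> \<zero> \<and> length cs = length es \<and> length ds = length es \<and>
     set cs \<subseteq> generate_field R {} \<and> set ds \<subseteq> simple_extension (generate_field R {}) x \<and>
     (\<exists>i < length es. cs ! i \<noteq> \<zero>) \<and> (\<forall>i < length es. \<mu> \<otimes> es ! i = cs ! i \<oplus> x \<otimes> ds ! i)"
proof -
  let ?k = "generate_field R {}" and ?D = "simple_extension (generate_field R {}) x"
  have k: "subring ?k R" using subfieldE(1)[OF generate_field_is_subfield[of "{}"]] by simp
  note DS = subringE[OF simple_extension_is_subring[OF k x(1)]]
  obtain b where b: "b \<in> ?D" "b \<noteq> \<zero>" "\<And>e. e \<in> set es \<Longrightarrow> e \<otimes> b \<in> ?D"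
    using common_denominator[OF x(1) es(1)] by auto
  have ec: "e \<in> carrier R" if "e \<in> set es" for e
    using that es(1) generate_field_incl[of "{x}"] x by auto
  have bc: "b \<in> carrier R" using b DS by auto
  obtain j where j: "j < length es" "es ! j \<noteq> \<zero>" using es(2) by (auto simp: set_conv_nth)
  let ?d = "\<lambda>i. es ! i \<otimes> b"
  have dj: "?d j \<in> ?D" "?d j \<noteq> \<zero>" using b j ec[of "es ! j"] bc integral by auto
  obtain m :: nat and c d' where "c \<in> ?k - {\<zero>}" "d' \<in> ?D" "?d j = x [^] m \<otimes> (c \<oplus> x \<otimes> d')"
    using extension_mem_order[OF k x(1) dj] by blast
  with j have "\<exists>(n::nat) cs ds. (\<forall>i \<in> {..<length es}. cs i \<in> ?k \<and> ds i \<in> ?D \<and> ?d i = x [^] n \<otimes> (cs i \<oplus> x \<otimes> ds i))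
           \<and> (\<exists>i \<in> {..<length es}. cs i \<noteq> \<zero>)"
    using extension_family_order[OF k x(1), of j "{..<length es}" ?d m c d'] b(3) by simp
  then obtain n :: nat and cs ds where *: "\<And>i. i < length es \<Longrightarrow> cs i \<in> ?k \<and> ds i \<in> ?D \<and> ?d i = x [^] n \<otimes> (cs i \<oplus> x \<otimes> ds i)"
    "\<exists>i < length es. cs i \<noteq> \<zero>"
    unfolding Ball_def Bex_def lessThan_iff by blast
  have xn: "x [^] n \<in> carrier R" "x [^] n \<noteq> \<zero>" using x pow_nonzero by auto
  note xi = nonzero_inv[OF xn]
  define \<mu> where "\<mu> = inv (x [^] n) \<otimes> b"
  have "\<mu> \<in> carrier R" "\<mu> \<noteq> \<zero>" using xi b bc integral by (auto simp: \<mu>_def)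
  moreover have "\<mu> \<otimes> es ! i = cs i \<oplus> x \<otimes> ds i" if i: "i < length es" for i
  proof -
    have c: "cs i \<in> carrier R" "ds i \<in> carrier R" "es ! i \<in> carrier R"
      using *(1)[OF i] DS(1) subringE(1)[OF k] ec i by auto
    have "\<mu> \<otimes> es ! i = inv (x [^] n) \<otimes> ?d i" using c xi(1) bc by (simp add: \<mu>_def m_ac)
    also have "?d i = x [^] n \<otimes> (cs i \<oplus> x \<otimes> ds i)" using *(1)[OF i] by simp
    also have "inv (x [^] n) \<otimes> (x [^] n \<otimes> (cs i \<oplus> x \<otimes> ds i)) = cs i \<oplus> x \<otimes> ds i"
      using c xi x by (simp add: m_assoc[symmetric])
    finally show ?thesis .
  qed
  moreover have "set (map cs [0..<length es]) \<subseteq> ?k" "set (map ds [0..<length es]) \<subseteq> ?D" using *(1) by auto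
  moreover have "\<exists>i < length es. map cs [0..<length es] ! i \<noteq> \<zero>" using *(2) by auto
  ultimately show ?thesis
    by (intro exI[of _ \<mu>] exI[of _ "map cs [0..<length es]"] exI[of _ "map ds [0..<length es]"]) simp
qed

end

section \<open>Fields of positive characteristic\<close>

locale finite_char_field = field R for R (structure) +
  fixes l :: nat
  assumes l_prime: "Factorial_Ring.prime l" and char_l: "[l] \<cdot> \<one> = \<zero>"

context finite_char_field
begin

lemma prime_subfield_is_subfield: "subfield (prime_subfield R) R"
  unfolding prime_subfield_def by (rule generate_field_is_subfield) simp

lemma multiples_add: "[(n::nat)] \<cdot> \<one> \<oplus> [(m::nat)] \<cdot> \<one> = [(n + m)] \<cdot> \<one>"
  by (simp add: add.nat_pow_mult)

lemma multiples_mult: "[(n::nat)] \<cdot> \<one> \<otimes> [(m::nat)] \<cdot> \<one> = [(n * m)] \<cdot> \<one>"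
  by (simp add: add_pow_ldistr add.nat_pow_pow mult.commute)

lemma multiple_of_char: "[(n * l)] \<cdot> \<one> = \<zero>"
  using multiples_mult[of n l] char_l by simp

lemma multiple_inverse:
  assumes "\<not> l dvd n"
  shows "\<exists>m. [(n::nat)] \<cdot> \<one> \<otimes> [(m::nat)] \<cdot> \<one> = \<one>"
proof -
  have "coprime n l" using assms l_prime by (simp add: coprime_commute prime_imp_coprime)
  moreover have "n \<noteq> 0" using assms by (metis dvd_0_right)
  ultimately obtain x y where xy: "n * x = l * y + 1" using bezout_nat[of n l] by auto
  have "[n] \<cdot> \<one> \<otimes> [x] \<cdot> \<one> = [(y * l + 1)] \<cdot> \<one>"
    by (simp only: multiples_mult xy) (simp add: mult.commute)
  also have "\<dots> = \<one>" using multiples_add[of "y * l" 1] multiple_of_char by simp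
  finally show ?thesis by blast
qed

lemma multiple_eq_zero_iff: "[(n::nat)] \<cdot> \<one> = \<zero> \<longleftrightarrow> l dvd n"
proof
  assume z: "[n] \<cdot> \<one> = \<zero>"
  show "l dvd n"
  proof (rule ccontr)
    assume "\<not> l dvd n"
    from multiple_inverse[OF this] obtain m where "[n] \<cdot> \<one> \<otimes> [(m::nat)] \<cdot> \<one> = \<one>" by auto
    then show False using z by simp
  qed
qed (use multiple_of_char in \<open>auto simp: mult.commute\<close>)

lemma prime_subfield_multiples: "prime_subfield R \<subseteq> range (\<lambda>n::nat. [n] \<cdot> \<one>)"
proof
  fix x assume "x \<in> prime_subfield R"
  then show "x \<in> range (\<lambda>n::nat. [n] \<cdot> \<one>)" unfolding prime_subfield_def
  proof induction
    case one
    show ?case by (rule image_eqI[of _ _ 1]) auto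
  next
    case (incl h)
    then show ?case by simp
  next
    case (a_inv h)
    then obtain n :: nat where h: "h = [n] \<cdot> \<one>" by auto
    have "[n] \<cdot> \<one> \<oplus> [(n * (l - 1))] \<cdot> \<one> = [(n * l)] \<cdot> \<one>"
      using prime_gt_0_nat[OF l_prime] by (simp only: multiples_add) (cases l; simp)
    then have "[n] \<cdot> \<one> \<oplus> [(n * (l - 1))] \<cdot> \<one> = \<zero>" using multiple_of_char by simp
    then have "\<ominus> h = [(n * (l - 1))] \<cdot> \<one>" unfolding h by (intro minus_equality) (auto simp: a_comm)
    then show ?case by blast
  next
    case (m_inv h)
    then obtain n :: nat where h: "h = [n] \<cdot> \<one>" by auto
    have "\<not> l dvd n" using m_inv(2) h multiple_eq_zero_iff by simp
    then obtain m :: nat where m: "[n] \<cdot> \<one> \<otimes> [m] \<cdot> \<one> = \<one>" using multiple_inverse by blast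
    have "inv h = [m] \<cdot> \<one>" unfolding h by (rule inv_unique_field(1)[OF _ _ m]) auto
    then show ?case by blast
  next
    case (eng_add h1 h2)
    then show ?case using multiples_add by fastforce
  next
    case (eng_mult h1 h2)
    then show ?case using multiples_mult by fastforce
  qed
qed

lemma multiple_in_subring:
  assumes V: "subring V R"
  shows "[(n::nat)] \<cdot> \<one> \<in> V"
  by (induction n) (use subringE(2,3,7)[OF V] in auto)

text \<open>
  In characteristic \<open>l\<close> the prime subfield consists of the multiples of 1.  This is what makes every
  valuation subring contain the constants.
\<close>

lemma prime_subfield_subset:
  assumes V: "subring V R"
  shows "prime_subfield R \<subseteq> V"
  using prime_subfield_multiples multiple_in_subring[OF V] by auto

lemma prime_subfield_subset_valuation:
  assumes V: "valuation_subring R V"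
  shows "prime_subfield R \<subseteq> V"
  using prime_subfield_subset valuation_subringD(1)[OF V] by blast

lemma prime_subfield_unit:
  assumes V: "valuation_subring R V" and c: "c \<in> prime_subfield R" "c \<noteq> \<zero>"
  shows "c \<in> V" "c \<notin> nonunits R V"
proof -
  note P = prime_subfield_subset_valuation[OF V]
  show "c \<in> V" using P c by auto
  have "inv c \<in> prime_subfield R" using subfield_m_inv(1)[OF prime_subfield_is_subfield] c by auto
  then show "c \<notin> nonunits R V" using P c by (auto simp: nonunits_def)
qed

lemma constant_iff:
  assumes "z \<in> carrier R"
  shows "(algebraic over prime_subfield R) z \<longleftrightarrow> (\<forall>V. valuation_subring R V \<longrightarrow> z \<in> V)"
  using algebraic_iff_valuation_subrings[OF prime_subfield_is_subfield assms] prime_subfield_subset_valuation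
  by blast

lemma field_of_constants_eq:
  "field_of_constants R = {z \<in> carrier R. \<forall>V. valuation_subring R V \<longrightarrow> z \<in> V}"
  unfolding field_of_constants_def using constant_iff by blast

lemma field_of_constants_subfield: "subfield (field_of_constants R) R"
  unfolding field_of_constants_def by (rule subfield_of_algebraics[OF prime_subfield_is_subfield])

lemma constant_unit:
  assumes V: "valuation_subring R V" and c: "c \<in> field_of_constants R" "c \<noteq> \<zero>"
  shows "c \<in> V" "c \<notin> nonunits R V"
proof -
  show "c \<in> V" using c V field_of_constants_eq by auto
  have "inv c \<in> field_of_constants R" using subfield_m_inv(1)[OF field_of_constants_subfield] c by auto
  then have "inv c \<in> V" using V field_of_constants_eq by auto
  then show "c \<notin> nonunits R V" using c by (auto simp: nonunits_def)
qed

lemma nonunit_transcendental: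
  assumes V: "valuation_subring R V" and z: "z \<in> nonunits R V" "z \<noteq> \<zero>"
  shows "(transcendental over prime_subfield R) z"
proof (rule ccontr)
  assume "\<not> (transcendental over prime_subfield R) z"
  then have "(algebraic over prime_subfield R) z" by (simp add: over_def)
  moreover have "z \<in> carrier R" using nonunits_sub[OF z(1)] valuation_subringD[OF V] by auto
  ultimately have "z \<in> field_of_constants R" by (simp add: field_of_constants_def)
  then show False using constant_unit(2)[OF V] z by auto
qed

end

lemma (in ring) combine_in_subgroup:
  assumes M: "\<zero> \<in> M" "\<And>a b. \<lbrakk>a \<in> M; b \<in> M\<rbrakk> \<Longrightarrow> a \<oplus> b \<in> M"
    and "length es = length ys" "\<And>j. j < length ys \<Longrightarrow> es ! j \<otimes> ys ! j \<in> M"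
  shows "combine es ys \<in> M"
  using assms(3,4)
proof (induction es arbitrary: ys)
  case Nil
  then show ?case using M by simp
next
  case (Cons e es)
  then obtain y ys' where ys: "ys = y # ys'" "length es = length ys'" by (cases ys) auto
  have "combine es ys' \<in> M" using Cons.IH[OF ys(2)] Cons.prems(2) ys by force
  moreover have "e \<otimes> y \<in> M" using Cons.prems(2)[of 0] ys by simp
  ultimately show ?case using M ys by simp
qed

lemma (in ring) combine_split:
  assumes "length es = length ys" "set es \<subseteq> carrier R" "set ys \<subseteq> carrier R" "i < length ys"
  shows "combine es ys = es ! i \<otimes> ys ! i \<oplus> combine (es[i := \<zero>]) ys"
  using assms
proof (induction es arbitrary: ys i)
  case Nil
  then show ?case by simp
next
  case (Cons e es)
  then obtain y ys' where ys: "ys = y # ys'" "length es = length ys'" by (cases ys) auto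
  have c: "e \<in> carrier R" "y \<in> carrier R" "set es \<subseteq> carrier R" "set ys' \<subseteq> carrier R"
    using Cons.prems ys by auto
  then have cc: "combine es ys' \<in> carrier R" by simp
  show ?case
  proof (cases i)
    case 0
    then show ?thesis using ys c cc by simp
  next
    case (Suc k)
    have k: "k < length ys'" using Cons.prems Suc ys by simp
    have s: "set (es[k := \<zero>]) \<subseteq> carrier R" using c set_update_subset_insert[of es k \<zero>] by auto
    have c3: "es ! k \<in> carrier R" "ys' ! k \<in> carrier R" using k c ys nth_mem by force+
    show ?thesis using Cons.IH[OF ys(2) c(3,4) k] ys c c3 Suc combine_in_carrier[OF s c(4)]
      by (simp add: a_lcomm)
  qed
qed

context field
begin

text \<open>
  The ultrametric principle: in a vanishing sum no single term can have strictly smaller order than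
  all the others.  The factor \<open>y\<close> expresses an order larger than that of \<open>1/y\<close> as membership in the maximal ideal.
\<close>

lemma combine_dominated:
  assumes V: "valuation_subring R V" and len: "length es = length ys"
    and c: "set es \<subseteq> carrier R" "set ys \<subseteq> carrier R" and z: "combine es ys = \<zero>"
    and i: "i < length ys" "y \<in> carrier R"
    and dom: "\<And>j. \<lbrakk>j < length ys; j \<noteq> i\<rbrakk> \<Longrightarrow> es ! j \<otimes> ys ! j \<otimes> y \<in> nonunits R V"
  shows "es ! i \<otimes> ys ! i \<otimes> y \<in> nonunits R V"
proof -
  note D = valuation_subringD[OF V]
  define M where "M = {a \<in> carrier R. a \<otimes> y \<in> nonunits R V}"
  have M0: "\<zero> \<in> M" using zero_nonunit[OF V] i by (simp add: M_def)
  have Ma: "a \<oplus> b \<in> M" if "a \<in> M" "b \<in> M" for a b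
    using that nonunits_add[OF V] i by (auto simp: M_def l_distr)
  have nth: "es ! j \<in> carrier R" "ys ! j \<in> carrier R" if "j < length ys" for j
    using that c len nth_mem by force+
  have "combine (es[i := \<zero>]) ys \<in> M"
  proof (rule combine_in_subgroup[OF M0 Ma])
    fix j assume j: "j < length ys"
    show "es[i := \<zero>] ! j \<otimes> ys ! j \<in> M"
    proof (cases "j = i")
      case True
      then show ?thesis using M0 nth j len by simp
    next
      case False
      then show ?thesis using dom[OF j False] nth[OF j] by (simp add: M_def)
    qed
  qed (use len in auto)
  then have m: "combine (es[i := \<zero>]) ys \<in> carrier R" "combine (es[i := \<zero>]) ys \<otimes> y \<in> nonunits R V"
    by (auto simp: M_def)
  have "es ! i \<otimes> ys ! i \<oplus> combine (es[i := \<zero>]) ys = \<zero>"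
    using combine_split[OF len c i(1)] z by simp
  then have "es ! i \<otimes> ys ! i = \<ominus> combine (es[i := \<zero>]) ys"
    using m(1) nth[OF i(1)] by (simp add: minus_equality)
  then have "es ! i \<otimes> ys ! i \<otimes> y = \<ominus> (combine (es[i := \<zero>]) ys \<otimes> y)"
    using m(1) i by (simp add: l_minus)
  then show ?thesis using nonunits_minus[OF V m(2)] by simp
qed

lemma eval_scale:
  assumes "length cs = length p" "length ds = length p" "set p \<subseteq> carrier R"
    "set cs \<subseteq> carrier R" "set ds \<subseteq> carrier R" "\<mu> \<in> carrier R" "w \<in> carrier R" "x \<in> carrier R"
    "\<forall>i < length p. \<mu> \<otimes> p ! i = cs ! i \<oplus> w \<otimes> ds ! i"
  shows "\<mu> \<otimes> eval p x = eval cs x \<oplus> w \<otimes> eval ds x"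
  using assms
proof (induction p arbitrary: cs ds)
  case Nil
  then show ?case by simp
next
  case (Cons a p)
  from Cons.prems(1,2) obtain c cs' d ds' where cd: "cs = c # cs'" "ds = d # ds'"
    by (metis length_Suc_conv length_Cons)
  have rel: "\<forall>i < length p. \<mu> \<otimes> p ! i = cs' ! i \<oplus> w \<otimes> ds' ! i"
    using Cons.prems(9) cd by (metis Suc_less_eq length_Cons nth_Cons_Suc)
  have IH: "\<mu> \<otimes> eval p x = eval cs' x \<oplus> w \<otimes> eval ds' x"
    by (rule Cons.IH) (use Cons.prems(1-8) cd rel in auto)
  have h: "\<mu> \<otimes> a = c \<oplus> w \<otimes> d" using Cons.prems(9)[rule_format, of 0] cd by simp
  have len: "length cs' = length p" "length ds' = length p" using Cons.prems(1,2) cd by auto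
  have carr: "a \<in> carrier R" "c \<in> carrier R" "d \<in> carrier R" "\<mu> \<in> carrier R" "w \<in> carrier R" "x \<in> carrier R"
    "eval p x \<in> carrier R" "eval cs' x \<in> carrier R" "eval ds' x \<in> carrier R" 
    using Cons.prems(3-8) cd by (auto intro: eval_in_carrier)
  let ?X = "x [^] length p"
  have "\<mu> \<otimes> eval (a # p) x = (\<mu> \<otimes> a) \<otimes> ?X \<oplus> \<mu> \<otimes> eval p x"
    using carr by (simp add: r_distr m_assoc)
  also have "\<dots> = (c \<otimes> ?X \<oplus> eval cs' x) \<oplus> w \<otimes> (d \<otimes> ?X \<oplus> eval ds' x)"
    unfolding h IH using carr by (simp add: r_distr l_distr m_assoc a_ac)
  finally show ?case using cd len by simp
qed

lemma normalize_Nil_imp: "normalize p = [] \<Longrightarrow> set p \<subseteq> {\<zero>}"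
  by (induction p) (auto split: if_splits)

lemma transcendental_eval_nonzero:
  assumes E: "subfield E R" and x: "x \<in> carrier R" "(transcendental over E) x"
    and p: "set p \<subseteq> E" "\<not> set p \<subseteq> {\<zero>}"
  shows "eval p x \<noteq> \<zero>"
proof
  assume z: "eval p x = \<zero>"
  have "normalize p \<in> carrier (E[X])"
    using normalize_gives_polynomial[OF p(1)] by (simp add: univ_poly_carrier)
  moreover have "eval (normalize p) x = \<zero>"
    using eval_normalize[OF _ x(1)] p subfieldE(3)[OF E] z by auto
  ultimately have "normalize p = []" using eval_transcendental[OF x(2)] by blast
  then show False using normalize_Nil_imp[of p] p(2) by simp
qed

end

section \<open>Linear relations in function fields\<close>

locale function_field = field R for R (structure) +
  fixes l :: nat
  assumes gff: "global_function_field l R"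

sublocale function_field \<subseteq> finite_char_field
  by unfold_locales (use gff in \<open>auto simp: global_function_field_def\<close>)

context function_field
begin

text \<open>
  The exchange property for transcendence bases.  If \<open>t\<close> were transcendental over \<open>k(x)\<close>, some valuation
  subring would contain \<open>k(x)\<close> and have \<open>w = 1/t\<close> as a nonunit.  An equation of \<open>x\<close> over \<open>k(w)\<close>, scaled
  and reduced modulo \<open>w\<close>, shows that a nonzero polynomial over \<open>k\<close> takes a nonunit value at \<open>x\<close>.  But that value
  is a nonzero element of \<open>k(x)\<close>, hence a unit.
\<close>

lemma exchange:
  assumes t: "t \<in> carrier R" and x: "x \<in> carrier R" "(transcendental over prime_subfield R) x"
    and alg: "(algebraic over generate_field R {t}) x"
  shows "(algebraic over generate_field R {x}) t"
proof -
  let ?k = "generate_field R {}"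
  have k_eq: "prime_subfield R = ?k" by (simp add: prime_subfield_def)
  have Ex: "subfield (generate_field R {x}) R" by (rule generate_field_is_subfield) (use x in auto)
  have "t \<in> V" if V: "valuation_subring R V" "generate_field R {x} \<subseteq> V" for V
  proof (rule ccontr)
    assume nV: "t \<notin> V"
    note D = valuation_subringD[OF V(1)]
    define w where "w = inv t"
    have w: "w \<in> nonunits R V" "t \<noteq> \<zero>" using nonunit_inv[OF V(1) t nV] by (auto simp: w_def)
    have wc: "w \<in> carrier R" "w \<noteq> \<zero>" "inv w = t" using nonzero_inv[OF t w(2)] by (auto simp: w_def)
    have Ew: "subfield (generate_field R {w}) R" by (rule generate_field_is_subfield) (use wc in auto)
    have "t \<in> generate_field R {w}"
      using generate_field.m_inv[OF generate_field.incl[of w "{w}" R] wc(2)] wc(3) by simp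
    then have "generate_field R {t} \<subseteq> generate_field R {w}"
      by (intro generate_field_min_subfield1 Ew) (use t in auto)
    then have "(algebraic over generate_field R {w}) x" by (rule algebraic_mono[OF _ alg])
    then obtain p where p: "p \<in> carrier ((generate_field R {w})[X])" "p \<noteq> []" "eval p x = \<zero>"
      using algebraicE[OF subfieldE(1)[OF Ew] x(1)] by blast
    have pE': "set p \<subseteq> generate_field R {w}" "lead_coeff p \<noteq> \<zero>"
      using p(1,2) unfolding univ_poly_carrier[symmetric] polynomial_def by auto
    then have pE: "set p \<subseteq> generate_field R {w}" "\<not> set p \<subseteq> {\<zero>}"
      using hd_in_set[OF p(2)] by blast+
    obtain \<mu> cs ds where s: "\<mu> \<in> carrier R" "\<mu> \<noteq> \<zero>" "length cs = length p" "length ds = length p"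
      "set cs \<subseteq> ?k" "set ds \<subseteq> simple_extension ?k w" "\<exists>i < length p. cs ! i \<noteq> \<zero>"
      "\<forall>i < length p. \<mu> \<otimes> p ! i = cs ! i \<oplus> w \<otimes> ds ! i"
      using scale_list[OF wc(1,2) pE] by blast
    have kV: "?k \<subseteq> V" using prime_subfield_subset_valuation[OF V(1)] k_eq by simp
    have dV: "set ds \<subseteq> V"
      using s(6) simple_extension_subring_incl[OF D(1) kV nonunits_sub[OF w(1)]] by auto
    have xV: "x \<in> V" using V(2) generate_field.incl[of x "{x}" R] by auto
    have evV: "eval qs x \<in> H" if "subring H R" "x \<in> H" "set qs \<subseteq> H" for qs H
      using that(3)
    proof (induction qs)
      case (Cons a qs)
      have "x [^] n \<in> H" for n :: nat using that(1,2) subringE(3,6)[OF that(1)] by (induction n) auto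
      then show ?case using Cons subringE(6,7)[OF that(1)] by simp
    qed (use subringE(2)[OF that(1)] in simp)
    have "\<mu> \<otimes> eval p x = eval cs x \<oplus> w \<otimes> eval ds x"
      by (rule eval_scale) (use s pE generate_field_incl[of "{w}"] generate_field_incl[of "{}"] dV D(2) wc x in auto)
    then have z: "eval cs x \<oplus> w \<otimes> eval ds x = \<zero>" using p(3) s(1) by simp
    have ec: "eval cs x \<in> carrier R" "eval ds x \<in> V"
      using evV[OF D(1) xV] dV s(5) kV D(2) by auto
    have "eval cs x = \<ominus> (w \<otimes> eval ds x)"
      using z ec D(11) wc(1) by (simp add: minus_equality)
    then have nu: "eval cs x \<in> nonunits R V"
      using nonunits_minus[OF V(1) nonunits_mult(1)[OF V(1) w(1) ec(2)]] by simp
    obtain i where "i < length cs" "cs ! i \<noteq> \<zero>" using s(3,7) by auto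
    then have "\<not> set cs \<subseteq> {\<zero>}" using nth_mem[of i cs] by blast
    then have nz: "eval cs x \<noteq> \<zero>"
      using transcendental_eval_nonzero[OF prime_subfield_is_subfield x] s(5) k_eq by simp
    have "?k \<subseteq> generate_field R {x}" using mono_generate_field[of "{}" "{x}"] x by auto
    then have "eval cs x \<in> generate_field R {x}"
      using evV[OF subfieldE(1)[OF Ex] generate_field.incl[of x "{x}" R]] s(5) by auto
    then have "inv (eval cs x) \<in> V" using generate_field.m_inv[OF _ nz] V(2) by blast
    then show False using nu nz by (simp add: nonunits_def)
  qed
  then show ?thesis using algebraic_iff_valuation_subrings[OF Ex t] by blast
qed

lemma algebraic_over_transcendental:
  assumes x: "x \<in> carrier R" "(transcendental over prime_subfield R) x" and y: "y \<in> carrier R"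
  shows "(algebraic over generate_field R {x}) y"
proof -
  obtain t where t: "t \<in> carrier R" "\<forall>x \<in> carrier R. (algebraic over generate_field R {t}) x"
    using gff by (auto simp: global_function_field_def)
  have Ex: "subfield (generate_field R {x}) R" by (rule generate_field_is_subfield) (use x in auto)
  have Et: "subfield (generate_field R {t}) R" by (rule generate_field_is_subfield) (use t in auto)
  have "(algebraic over generate_field R {x}) t" using exchange[OF t(1) x] t(2) x(1) by blast
  then have "generate_field R {t} \<subseteq> {z \<in> carrier R. (algebraic over generate_field R {x}) z}"
    by (intro generate_field_min_subfield1 subfield_of_algebraics[OF Ex]) (use t in auto)
  then have "generate_field R {t} \<subseteq> V" if "valuation_subring R V" "generate_field R {x} \<subseteq> V" for V
    using algebraic_iff_valuation_subrings[OF Ex] that by blast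
  then show ?thesis
    using algebraic_iff_valuation_subrings[OF Ex y] algebraic_iff_valuation_subrings[OF Et y] t(2) y by blast
qed

lemma finite_over_transcendental:
  assumes x: "x \<in> carrier R" "(transcendental over prime_subfield R) x"
  shows "finite_dimension (generate_field R {x}) (carrier R)"
proof -
  obtain S where S: "finite S" "S \<subseteq> carrier R" "carrier R = generate_field R S"
    using gff by (auto simp: global_function_field_def)
  obtain xs where xs: "set xs = S" using S(1) finite_list by auto
  have Ex: "subfield (generate_field R {x}) R" by (rule generate_field_is_subfield) (use x in auto)
  let ?M = "finite_extension (generate_field R {x}) xs"
  have alg: "\<And>y. y \<in> set xs \<Longrightarrow> (algebraic over generate_field R {x}) y"
    using algebraic_over_transcendental[OF x] S xs by auto
  have M: "subfield ?M R" by (rule finite_extension_is_subfield[OF Ex _ alg]) (use xs S in auto)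
  have "S \<subseteq> ?M" using finite_extension_mem[OF subfieldE(1)[OF Ex]] xs S by auto
  then have "carrier R \<subseteq> ?M" using generate_field_min_subfield1[OF S(2) M] S(3) by simp
  then have "?M = carrier R" using subfieldE(3)[OF M] by auto
  moreover have "finite_dimension (generate_field R {x}) ?M"
    by (rule finite_extension_finite_dimension(1)[OF Ex _ alg]) (use xs S in auto)
  ultimately show ?thesis by simp
qed

text \<open>
  The only place where the finiteness of function fields over \<open>k(x)\<close> enters the study of their primes.
  At every valuation subring that has \<open>x\<close> as a nonunit, the coefficients \<open>es\<close> are integral, and they are
  units exactly where the constant part \<open>cs\<close> is not 0.
\<close>

lemma linear_relation:
  assumes x: "x \<in> carrier R" "(transcendental over prime_subfield R) x"
  shows "\<exists>N. \<forall>ys. set ys \<subseteq> carrier R \<and> length ys > N \<longrightarrow>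
     (\<exists>es cs ds. length es = length ys \<and> length cs = length ys \<and> length ds = length ys \<and>
       set es \<subseteq> carrier R \<and> set cs \<subseteq> prime_subfield R \<and> set ds \<subseteq> simple_extension (prime_subfield R) x \<and>
       combine es ys = \<zero> \<and> (\<exists>i < length ys. cs ! i \<noteq> \<zero>) \<and>
       (\<forall>i < length ys. es ! i = cs ! i \<oplus> x \<otimes> ds ! i))"
proof -
  let ?E = "generate_field R {x}"
  have Ex: "subfield ?E R" by (rule generate_field_is_subfield) (use x in auto)
  obtain N where N: "dimension N ?E (carrier R)" using finite_over_transcendental[OF x] by (auto simp: finite_dimension_def)
  have x0: "x \<noteq> \<zero>" using x(2) zero_is_algebraic[OF subfieldE(1)[OF prime_subfield_is_subfield]] by (auto simp: over_def)
  show ?thesis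
  proof (rule exI[of _ N], intro allI impI)
    fix ys assume ys: "set ys \<subseteq> carrier R \<and> length ys > N"
    then have "dependent ?E ys" using independent_length_le_dimension[OF Ex N] by (meson leD)
    then obtain Ks where Ks: "length Ks = length ys" "combine Ks ys = \<zero>" "set Ks \<subseteq> ?E" "set Ks \<noteq> {\<zero>}"
      using dependent_imp_non_trivial_combine[OF Ex conjunct1[OF ys]] by metis
    have nz: "\<not> set Ks \<subseteq> {\<zero>}" using Ks(1,4) ys by (cases Ks) (auto simp: subset_singleton_iff)
    obtain \<mu> cs ds where s: "\<mu> \<in> carrier R" "\<mu> \<noteq> \<zero>" "length cs = length Ks" "length ds = length Ks"
      "set cs \<subseteq> generate_field R {}" "set ds \<subseteq> simple_extension (generate_field R {}) x" "\<exists>i < length Ks. cs ! i \<noteq> \<zero>"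
      "\<forall>i < length Ks. \<mu> \<otimes> Ks ! i = cs ! i \<oplus> x \<otimes> ds ! i"
      using scale_list[OF x(1) x0 Ks(3) nz] by blast
    have Kc: "set Ks \<subseteq> carrier R" using Ks(3) subfieldE(3)[OF Ex] by auto
    let ?es = "map ((\<otimes>) \<mu>) Ks"
    have "combine ?es ys = \<mu> \<otimes> combine Ks ys" using combine_r_distr[OF Kc _ s(1)] ys by auto
    then have comb: "combine ?es ys = \<zero>" using Ks(2) s(1) by simp
    show "\<exists>es cs ds. length es = length ys \<and> length cs = length ys \<and> length ds = length ys \<and>
       set es \<subseteq> carrier R \<and> set cs \<subseteq> prime_subfield R \<and> set ds \<subseteq> simple_extension (prime_subfield R) x \<and>
       combine es ys = \<zero> \<and> (\<exists>i < length ys. cs ! i \<noteq> \<zero>) \<and>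
       (\<forall>i < length ys. es ! i = cs ! i \<oplus> x \<otimes> ds ! i)"
      unfolding prime_subfield_def
      by (rule exI[of _ ?es], rule exI[of _ cs], rule exI[of _ ds]) (use comb s Ks Kc in auto)
  qed
qed

end

section \<open>Valuation subrings of function fields are discrete\<close>

definition uniformizer :: "('a, 'b) ring_scheme \<Rightarrow> 'a set \<Rightarrow> 'a \<Rightarrow> bool" where
  "uniformizer K V \<pi> \<longleftrightarrow> \<pi> \<in> nonunits K V \<and> \<pi> \<noteq> \<zero>\<^bsub>K\<^esub> \<and>
     (\<forall>z \<in> carrier K - {\<zero>\<^bsub>K\<^esub>}. \<exists>n::int. \<exists>u \<in> V - nonunits K V. z = u \<otimes>\<^bsub>K\<^esub> \<pi> [^]\<^bsub>K\<^esub> n)"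

context field
begin

lemma int_pow_mult_of:
  assumes "x \<in> carrier R" "x \<noteq> \<zero>"
  shows "x [^]\<^bsub>Multiplicative_Group.mult_of R\<^esub> (n::int) = x [^] n"
proof -
  have *: "x [^] k \<in> carrier (Multiplicative_Group.mult_of R)" for k :: nat using assms pow_nonzero by simp
  show ?thesis unfolding int_pow_def2 Multiplicative_Group.nat_pow_mult_of by (simp only: m_inv_mult_of[OF *])
qed

lemma int_pow_field:
  assumes x: "x \<in> carrier R" "x \<noteq> \<zero>"
  shows "x [^] (n::int) \<in> carrier R" "x [^] n \<noteq> \<zero>"
    and "x [^] (n + m) = x [^] n \<otimes> x [^] (m::int)"
    and "x [^] (- n) = inv (x [^] n)"
    and "x [^] (int k) = x [^] k"
    and "x [^] (0::int) = \<one>" "x [^] (1::int) = x"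
proof -
  interpret M: group "Multiplicative_Group.mult_of R" by (rule field_mult_group)
  have xM: "x \<in> carrier (Multiplicative_Group.mult_of R)" using x by simp
  have *: "x [^] n \<in> carrier R \<and> x [^] n \<noteq> \<zero>" for n :: int
    using M.int_pow_closed[OF xM, of n] int_pow_mult_of[OF x] by auto
  then show "x [^] n \<in> carrier R" "x [^] n \<noteq> \<zero>" by auto
  show "x [^] (n + m) = x [^] n \<otimes> x [^] m" using M.int_pow_mult[OF xM, of n m] int_pow_mult_of[OF x] by simp
  show "x [^] (- n) = inv (x [^] n)"
    using M.int_pow_neg[OF xM, of n] int_pow_mult_of[OF x] m_inv_mult_of * by simp
  show "x [^] (int k) = x [^] k" by (rule int_pow_int)
  show "x [^] (0::int) = \<one>" by simp
  show "x [^] (1::int) = x" using x int_pow_int[of R x 1] by simp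
qed

lemma unit_pow:
  assumes V: "valuation_subring R V" and u: "u \<in> V - nonunits R V"
  shows "u [^] (n::int) \<in> V - nonunits R V"
proof -
  note D = valuation_subringD[OF V]
  have uc: "u \<in> carrier R" "u \<noteq> \<zero>" using u D unit_inv_mem(1)[OF V] by auto
  have nat: "w [^] (k::nat) \<in> V - nonunits R V" if "w \<in> V - nonunits R V" for k w
    using that D one_not_nonunit unit_mult[OF V] by (induction k) auto
  show ?thesis
  proof (cases n)
    case (nonneg k)
    then show ?thesis using nat[OF u, of k] int_pow_field(5)[OF uc] by simp
  next
    case (neg k)
    have "u [^] Suc k \<in> V - nonunits R V" by (rule nat[OF u])
    then have "inv (u [^] Suc k) \<in> V - nonunits R V" using unit_inv_mem[OF V] by auto
    then show ?thesis using int_pow_field(4)[OF uc, of "int (Suc k)"] int_pow_field(5)[OF uc, of "Suc k"] neg by simp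
  qed
qed

lemma uniformizer_pow_pos:
  assumes V: "valuation_subring R V" and p: "\<pi> \<in> nonunits R V" "\<pi> \<noteq> \<zero>" and n: "(n::int) > 0"
  shows "\<pi> [^] n \<in> nonunits R V"
proof -
  have c: "\<pi> \<in> carrier R" using nonunits_sub[OF p(1)] valuation_subringD(11)[OF V] by auto
  obtain k where k: "n = int k" "k > 0" using n by (metis zero_less_imp_eq_int)
  show ?thesis using nonunits_pow[OF V p(1) k(2)] int_pow_field(5)[OF c p(2)] k by simp
qed

lemma unit_times_pow_mem:
  assumes V: "valuation_subring R V" and p: "\<pi> \<in> nonunits R V" "\<pi> \<noteq> \<zero>"
    and u: "u \<in> V - nonunits R V"
  shows "u \<otimes> \<pi> [^] (n::int) \<in> nonunits R V \<longleftrightarrow> n > 0" "u \<otimes> \<pi> [^] n \<in> V \<longleftrightarrow> n \<ge> 0"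
proof -
  note D = valuation_subringD[OF V]
  have c: "\<pi> \<in> carrier R" using nonunits_sub[OF p(1)] D(11) by auto
  note ip = int_pow_field[OF c p(2)]
  have uc: "u \<in> carrier R" "u \<noteq> \<zero>" using u D(11) unit_inv_mem(1)[OF V] by auto
  have pos: "u \<otimes> \<pi> [^] n \<in> nonunits R V" if "n > 0" for n :: int
    using nonunits_mult(2)[OF V uniformizer_pow_pos[OF V p that]] u by auto
  have zero: "u \<otimes> \<pi> [^] (0::int) = u" using uc by simp
  have neg: "u \<otimes> \<pi> [^] n \<notin> V" if n: "n < 0" for n :: int
  proof
    assume h: "u \<otimes> \<pi> [^] n \<in> V"
    have "\<pi> [^] (-n) \<in> nonunits R V" by (rule uniformizer_pow_pos[OF V p]) (use n in simp)
    then have "(u \<otimes> \<pi> [^] n) \<otimes> \<pi> [^] (-n) \<in> nonunits R V" using nonunits_mult(2)[OF V _ h] by auto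
    moreover have "(u \<otimes> \<pi> [^] n) \<otimes> \<pi> [^] (-n) = u"
      using uc ip(1) ip(3)[of n "-n", symmetric] by (simp add: m_assoc)
    ultimately show False using u by simp
  qed
  show "u \<otimes> \<pi> [^] n \<in> nonunits R V \<longleftrightarrow> n > 0"
    using pos[of n] zero neg[of n] u nonunits_sub by (metis DiffD2 linorder_neqE)
  show "u \<otimes> \<pi> [^] n \<in> V \<longleftrightarrow> n \<ge> 0"
    using pos[of n] zero neg[of n] u nonunits_sub by (metis DiffD1 linorder_not_le order_le_less)
qed

lemma uniformizer_exponent_unique:
  assumes V: "valuation_subring R V" and p: "\<pi> \<in> nonunits R V" "\<pi> \<noteq> \<zero>"
    and u: "u \<in> V - nonunits R V" "w \<in> V - nonunits R V" and eq: "u \<otimes> \<pi> [^] (n::int) = w \<otimes> \<pi> [^] (m::int)"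
  shows "n = m"
proof -
  note D = valuation_subringD[OF V]
  have c: "\<pi> \<in> carrier R" using nonunits_sub[OF p(1)] D(11) by auto
  note ip = int_pow_field[OF c p(2)]
  have uc: "u \<in> carrier R" "w \<in> carrier R" using u D(11) by auto
  have shift: "a \<otimes> \<pi> [^] i \<otimes> \<pi> [^] (-j) = a \<otimes> \<pi> [^] (i - j)" if "a \<in> carrier R" for a and i j :: int
    using that ip(1) ip(3)[of i "-j"] by (simp add: m_assoc)
  have e1: "u \<otimes> \<pi> [^] (n - m) = w"
    using shift[OF uc(1), of n m] shift[OF uc(2), of m m] eq uc by simp
  have e2: "w \<otimes> \<pi> [^] (m - n) = u"
    using shift[OF uc(2), of m n] shift[OF uc(1), of n n] eq uc by simp
  have "\<not> n - m > 0" "\<not> m - n > 0"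
    using unit_times_pow_mem(1)[OF V p] e1 e2 u by (metis DiffD2)+
  then show ?thesis by simp
qed

lemma Units_subring:
  assumes V: "valuation_subring R V"
  shows "Units (R\<lparr>carrier := V\<rparr>) = V - nonunits R V"
proof
  note D = valuation_subringD[OF V]
  show "Units (R\<lparr>carrier := V\<rparr>) \<subseteq> V - nonunits R V"
  proof
    fix u assume "u \<in> Units (R\<lparr>carrier := V\<rparr>)"
    then obtain w where w: "u \<in> V" "w \<in> V" "u \<otimes> w = \<one>" by (auto simp: Units_def)
    then have "inv u = w" "u \<noteq> \<zero>" using inv_unique_field[of u w] D(11) by auto
    then show "u \<in> V - nonunits R V" using w by (simp add: nonunits_def)
  qed
  show "V - nonunits R V \<subseteq> Units (R\<lparr>carrier := V\<rparr>)"
  proof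
    fix u assume u: "u \<in> V - nonunits R V"
    then have i: "u \<noteq> \<zero>" "inv u \<in> V" using unit_inv_mem[OF V] by auto
    then show "u \<in> Units (R\<lparr>carrier := V\<rparr>)"
      using u nonzero_inv(3,4)[of u] D(11) by (auto simp: Units_def intro!: bexI[of _ "inv u"])
  qed
qed

text \<open>
  For \<open>x = a/b\<close> divide \<open>a\<close> and \<open>b\<close> by a generator of the ideal that they span; the quotients span the unit
  ideal, so one of them is outside the only maximal ideal and is a unit.
\<close>

lemma discrete_imp_valuation:
  assumes A: "discrete_valuation_subring R A"
  shows "valuation_subring R A" "A \<noteq> carrier R"
    and "\<And>v. maximalideal v (R\<lparr>carrier := A\<rparr>) \<Longrightarrow> v = nonunits R A"
proof -
  let ?A = "R\<lparr>carrier := A\<rparr>"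
  have sub: "subring A R" and pd: "principal_domain ?A" and nf: "\<not> field ?A"
    and uniq: "\<exists>!v. maximalideal v ?A"
    and frac: "carrier R = {a \<otimes> inv b | a b. a \<in> A \<and> b \<in> A - {\<zero>}}"
    using A by (auto simp: discrete_valuation_subring_def discrete_valuation_ring_def)
  interpret A: principal_domain ?A by (rule pd)
  note S = subringE[OF sub]
  show neq: "A \<noteq> carrier R"
  proof
    assume "A = carrier R"
    then have "?A = R" by simp
    then show False using nf field_axioms by simp
  qed
  obtain v where v: "maximalideal v ?A" and only: "\<And>w. maximalideal w ?A \<Longrightarrow> w = v" using uniq by blast
  interpret v: maximalideal v ?A by (rule v)
  have vsub: "v \<subseteq> A" using v.a_subset by simp
  have unit_iff: "u \<in> Units ?A \<longleftrightarrow> u \<in> A \<and> u \<noteq> \<zero> \<and> inv u \<in> A" for u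
  proof
    assume "u \<in> Units ?A"
    then obtain w where w: "u \<in> A" "w \<in> A" "u \<otimes> w = \<one>" by (auto simp: Units_def)
    then have "inv u = w" "u \<noteq> \<zero>" using inv_unique_field[of u w] S(1) by auto
    then show "u \<in> A \<and> u \<noteq> \<zero> \<and> inv u \<in> A" using w by simp
  next
    assume "u \<in> A \<and> u \<noteq> \<zero> \<and> inv u \<in> A"
    then show "u \<in> Units ?A" using nonzero_inv(3,4)[of u] S(1) by (auto simp: Units_def intro!: bexI[of _ "inv u"])
  qed
  have v_eq: "v = nonunits R A"
  proof
    show "v \<subseteq> nonunits R A"
    proof
      fix a assume a: "a \<in> v"
      have "a \<notin> Units ?A"
      proof
        assume u: "a \<in> Units ?A"
        then have "inv a \<in> A" "a \<noteq> \<zero>" "a \<in> A" using unit_iff by auto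
        then have "inv a \<otimes> a = \<one>" using nonzero_inv[of a] S(1) by auto
        then have "\<one> \<in> v" using v.I_l_closed[OF a, of "inv a"] \<open>inv a \<in> A\<close> by simp
        then have "v = carrier ?A" using v.one_imp_carrier by simp
        then show False using v.I_notcarr by simp
      qed
      then show "a \<in> nonunits R A" using a vsub unit_iff by (auto simp: nonunits_def)
    qed
    show "nonunits R A \<subseteq> v"
    proof
      fix a assume a: "a \<in> nonunits R A"
      show "a \<in> v"
      proof (cases "a = \<zero>")
        case True
        then show ?thesis using v.a_subgroup additive_subgroup.zero_closed[OF v.is_additive_subgroup] by simp
      next
        case False
        have nu: "a \<in> carrier ?A - {\<zero>\<^bsub>?A\<^esub>}" "a \<notin> Units ?A"
          using a False unit_iff by (auto simp: nonunits_def)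
        obtain b where b: "b \<in> carrier ?A" "ring_irreducible\<^bsub>?A\<^esub> b" "b divides\<^bsub>?A\<^esub> a"
          using A.exists_irreducible_divisor[OF nu] by blast
        have "PIdl\<^bsub>?A\<^esub> b = v" using only A.irreducible_imp_maximalideal[OF b(1,2)] by blast
        moreover have "a \<in> PIdl\<^bsub>?A\<^esub> b"
          using b(1,3) S(1) by (auto simp: factor_def cgenideal_def) (use m_comm in blast)
        ultimately show ?thesis by simp
      qed
    qed
  qed
  show "w = nonunits R A" if "maximalideal w ?A" for w using only[OF that] v_eq by simp
  show "valuation_subring R A"
    unfolding valuation_subring_def
  proof (intro conjI sub ballI impI)
    fix x assume x: "x \<in> carrier R" "x \<notin> A"
    then obtain a b where ab: "x = a \<otimes> inv b" "a \<in> A" "b \<in> A" "b \<noteq> \<zero>" using frac by blast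
    have c: "a \<in> carrier R" "b \<in> carrier R" using ab S(1) by auto
    let ?I = "PIdl\<^bsub>?A\<^esub> a <+>\<^bsub>?A\<^esub> PIdl\<^bsub>?A\<^esub> b"
    have "ideal ?I ?A" by (intro A.add_ideals A.cgenideal_ideal) (use ab in auto)
    then obtain d where d: "d \<in> A" "?I = PIdl\<^bsub>?A\<^esub> d" using A.exists_gen by auto
    have I_eq: "?I = {r \<otimes> a \<oplus> s \<otimes> b | r s. r \<in> A \<and> s \<in> A}"
      by (auto simp: set_add_def' cgenideal_def)
    have "a = \<one> \<otimes> a \<oplus> \<zero> \<otimes> b" "b = \<zero> \<otimes> a \<oplus> \<one> \<otimes> b" using c by auto
    then have "a \<in> ?I" "b \<in> ?I" unfolding I_eq using S(2,3) by blast+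
    then obtain a' b' where a': "a' \<in> A" "a = a' \<otimes> d" and b': "b' \<in> A" "b = b' \<otimes> d"
      using d by (auto simp: cgenideal_def)
    have "d = \<one> \<otimes> d" using d S(1) by auto
    then have "d \<in> PIdl\<^bsub>?A\<^esub> d" using S(3) by (auto simp: cgenideal_def)
    then have "d \<in> ?I" using d(2) by simp
    then obtain r s where rs: "r \<in> A" "s \<in> A" "d = r \<otimes> a \<oplus> s \<otimes> b" unfolding I_eq by blast
    have cc: "a' \<in> carrier R" "b' \<in> carrier R" "r \<in> carrier R" "s \<in> carrier R" "d \<in> carrier R"
      using a'(1) b'(1) rs(1,2) d(1) S(1) by auto
    have d0: "d \<noteq> \<zero>" using ab(4) b'(2) cc(2) by auto
    have "r \<otimes> a \<oplus> s \<otimes> b = (r \<otimes> a' \<oplus> s \<otimes> b') \<otimes> d"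
      unfolding a'(2) b'(2) using cc by (simp add: l_distr m_assoc)
    then have "\<one> \<otimes> d = (r \<otimes> a' \<oplus> s \<otimes> b') \<otimes> d" using rs(3) cc(5) by (metis l_one)
    then have one: "\<one> = r \<otimes> a' \<oplus> s \<otimes> b'" using m_rcancel[OF d0 cc(5), of \<one> "r \<otimes> a' \<oplus> s \<otimes> b'"] cc(1-4)
      by (simp del: l_one)
    have "\<not> (a' \<in> nonunits R A \<and> b' \<in> nonunits R A)"
    proof
      assume "a' \<in> nonunits R A \<and> b' \<in> nonunits R A"
      then have "a' \<in> v" "b' \<in> v" using v_eq by auto
      then have "r \<otimes> a' \<in> v" "s \<otimes> b' \<in> v" using v.I_l_closed rs by auto
      then have "\<one> \<in> v" using additive_subgroup.a_closed[OF v.is_additive_subgroup] one by simp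
      then show False using one_not_nonunit v_eq by auto
    qed
    then consider "a' \<noteq> \<zero>" "inv a' \<in> A" | "b' \<noteq> \<zero>" "inv b' \<in> A" using a' b' by (auto simp: nonunits_def)
    then show "inv x \<in> A"
    proof cases
      case 1
      have b'0: "b' \<noteq> \<zero>" using ab(4) b'(2) cc(5) by auto
      note i = nonzero_inv[OF cc(1) 1(1)] nonzero_inv[OF cc(2) b'0] nonzero_inv[OF cc(5) d0]
      have "x = a' \<otimes> inv b'"
        unfolding ab(1) a'(2) b'(2) nonzero_inv_mult[OF cc(2) b'0 cc(5) d0]
        using m_assoc[of "a'" d "inv b' \<otimes> inv d"] m_lcomm[of d "inv b'" "inv d"] i cc by simp
      then have "x \<otimes> (b' \<otimes> inv a') = (a' \<otimes> inv a') \<otimes> (inv b' \<otimes> b')"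
        using i(1,6) cc by (simp add: m_ac)
      then have "x \<otimes> (b' \<otimes> inv a') = \<one>" using i by simp
      then have "inv x = b' \<otimes> inv a'" using inv_unique_field(1)[OF x(1)] cc i by simp
      then show ?thesis using S(6)[OF b'(1) 1(2)] by simp
    next
      case 2
      note i = nonzero_inv[OF cc(2) 2(1)] nonzero_inv[OF cc(5) d0]
      have "x = a' \<otimes> inv b'"
        unfolding ab(1) a'(2) b'(2) nonzero_inv_mult[OF cc(2) 2(1) cc(5) d0]
        using m_assoc[of "a'" d "inv b' \<otimes> inv d"] m_lcomm[of d "inv b'" "inv d"] i cc by simp
      then have "x \<in> A" using S(6)[OF a'(1) 2(2)] by simp
      then show ?thesis using x by simp
    qed
  qed
qed

text \<open>
  A nonzero ideal is generated by the smallest power of the uniformizer that it contains.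
\<close>

lemma uniformizer_imp_discrete:
  assumes V: "valuation_subring R V" and p: "uniformizer R V \<pi>"
  shows "discrete_valuation_subring R V" "maximalideal (nonunits R V) (R\<lparr>carrier := V\<rparr>)"
proof -
  note D = valuation_subringD[OF V]
  let ?V = "R\<lparr>carrier := V\<rparr>"
  have pn: "\<pi> \<in> nonunits R V" "\<pi> \<noteq> \<zero>" using p by (auto simp: uniformizer_def)
  have pc: "\<pi> \<in> V" "\<pi> \<in> carrier R" using nonunits_sub[OF pn(1)] D(11) by auto
  note ip = int_pow_field[OF pc(2) pn(2)]
  interpret V: domain ?V by (rule subring_is_domain[OF D(1)])
  have minus_V: "\<ominus>\<^bsub>?V\<^esub> a = \<ominus> a" if "a \<in> V" for a
  proof (rule V.minus_equality)
    show "\<ominus> a \<oplus>\<^bsub>?V\<^esub> a = \<zero>\<^bsub>?V\<^esub>" using that D(11) by (simp add: l_neg)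
  qed (use that D(7) in auto)
  have decomp: "\<exists>n::nat. \<exists>u \<in> V - nonunits R V. z = u \<otimes> \<pi> [^] n" if z: "z \<in> V" "z \<noteq> \<zero>" for z
  proof -
    have "z \<in> carrier R - {\<zero>}" using z D(11) by simp
    then obtain n :: int and u where u: "u \<in> V - nonunits R V" "z = u \<otimes> \<pi> [^] n"
      using p unfolding uniformizer_def by blast
    then have "n \<ge> 0" using unit_times_pow_mem(2)[OF V pn u(1)] z by simp
    then have "\<pi> [^] n = \<pi> [^] (nat n)" using ip(5)[of "nat n"] by simp
    then show ?thesis using u by auto
  qed
  have principal: "\<exists>a \<in> carrier ?V. I = PIdl\<^bsub>?V\<^esub> a" if I: "ideal I ?V" for I
  proof -
    interpret I: ideal I ?V by (rule I)
    have IV: "I \<subseteq> V" using I.a_subset by simp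
    have I0: "\<zero> \<in> I" using additive_subgroup.zero_closed[OF I.is_additive_subgroup] by simp
    show ?thesis
    proof (cases "I = {\<zero>}")
      case True
      have "\<exists>x. \<zero> = x \<otimes> \<zero> \<and> x \<in> V" using D(3) by (intro exI[of _ \<zero>]) simp
      then have "I = PIdl\<^bsub>?V\<^esub> \<zero>" using True D(3,11) by (auto simp: cgenideal_def)
      then show ?thesis using D(3) by auto
    next
      case False
      define n where "n = (LEAST n. \<pi> [^] (n::nat) \<in> I)"
      have ex: "\<pi> [^] (k::nat) \<in> I" if "u \<in> V - nonunits R V" "u \<otimes> \<pi> [^] k \<in> I" for u k
      proof -
        have iu: "inv u \<in> V" "u \<noteq> \<zero>" "u \<in> carrier R" using unit_inv_mem[OF V] that D(11) by auto
        have "inv u \<otimes> (u \<otimes> \<pi> [^] k) = \<pi> [^] k"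
          using iu nonzero_inv[OF iu(3,2)] pc by (simp add: m_assoc[symmetric])
        then show ?thesis using I.I_l_closed[OF that(2), of "inv u"] iu by simp
      qed
      obtain z where z: "z \<in> I" "z \<noteq> \<zero>" using False I0 by auto
      obtain k :: nat and u where u: "u \<in> V - nonunits R V" "z = u \<otimes> \<pi> [^] k" using decomp[of z] z IV by auto
      have "\<pi> [^] k \<in> I" using ex[OF u(1)] u(2) z(1) by simp
      then have n: "\<pi> [^] n \<in> I" and least: "\<And>m::nat. \<pi> [^] m \<in> I \<Longrightarrow> n \<le> m"
        unfolding n_def by (auto intro: LeastI Least_le)
      have "I = PIdl\<^bsub>?V\<^esub> (\<pi> [^] n)"
      proof
        show "I \<subseteq> PIdl\<^bsub>?V\<^esub> (\<pi> [^] n)"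
        proof
          fix a assume a: "a \<in> I"
          show "a \<in> PIdl\<^bsub>?V\<^esub> (\<pi> [^] n)"
          proof (cases "a = \<zero>")
            case True
            have "\<zero> = \<zero> \<otimes> \<pi> [^] n" using pc by simp
            then show ?thesis using True D(3) by (auto simp: cgenideal_def)
          next
            case False
            obtain m :: nat and w where w: "w \<in> V - nonunits R V" "a = w \<otimes> \<pi> [^] m" using decomp[of a] a False IV by auto
            have "\<pi> [^] m \<in> I" using ex[OF w(1)] w(2) a by simp
            then have "m = (m - n) + n" using least by simp
            then have "\<pi> [^] m = \<pi> [^] (m - n) \<otimes> \<pi> [^] n" using pc by (metis nat_pow_mult)
            then have "a = (w \<otimes> \<pi> [^] (m - n)) \<otimes> \<pi> [^] n" using w D(11) pc by (simp add: m_assoc)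
            moreover have "w \<otimes> \<pi> [^] (m - n) \<in> V" using w D(6,9) pc by blast
            ultimately show ?thesis by (auto simp: cgenideal_def)
          qed
        qed
        show "PIdl\<^bsub>?V\<^esub> (\<pi> [^] n) \<subseteq> I" using I.I_l_closed[OF n] by (auto simp: cgenideal_def)
      qed
      then show ?thesis using D(9)[OF pc(1)] by auto
    qed
  qed
  have pd: "principal_domain ?V"
    using principal V.domain_axioms unfolding principal_domain_def principal_domain_axioms_def by blast
  have U: "Units ?V = V - nonunits R V" by (rule Units_subring[OF V])
  have nf: "\<not> field ?V"
  proof
    assume f: "field ?V"
    have "Units ?V = V - {\<zero>}" using field.field_Units[OF f] by simp
    then show False using U pn pc by auto
  qed
  have idl: "ideal (nonunits R V) ?V"
  proof (rule idealI)
    show "ring ?V" by (rule V.ring_axioms)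
    show "subgroup (nonunits R V) (add_monoid ?V)"
    proof (rule V.add.subgroupI)
      show "nonunits R V \<subseteq> carrier ?V" using nonunits_sub by auto
      show "nonunits R V \<noteq> {}" using pn by auto
      show "\<ominus>\<^bsub>?V\<^esub> a \<in> nonunits R V" if "a \<in> nonunits R V" for a
        using nonunits_minus[OF V that] minus_V[OF nonunits_sub[OF that]] by simp
      show "a \<oplus>\<^bsub>?V\<^esub> b \<in> nonunits R V" if "a \<in> nonunits R V" "b \<in> nonunits R V" for a b
        using nonunits_add[OF V that] by simp
    qed
  qed (use nonunits_mult[OF V] in auto)
  have unit_ideal: "J = V" if J: "ideal J ?V" and u: "u \<in> J" "u \<in> V - nonunits R V" for J u
  proof -
    interpret J: ideal J ?V by (rule J)
    have "inv u \<in> V" "u \<noteq> \<zero>" "u \<in> carrier R" using unit_inv_mem[OF V] u D(11) by auto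
    then have "inv u \<otimes> u = \<one>" "inv u \<in> V" using nonzero_inv by auto
    then have "\<one>\<^bsub>?V\<^esub> \<in> J" using J.I_l_closed[OF u(1), of "inv u"] by simp
    then show ?thesis using J.one_imp_carrier by simp
  qed
  show mx: "maximalideal (nonunits R V) ?V"
  proof (rule maximalidealI[OF idl])
    show "carrier ?V \<noteq> nonunits R V" using one_not_nonunit D(4) by auto
    fix J assume J: "ideal J ?V" "nonunits R V \<subseteq> J" "J \<subseteq> carrier ?V"
    show "J = nonunits R V \<or> J = carrier ?V"
    proof (cases "J \<subseteq> nonunits R V")
      case False
      then obtain u where "u \<in> J" "u \<in> V - nonunits R V" using J(3) by auto
      then show ?thesis using unit_ideal[OF J(1)] by auto
    qed (use J in auto)
  qed
  have uniq: "M = nonunits R V" if M: "maximalideal M ?V" for M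
  proof -
    interpret M: maximalideal M ?V by (rule M)
    have MV: "M \<subseteq> V" using M.a_subset by simp
    have "M \<subseteq> nonunits R V"
    proof
      fix a assume a: "a \<in> M"
      show "a \<in> nonunits R V"
      proof (rule ccontr)
        assume "a \<notin> nonunits R V"
        then have "M = V" using unit_ideal[OF M.ideal_axioms a] a MV by auto
        then show False using M.I_notcarr by simp
      qed
    qed
    moreover have "nonunits R V \<subseteq> carrier ?V" using nonunits_sub by auto
    moreover have "nonunits R V \<noteq> carrier ?V" using one_not_nonunit D(4) by auto
    ultimately show ?thesis using M.I_maximal[OF idl] by auto
  qed
  have frac: "carrier R = {a \<otimes> inv b | a b. a \<in> V \<and> b \<in> V - {\<zero>}}"
  proof
    show "carrier R \<subseteq> {a \<otimes> inv b | a b. a \<in> V \<and> b \<in> V - {\<zero>}}"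
    proof
      fix x assume x: "x \<in> carrier R"
      show "x \<in> {a \<otimes> inv b | a b. a \<in> V \<and> b \<in> V - {\<zero>}}"
      proof (cases "x \<in> V")
        case True
        have "x = x \<otimes> inv \<one>" using x by simp
        moreover have "\<one> \<in> V - {\<zero>}" using D(4) by simp
        ultimately show ?thesis using True by blast
      next
        case False
        note i = nonunit_inv[OF V x False]
        have "x = \<one> \<otimes> inv (inv x)" using x nonzero_inv[OF x i(2)] by simp
        moreover have "inv x \<in> V - {\<zero>}" using i(1) nonunits_sub nonzero_inv[OF x i(2)] by auto
        ultimately show ?thesis using D(4) by blast
      qed
    qed
    show "{a \<otimes> inv b | a b. a \<in> V \<and> b \<in> V - {\<zero>}} \<subseteq> carrier R"
      using D(11) nonzero_inv(1) by auto
  qed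
  show "discrete_valuation_subring R V"
    unfolding discrete_valuation_subring_def discrete_valuation_ring_def
    using D(1) pd nf mx uniq frac by blast
qed

end

context function_field
begin

lemma simple_extension_prime_subset:
  assumes V: "valuation_subring R V" and x: "x \<in> V"
  shows "simple_extension (prime_subfield R) x \<subseteq> V"
  using simple_extension_subring_incl[OF valuation_subringD(1)[OF V] prime_subfield_subset_valuation[OF V] x] .

lemma relation_coeffs:
  assumes V: "valuation_subring R V" and x: "x \<in> nonunits R V"
    and c: "c \<in> prime_subfield R" and d: "d \<in> simple_extension (prime_subfield R) x"
  shows "c \<oplus> x \<otimes> d \<in> V" "c \<noteq> \<zero> \<Longrightarrow> c \<oplus> x \<otimes> d \<notin> nonunits R V" "x \<otimes> d \<in> nonunits R V" "d \<in> V"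
proof -
  note D = valuation_subringD[OF V]
  show dV: "d \<in> V" using simple_extension_prime_subset[OF V nonunits_sub[OF x]] d by auto
  show m: "x \<otimes> d \<in> nonunits R V" by (rule nonunits_mult(1)[OF V x dV])
  show "c \<oplus> x \<otimes> d \<in> V" using prime_subfield_subset_valuation[OF V] c nonunits_sub[OF m] D(5) by auto
  show "c \<oplus> x \<otimes> d \<notin> nonunits R V" if "c \<noteq> \<zero>"
    using unit_add_nonunit(2)[OF V _ _ m] prime_subfield_unit[OF V c that] by auto
qed

text \<open>
  A chain of elements, each strictly divisible by the next, starting from \<open>z\<close> is linearly
  independent over \<open>k(z)\<close>: in a relation the last term with a nonzero constant part dominates.  The
  terms after it have coefficients divisible by \<open>z\<close>, which is divisible by every member of the chain.
\<close>

lemma chain_bound: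
  assumes V: "valuation_subring R V" and z: "z \<in> nonunits R V" "z \<noteq> \<zero>"
  shows "\<exists>N. \<not> (\<exists>y::nat \<Rightarrow> 'a. y 0 = z \<and> (\<forall>i \<le> N. y i \<in> nonunits R V \<and> y i \<noteq> \<zero>) \<and>
     (\<forall>i < N. y i \<otimes> inv (y (Suc i)) \<in> nonunits R V))"
proof -
  note D = valuation_subringD[OF V]
  have zc: "z \<in> carrier R" using nonunits_sub[OF z(1)] D(11) by auto
  obtain N where N: "\<And>ys. set ys \<subseteq> carrier R \<Longrightarrow> length ys > N \<Longrightarrow>
     (\<exists>es cs ds. length es = length ys \<and> length cs = length ys \<and> length ds = length ys \<and>
       set es \<subseteq> carrier R \<and> set cs \<subseteq> prime_subfield R \<and> set ds \<subseteq> simple_extension (prime_subfield R) z \<and>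
       combine es ys = \<zero> \<and> (\<exists>i < length ys. cs ! i \<noteq> \<zero>) \<and>
       (\<forall>i < length ys. es ! i = cs ! i \<oplus> z \<otimes> ds ! i))"
    using linear_relation[OF zc nonunit_transcendental[OF V z]] by blast
  show ?thesis
  proof (intro exI notI)
    assume "\<exists>y::nat \<Rightarrow> 'a. y 0 = z \<and> (\<forall>i \<le> N. y i \<in> nonunits R V \<and> y i \<noteq> \<zero>) \<and>
     (\<forall>i < N. y i \<otimes> inv (y (Suc i)) \<in> nonunits R V)"
    then obtain y :: "nat \<Rightarrow> 'a" where y0: "y 0 = z" and yn: "\<And>i. i \<le> N \<Longrightarrow> y i \<in> nonunits R V \<and> y i \<noteq> \<zero>"
      and step: "\<And>i. i < N \<Longrightarrow> y i \<otimes> inv (y (Suc i)) \<in> nonunits R V" by auto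
    have yc: "y i \<in> carrier R" if "i \<le> N" for i using yn[OF that] nonunits_sub D(11) by auto
    note yi = nonzero_inv[OF yc conjunct2[OF yn]]
    have chain: "y i \<otimes> inv (y (i + Suc k)) \<in> nonunits R V" if "i + Suc k \<le> N" for i k
      using that
    proof (induction k)
      case 0
      then show ?case using step[of i] by simp
    next
      case (Suc k)
      let ?j = "i + Suc k"
      have h: "y i \<otimes> inv (y ?j) \<in> nonunits R V" "y ?j \<otimes> inv (y (Suc ?j)) \<in> nonunits R V"
        using Suc step[of ?j] by auto
      have "y i \<otimes> inv (y ?j) \<otimes> (y ?j \<otimes> inv (y (Suc ?j))) = y i \<otimes> (inv (y ?j) \<otimes> y ?j) \<otimes> inv (y (Suc ?j))"
        using yc[of i] yc[of ?j] yi(1)[of ?j] yi(1)[of "Suc ?j"] Suc.prems by (simp add: m_assoc)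
      also have "\<dots> = y i \<otimes> inv (y (Suc ?j))"
        using yc[of i] yi(4)[of ?j] Suc.prems by simp
      finally show ?case using nonunits_mult(1)[OF V h(1) nonunits_sub[OF h(2)]] by simp
    qed
    have chain': "y j \<otimes> inv (y i) \<in> nonunits R V" if "j < i" "i \<le> N" for i j
      using chain[of j "i - j - 1"] that by simp
    let ?ys = "map y [0..<Suc N]"
    have ysc: "set ?ys \<subseteq> carrier R" using yc by auto
    obtain es cs ds where r: "length es = length ?ys" "length cs = length ?ys" "length ds = length ?ys"
       "set es \<subseteq> carrier R" "set cs \<subseteq> prime_subfield R" "set ds \<subseteq> simple_extension (prime_subfield R) z"
       "combine es ?ys = \<zero>" "\<exists>i < length ?ys. cs ! i \<noteq> \<zero>"
       "\<forall>i < length ?ys. es ! i = cs ! i \<oplus> z \<otimes> ds ! i"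
      using N[OF ysc] by auto
    have len: "length es = Suc N" "length cs = Suc N" "length ds = Suc N" using r(1-3) by auto
    have cm: "cs ! i \<in> prime_subfield R" "ds ! i \<in> simple_extension (prime_subfield R) z"
      "es ! i = cs ! i \<oplus> z \<otimes> ds ! i" if "i \<le> N" for i
    proof -
      show "cs ! i \<in> prime_subfield R" using r(5) nth_mem[of i cs] len that by auto
      show "ds ! i \<in> simple_extension (prime_subfield R) z" using r(6) nth_mem[of i ds] len that by auto
      show "es ! i = cs ! i \<oplus> z \<otimes> ds ! i" using r(9) that by auto
    qed
    note rc = relation_coeffs[OF V z(1) cm(1,2)]
    define i where "i = Max {i. i \<le> N \<and> cs ! i \<noteq> \<zero>}"
    have fin: "finite {i. i \<le> N \<and> cs ! i \<noteq> \<zero>}" "{i. i \<le> N \<and> cs ! i \<noteq> \<zero>} \<noteq> {}"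
      using r(8) by (auto simp: less_Suc_eq_le)
    have i: "i \<le> N" "cs ! i \<noteq> \<zero>" using Max_in[OF fin] by (auto simp: i_def)
    have above: "cs ! j = \<zero>" if "j \<le> N" "i < j" for j
      using Max_ge[OF fin(1), of j] that unfolding i_def by fastforce
    have nth: "?ys ! j = y j" if "j \<le> N" for j using that by (simp del: upt_Suc)
    have "es ! i \<otimes> ?ys ! i \<otimes> inv (y i) \<in> nonunits R V"
    proof (rule combine_dominated[OF V r(1) r(4) ysc r(7)])
      show "i < length ?ys" "inv (y i) \<in> carrier R" using i yi(1)[of i] by auto
      fix j assume "j < length ?ys" and ji: "j \<noteq> i"
      then have j: "j \<le> N" by auto
      have ejc: "es ! j \<in> V" "es ! j \<in> carrier R" using rc(1)[OF j j] cm(3)[OF j] D(11) by auto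
      have cc: "y j \<in> carrier R" "inv (y i) \<in> carrier R" "ds ! j \<in> carrier R" "ds ! j \<in> V"
        using yc[OF j] yi(1)[OF i(1) i(1)] rc(4)[OF j j] D(11) by auto
      show "es ! j \<otimes> ?ys ! j \<otimes> inv (y i) \<in> nonunits R V"
      proof (cases "j < i")
        case True
        have "es ! j \<otimes> (y j \<otimes> inv (y i)) \<in> nonunits R V"
          by (rule nonunits_mult(2)[OF V chain'[OF True i(1)] ejc(1)])
        then show ?thesis using nth[OF j] cc ejc by (simp add: m_assoc)
      next
        case False
        then have "cs ! j = \<zero>" using above j ji by simp
        then have e: "es ! j = z \<otimes> ds ! j" using cm(3)[OF j] zc cc by simp
        have zi: "z \<otimes> inv (y i) \<in> V"
        proof (cases "i = 0")
          case True
          then show ?thesis using y0 nonzero_inv[OF zc z(2)] D(4) by simp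
        next
          case False
          then show ?thesis using chain'[of 0 i] i(1) y0 nonunits_sub by auto
        qed
        have "es ! j \<otimes> y j \<otimes> inv (y i) = y j \<otimes> (ds ! j \<otimes> (z \<otimes> inv (y i)))"
          unfolding e using zc cc by (simp add: m_ac)
        moreover have "y j \<otimes> (ds ! j \<otimes> (z \<otimes> inv (y i))) \<in> nonunits R V"
          using nonunits_mult(1)[OF V conjunct1[OF yn[OF j]] D(6)[OF cc(4) zi]] .
        ultimately show ?thesis using nth[OF j] by simp
      qed
    qed
    moreover have "es ! i \<otimes> ?ys ! i \<otimes> inv (y i) = es ! i"
    proof -
      have "es ! i \<in> carrier R" using rc(1)[OF i(1) i(1)] cm(3)[OF i(1)] D(11) by auto
      then show ?thesis using nth[OF i(1)] yc[OF i(1)] yi(1,3)[OF i(1) i(1)] by (simp add: m_assoc)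
    qed
    ultimately show False using rc(2)[OF i(1) i(1) i(2)] cm(3)[OF i(1)] by simp
  qed
qed

text \<open>
  Both steps contradict the bound on chains: if the maximal ideal is not principal, there are chains
  of every length from any of its nonzero elements; if \<open>z\<close> is divisible by all powers of
  a generator \<open>\<pi>\<close>, then \<open>z, \<pi>\<^sup>N, \<dots>, \<pi>\<close> is a chain of arbitrary length.
\<close>

lemma exists_uniformizer:
  assumes V: "valuation_subring R V" "V \<noteq> carrier R"
  shows "\<exists>\<pi>. uniformizer R V \<pi>"
proof -
  note D = valuation_subringD[OF V(1)]
  obtain x0 where x0: "x0 \<in> carrier R" "x0 \<notin> V" using V D(2) by auto
  define z0 where "z0 = inv x0"
  have z0: "z0 \<in> nonunits R V" "z0 \<noteq> \<zero>"
    using nonunit_inv[OF V(1) x0] nonzero_inv(2)[OF x0(1)] by (auto simp: z0_def)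
  have nuc: "a \<in> carrier R" if "a \<in> nonunits R V" for a using that nonunits_sub D(11) by auto
  have "\<exists>\<pi> \<in> nonunits R V - {\<zero>}. \<forall>a \<in> nonunits R V. a \<otimes> inv \<pi> \<in> V"
  proof (rule ccontr)
    assume "\<not> ?thesis"
    then have "\<forall>\<pi> \<in> nonunits R V - {\<zero>}. \<exists>a \<in> nonunits R V. a \<otimes> inv \<pi> \<notin> V" by blast
    then obtain f where f: "\<And>\<pi>. \<pi> \<in> nonunits R V - {\<zero>} \<Longrightarrow> f \<pi> \<in> nonunits R V \<and> f \<pi> \<otimes> inv \<pi> \<notin> V"
      by metis
    have f': "f \<pi> \<noteq> \<zero> \<and> \<pi> \<otimes> inv (f \<pi>) \<in> nonunits R V" if p: "\<pi> \<in> nonunits R V - {\<zero>}" for \<pi>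
    proof -
      have pc: "\<pi> \<in> carrier R" "\<pi> \<noteq> \<zero>" "f \<pi> \<in> carrier R" using p nuc f[OF p] by auto
      note pi = nonzero_inv[OF pc(1,2)]
      have nz: "f \<pi> \<noteq> \<zero>" using f[OF p] D(3) pi by auto
      have "inv (f \<pi> \<otimes> inv \<pi>) \<in> nonunits R V"
        using nonunit_inv(1)[OF V(1)] f[OF p] pc pi by auto
      moreover have "inv (f \<pi> \<otimes> inv \<pi>) = \<pi> \<otimes> inv (f \<pi>)"
        using nonzero_inv_mult[OF pc(3) nz pi(1,2)] pi(5) pc nonzero_inv(1)[OF pc(3) nz] by (simp add: m_comm)
      ultimately show ?thesis using nz by simp
    qed
    define y where "y = rec_nat z0 (\<lambda>_. f)"
    have y: "y 0 = z0" "\<And>i. y (Suc i) = f (y i)" by (auto simp: y_def)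
    have yn: "y i \<in> nonunits R V - {\<zero>}" for i
      by (induction i) (use y z0 f f' in auto)
    have "y i \<otimes> inv (y (Suc i)) \<in> nonunits R V" for i using f'[OF yn[of i]] y(2) by simp
    then show False using chain_bound[OF V(1) z0] y(1) yn by blast
  qed
  then obtain \<pi> where p: "\<pi> \<in> nonunits R V" "\<pi> \<noteq> \<zero>" and gen: "\<And>a. a \<in> nonunits R V \<Longrightarrow> a \<otimes> inv \<pi> \<in> V" by auto
  have pc: "\<pi> \<in> carrier R" using nuc p by auto
  note pi = nonzero_inv[OF pc p(2)]
  note ip = int_pow_field[OF pc p(2)]
  have inV: "\<exists>n::nat. \<exists>u \<in> V - nonunits R V. z = u \<otimes> \<pi> [^] n" if z: "z \<in> V" "z \<noteq> \<zero>" for z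
  proof (rule ccontr)
    assume neg: "\<not> ?thesis"
    have zc: "z \<in> carrier R" using z D(11) by auto
    have all: "\<exists>b \<in> nonunits R V. z = b \<otimes> \<pi> [^] n" for n :: nat
    proof (induction n)
      case 0
      have "z = z \<otimes> \<pi> [^] (0::nat)" using zc by simp
      moreover from this have "z \<in> nonunits R V" using neg z by blast
      ultimately show ?case by blast
    next
      case (Suc n)
      then obtain b where b: "b \<in> nonunits R V" "z = b \<otimes> \<pi> [^] n" by auto
      have bc: "b \<in> carrier R" using nuc b by auto
      have "(b \<otimes> inv \<pi>) \<otimes> \<pi> [^] Suc n = b \<otimes> (inv \<pi> \<otimes> \<pi>) \<otimes> \<pi> [^] n"
        using bc pc pi(1) by (simp add: m_ac)
      then have e: "z = (b \<otimes> inv \<pi>) \<otimes> \<pi> [^] Suc n" using b bc pi by simp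
      moreover from this have "b \<otimes> inv \<pi> \<in> nonunits R V" using neg gen[OF b(1)] by blast
      ultimately show ?case by blast
    qed
    have zn: "z \<in> nonunits R V" using all[of 0] nuc by auto
    obtain N where N: "\<not> (\<exists>y::nat \<Rightarrow> 'a. y 0 = z \<and> (\<forall>i \<le> N. y i \<in> nonunits R V \<and> y i \<noteq> \<zero>) \<and>
     (\<forall>i < N. y i \<otimes> inv (y (Suc i)) \<in> nonunits R V))"
      using chain_bound[OF V(1) zn z(2)] by auto
    \<comment> \<open>the chain \<open>z, \<pi>\<^sup>N, \<dots>, \<pi>\<close>, with indices from 0 to \<open>N\<close>\<close>
    define y where "y = (\<lambda>i. if i = 0 then z else \<pi> [^] (N + 1 - i))"
    have "y i \<in> nonunits R V \<and> y i \<noteq> \<zero>" if "i \<le> N" for i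
      using that zn z nonunits_pow[OF V(1) p(1)] pow_nonzero[OF pc p(2)] by (auto simp: y_def)
    moreover have "y i \<otimes> inv (y (Suc i)) \<in> nonunits R V" if i: "i < N" for i
    proof (cases "i = 0")
      case True
      obtain b where b: "b \<in> nonunits R V" "z = b \<otimes> \<pi> [^] N" using all by auto
      have "z \<otimes> inv (\<pi> [^] N) = b"
        unfolding b(2) using nuc[OF b(1)] nonzero_inv[OF nat_pow_closed[OF pc] pow_nonzero[OF pc p(2)]] pc
        by (simp add: m_assoc)
      then show ?thesis using True b i by (simp add: y_def)
    next
      case False
      have "N + 1 - i = Suc (N + 1 - Suc i)" using i by simp
      then have "\<pi> [^] (N + 1 - i) = \<pi> \<otimes> \<pi> [^] (N + 1 - Suc i)" using pc by (simp add: m_comm)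
      then have "\<pi> [^] (N + 1 - i) \<otimes> inv (\<pi> [^] (N + 1 - Suc i)) = \<pi>"
        using pc nonzero_inv[OF nat_pow_closed[OF pc] pow_nonzero[OF pc p(2)]]
        by (simp add: m_assoc)
      then show ?thesis using False p by (simp add: y_def)
    qed
    ultimately show False using N by (metis y_def)
  qed
  have "\<exists>n::int. \<exists>u \<in> V - nonunits R V. z = u \<otimes> \<pi> [^] n" if z: "z \<in> carrier R" "z \<noteq> \<zero>" for z
  proof (cases "z \<in> V")
    case True
    then obtain n :: nat and u where "u \<in> V - nonunits R V" "z = u \<otimes> \<pi> [^] n" using inV z by blast
    then have "z = u \<otimes> \<pi> [^] (int n)" using ip(5) by simp
    then show ?thesis using \<open>u \<in> V - nonunits R V\<close> by blast
  next
    case False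
    note zi = nonzero_inv[OF z]
    have "inv z \<in> V" using D(10) z False by auto
    then obtain n :: nat and u where u: "u \<in> V - nonunits R V" "inv z = u \<otimes> \<pi> [^] n" using inV zi by blast
    have uc: "u \<in> carrier R" "u \<noteq> \<zero>" using u unit_inv_mem(1)[OF V(1)] D(11) by auto
    have "z = inv u \<otimes> inv (\<pi> [^] n)"
      using zi(5) unfolding u(2) using nonzero_inv_mult[OF uc nat_pow_closed[OF pc] pow_nonzero[OF pc p(2)]] by simp
    also have "inv (\<pi> [^] n) = \<pi> [^] (- int n)" using ip(4)[of "int n"] ip(5) by simp
    finally show ?thesis using unit_inv_mem[OF V(1)] u(1) by blast
  qed
  then show ?thesis using p by (auto simp: uniformizer_def)
qed

end

section \<open>Primes and orders\<close>

text \<open>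
  The valuation subring with maximal ideal \<open>v\<close>, recovered from \<open>v\<close>.
\<close>

definition prime_ring :: "('a, 'b) ring_scheme \<Rightarrow> 'a set \<Rightarrow> 'a set" where
  "prime_ring K v = {x \<in> carrier K. x = \<zero>\<^bsub>K\<^esub> \<or> inv\<^bsub>K\<^esub> x \<notin> v}"

lemma (in field) prime_ring_nonunits:
  assumes V: "valuation_subring R V"
  shows "prime_ring R (nonunits R V) = V"
proof
  note D = valuation_subringD[OF V]
  show "prime_ring R (nonunits R V) \<subseteq> V"
    using nonunit_inv(1)[OF V] D(3) by (auto simp: prime_ring_def)
  show "V \<subseteq> prime_ring R (nonunits R V)"
  proof
    fix x assume x: "x \<in> V"
    have xc: "x \<in> carrier R" using x D by auto
    have "inv x \<notin> nonunits R V" if "x \<noteq> \<zero>"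
      using nonunits_mult(2)[OF V _ x, of "inv x"] nonzero_inv(3)[OF xc that] one_not_nonunit[of V] by auto
    then show "x \<in> prime_ring R (nonunits R V)" using xc by (auto simp: prime_ring_def)
  qed
qed

context function_field
begin

lemma primes_of_iff: "v \<in> primes_of R \<longleftrightarrow> (\<exists>V. valuation_subring R V \<and> V \<noteq> carrier R \<and> v = nonunits R V)"
proof
  assume "v \<in> primes_of R"
  then obtain V where "discrete_valuation_subring R V" "maximalideal v (R\<lparr>carrier := V\<rparr>)"
    by (auto simp: primes_of_def)
  then show "\<exists>V. valuation_subring R V \<and> V \<noteq> carrier R \<and> v = nonunits R V"
    using discrete_imp_valuation by blast
next
  assume "\<exists>V. valuation_subring R V \<and> V \<noteq> carrier R \<and> v = nonunits R V"
  then obtain V where V: "valuation_subring R V" "V \<noteq> carrier R" "v = nonunits R V" by auto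
  obtain \<pi> where "uniformizer R V \<pi>" using exists_uniformizer[OF V(1,2)] by auto
  then show "v \<in> primes_of R"
    using uniformizer_imp_discrete[OF V(1)] V(3) by (auto simp: primes_of_def)
qed

lemma nonunits_prime:
  assumes "valuation_subring R V" "V \<noteq> carrier R"
  shows "nonunits R V \<in> primes_of R"
  using primes_of_iff assms by blast

lemma primeD:
  assumes v: "v \<in> primes_of R"
  shows "valuation_subring R (prime_ring R v)" "prime_ring R v \<noteq> carrier R"
    "nonunits R (prime_ring R v) = v"
    "local_ring R v = R\<lparr>carrier := prime_ring R v\<rparr>" "maximalideal v (local_ring R v)"
proof -
  obtain V where V: "valuation_subring R V" "V \<noteq> carrier R" "v = nonunits R V" using primes_of_iff v by auto
  have pV: "prime_ring R v = V" using prime_ring_nonunits[OF V(1)] V(3) by simp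
  show "valuation_subring R (prime_ring R v)" "prime_ring R v \<noteq> carrier R"
    "nonunits R (prime_ring R v) = v" using V pV by auto
  obtain \<pi> where p: "uniformizer R V \<pi>" using exists_uniformizer[OF V(1,2)] by auto
  have dv: "discrete_valuation_subring R V \<and> maximalideal v (R\<lparr>carrier := V\<rparr>)"
    using uniformizer_imp_discrete[OF V(1) p] V(3) by simp
  have "(THE A. discrete_valuation_subring R A \<and> maximalideal v (R\<lparr>carrier := A\<rparr>)) = V"
  proof (rule the_equality, rule dv)
    fix A assume A: "discrete_valuation_subring R A \<and> maximalideal v (R\<lparr>carrier := A\<rparr>)"
    then have "valuation_subring R A" "v = nonunits R A" using discrete_imp_valuation by auto
    then show "A = V" using prime_ring_nonunits pV by auto
  qed
  then show *: "local_ring R v = R\<lparr>carrier := prime_ring R v\<rparr>" by (simp add: local_ring_def pV)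
  show "maximalideal v (local_ring R v)" using dv * pV by simp
qed

lemma prime_unit_iff:
  assumes "v \<in> primes_of R"
  shows "Units (local_ring R v) = prime_ring R v - v"
  using Units_subring[OF primeD(1)[OF assms]] primeD(3,4)[OF assms] by simp

text \<open>
  The definition of the order allows any generator of the maximal ideal.  Two generators differ by a unit,
  so the exponent does not depend on the choice.
\<close>

lemma ord_at_unit_pow:
  assumes v: "v \<in> primes_of R" and p: "uniformizer R (prime_ring R v) \<pi>" and u: "u \<in> prime_ring R v - v"
  shows "ord_at R v (u \<otimes> \<pi> [^] (n::int)) = n"
proof -
  let ?V = "prime_ring R v"
  note V = primeD(1)[OF v]
  note nu = primeD(3)[OF v]
  note D = valuation_subringD[OF V]
  have pn: "\<pi> \<in> nonunits R ?V" "\<pi> \<noteq> \<zero>" and dec: "\<And>z. z \<in> carrier R - {\<zero>} \<Longrightarrow> \<exists>n::int. \<exists>u \<in> ?V - v. z = u \<otimes> \<pi> [^] n"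
    using p nu by (auto simp: uniformizer_def)
  have pc: "\<pi> \<in> ?V" "\<pi> \<in> carrier R" using nonunits_sub[OF pn(1)] D(11) by auto
  note ip = int_pow_field[OF pc(2) pn(2)]
  have loc: "local_ring R v = R\<lparr>carrier := ?V\<rparr>" by (rule primeD(4)[OF v])
  have U: "Units (local_ring R v) = ?V - v" by (rule prime_unit_iff[OF v])
  have vP: "v = PIdl\<^bsub>local_ring R v\<^esub> \<pi>"
  proof
    show "v \<subseteq> PIdl\<^bsub>local_ring R v\<^esub> \<pi>"
    proof
      fix a assume a: "a \<in> v"
      then have aV: "a \<in> ?V" "a \<in> nonunits R ?V" using nu nonunits_sub by auto
      show "a \<in> PIdl\<^bsub>local_ring R v\<^esub> \<pi>"
      proof (cases "a = \<zero>")
        case True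
        have "\<exists>x. \<zero> = x \<otimes> \<pi> \<and> x \<in> ?V" using D(3) pc by (intro exI[of _ \<zero>]) simp
        then show ?thesis using True loc by (simp add: cgenideal_def)
      next
        case False
        then obtain m :: int and w where w: "w \<in> ?V - v" "a = w \<otimes> \<pi> [^] m" using dec[of a] aV D(11) by auto
        have "m > 0" using unit_times_pow_mem(1)[OF V pn, of w m] w aV nu by simp
        then have "w \<otimes> \<pi> [^] (m - 1) \<in> ?V" using unit_times_pow_mem(2)[OF V pn, of w "m - 1"] w nu by simp
        moreover have "a = (w \<otimes> \<pi> [^] (m - 1)) \<otimes> \<pi>"
          using w ip(1) ip(3)[of "m - 1" 1] ip(7) D(11) pc by (simp add: m_assoc)
        ultimately show ?thesis using loc by (auto simp: cgenideal_def)
      qed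
    qed
    show "PIdl\<^bsub>local_ring R v\<^esub> \<pi> \<subseteq> v"
      using nonunits_mult(2)[OF V pn(1)] loc nu by (auto simp: cgenideal_def)
  qed
  have assoc: "\<exists>w \<in> ?V - v. \<rho> = w \<otimes> \<pi>" if r: "\<rho> \<in> ?V" "v = PIdl\<^bsub>local_ring R v\<^esub> \<rho>" for \<rho>
  proof -
    have rc: "\<rho> \<in> carrier R" using r D(11) by auto
    have "\<rho> = \<one> \<otimes> \<rho>" using rc by simp
    then have "\<rho> \<in> v" using r(2) loc D(4) by (auto simp: cgenideal_def)
    then obtain w where w: "w \<in> ?V" "\<rho> = w \<otimes> \<pi>" using vP loc by (auto simp: cgenideal_def)
    have "\<pi> \<in> v" using pn nu by simp
    then obtain w' where w': "w' \<in> ?V" "\<pi> = w' \<otimes> \<rho>" using r(2) loc by (auto simp: cgenideal_def)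
    have c: "w \<in> carrier R" "w' \<in> carrier R" using w(1) w'(1) D(11) by auto
    have "\<one> \<otimes> \<pi> = (w' \<otimes> w) \<otimes> \<pi>" using w'(2) unfolding w(2) using c pc by (simp add: m_assoc)
    then have "\<one> = w' \<otimes> w" using m_rcancel[OF pn(2) pc(2), of \<one> "w' \<otimes> w"] c by (simp del: l_one)
    then have "w \<notin> nonunits R ?V" using nonunits_mult(2)[OF V _ w'(1), of w] one_not_nonunit by auto
    then show ?thesis using w nu by auto
  qed
  show ?thesis unfolding ord_at_def
  proof (rule the_equality)
    show "\<exists>\<pi>' u'. \<pi>' \<in> carrier (local_ring R v) \<and> v = PIdl\<^bsub>local_ring R v\<^esub> \<pi>' \<and>
        u' \<in> Units (local_ring R v) \<and> u \<otimes> \<pi> [^] n = u' \<otimes> \<pi>' [^] n"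
      using pc loc vP U u by (intro exI[of _ \<pi>] exI[of _ u]) auto
  next
    fix m :: int assume "\<exists>\<pi>' u'. \<pi>' \<in> carrier (local_ring R v) \<and> v = PIdl\<^bsub>local_ring R v\<^esub> \<pi>' \<and>
        u' \<in> Units (local_ring R v) \<and> u \<otimes> \<pi> [^] n = u' \<otimes> \<pi>' [^] m"
    then obtain \<rho> u' where r: "\<rho> \<in> ?V" "v = PIdl\<^bsub>local_ring R v\<^esub> \<rho>" "u' \<in> ?V - v" "u \<otimes> \<pi> [^] n = u' \<otimes> \<rho> [^] m"
      using U loc by auto
    obtain w where w: "w \<in> ?V - v" "\<rho> = w \<otimes> \<pi>" using assoc[OF r(1,2)] by auto
    have wc: "w \<in> carrier R" "w \<noteq> \<zero>" using w(1) D(11) unit_inv_mem(1)[OF V] nu by auto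
    have wm: "w [^] m \<in> ?V - v" using unit_pow[OF V, of w m] w nu by simp
    have u'w: "u' \<otimes> w [^] m \<in> ?V - v"
      using unit_mult[OF V, of u' "w [^] m"] wm r(3) nu D(6) by auto
    have "\<rho> [^] m = w [^] m \<otimes> \<pi> [^] m"
    proof -
      interpret M: comm_group "Multiplicative_Group.mult_of R"
        by (intro group.group_comm_groupI field_mult_group) (auto simp: m_comm)
      have M: "w \<in> carrier (Multiplicative_Group.mult_of R)" "\<pi> \<in> carrier (Multiplicative_Group.mult_of R)"
        using wc pc pn by auto
      have "w \<otimes> \<pi> \<noteq> \<zero>" using wc pc pn by (simp add: integral_iff)
      then show ?thesis
        using M.int_pow_distrib[OF M, of m] int_pow_mult_of wc pc pn w(2) by simp
    qed
    then have "u \<otimes> \<pi> [^] n = (u' \<otimes> w [^] m) \<otimes> \<pi> [^] m"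
      using r(3,4) D(11) wm ip(1) by (simp add: m_assoc)
    then have "n = m" using uniformizer_exponent_unique[OF V pn] u u'w nu by simp
    then show "m = n" by simp
  qed
qed

lemma ord_at_decomp:
  assumes v: "v \<in> primes_of R"
  shows "\<exists>\<pi>. uniformizer R (prime_ring R v) \<pi> \<and>
     (\<forall>x \<in> carrier R - {\<zero>}. \<exists>u \<in> prime_ring R v - v. x = u \<otimes> \<pi> [^] ord_at R v x)"
proof -
  obtain \<pi> where p: "uniformizer R (prime_ring R v) \<pi>" using exists_uniformizer primeD(1,2)[OF v] by blast
  have "\<exists>u \<in> prime_ring R v - v. x = u \<otimes> \<pi> [^] ord_at R v x" if "x \<in> carrier R - {\<zero>}" for x
  proof -
    have "\<exists>n::int. \<exists>u \<in> prime_ring R v - v. x = u \<otimes> \<pi> [^] n"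
      using p that primeD(3)[OF v] by (simp add: uniformizer_def)
    then obtain n :: int and u where "u \<in> prime_ring R v - v" "x = u \<otimes> \<pi> [^] n" by blast
    then show ?thesis using ord_at_unit_pow[OF v p] by auto
  qed
  then show ?thesis using p by blast
qed

lemma ord_at_facts:
  assumes v: "v \<in> primes_of R" and x: "x \<in> carrier R" "x \<noteq> \<zero>" and y: "y \<in> carrier R" "y \<noteq> \<zero>"
  shows "ord_at R v (x \<otimes> y) = ord_at R v x + ord_at R v y"
    and "ord_at R v x \<ge> 0 \<longleftrightarrow> x \<in> prime_ring R v"
    and "ord_at R v x > 0 \<longleftrightarrow> x \<in> v"
    and "\<exists>z \<in> carrier R - {\<zero>}. ord_at R v z = n"
proof -
  let ?V = "prime_ring R v"
  note V = primeD(1)[OF v]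
  note nu = primeD(3)[OF v]
  note D = valuation_subringD[OF V]
  obtain \<pi> where p: "uniformizer R ?V \<pi>"
    and dec: "\<And>x. x \<in> carrier R - {\<zero>} \<Longrightarrow> \<exists>u \<in> ?V - v. x = u \<otimes> \<pi> [^] ord_at R v x"
    using ord_at_decomp[OF v] by blast
  have pn: "\<pi> \<in> nonunits R ?V" "\<pi> \<noteq> \<zero>" using p by (auto simp: uniformizer_def)
  have pc: "\<pi> \<in> ?V" "\<pi> \<in> carrier R" using nonunits_sub[OF pn(1)] D(11) by auto
  note ip = int_pow_field[OF pc(2) pn(2)]
  let ?n = "ord_at R v x" and ?m = "ord_at R v y"
  obtain a where a: "a \<in> ?V - v" "x = a \<otimes> \<pi> [^] ?n" using dec x by blast
  obtain b where b: "b \<in> ?V - v" "y = b \<otimes> \<pi> [^] ?m" using dec y by blast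
  have ab: "a \<otimes> b \<in> ?V - v" using a b nu unit_mult[OF V, of a b] D(6) by auto
  have c: "a \<in> carrier R" "b \<in> carrier R" using a(1) b(1) D(11) by auto
  have "(a \<otimes> \<pi> [^] ?n) \<otimes> (b \<otimes> \<pi> [^] ?m) = (a \<otimes> b) \<otimes> \<pi> [^] (?n + ?m)"
    unfolding ip(3) using c ip(1) by (simp add: m_ac)
  then have "x \<otimes> y = (a \<otimes> b) \<otimes> \<pi> [^] (?n + ?m)" using a(2) b(2) by simp
  then show "ord_at R v (x \<otimes> y) = ?n + ?m" using ord_at_unit_pow[OF v p ab] by simp
  show "?n \<ge> 0 \<longleftrightarrow> x \<in> ?V" using unit_times_pow_mem(2)[OF V pn, of a ?n] a nu by simp
  show "?n > 0 \<longleftrightarrow> x \<in> v" using unit_times_pow_mem(1)[OF V pn, of a ?n] a nu by simp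
  have "\<one> \<in> ?V - v" using D(4) one_not_nonunit nu by blast
  then have "ord_at R v (\<one> \<otimes> \<pi> [^] n) = n" by (rule ord_at_unit_pow[OF v p])
  then show "\<exists>z \<in> carrier R - {\<zero>}. ord_at R v z = n" using ip(1,2)[of n] by auto
qed

lemma ord_at_mult:
  assumes "v \<in> primes_of R" "x \<in> carrier R" "x \<noteq> \<zero>" "y \<in> carrier R" "y \<noteq> \<zero>"
  shows "ord_at R v (x \<otimes> y) = ord_at R v x + ord_at R v y"
  by (rule ord_at_facts(1)[OF assms])

lemma ord_at_nonneg_iff:
  assumes "v \<in> primes_of R" "x \<in> carrier R" "x \<noteq> \<zero>"
  shows "ord_at R v x \<ge> 0 \<longleftrightarrow> x \<in> prime_ring R v"
  by (rule ord_at_facts(2)[OF assms assms(2,3)])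

lemma ord_at_pos_iff:
  assumes "v \<in> primes_of R" "x \<in> carrier R" "x \<noteq> \<zero>"
  shows "ord_at R v x > 0 \<longleftrightarrow> x \<in> v"
  by (rule ord_at_facts(3)[OF assms assms(2,3)])

lemma ord_at_surj:
  assumes "v \<in> primes_of R"
  shows "\<exists>z \<in> carrier R - {\<zero>}. ord_at R v z = n"
  by (rule ord_at_facts(4)[OF assms one_closed one_not_zero one_closed one_not_zero])

lemma ord_at_one:
  assumes "v \<in> primes_of R"
  shows "ord_at R v \<one> = 0"
  using ord_at_mult[OF assms, of \<one> \<one>] by simp

lemma ord_at_inv:
  assumes v: "v \<in> primes_of R" and x: "x \<in> carrier R" "x \<noteq> \<zero>"
  shows "ord_at R v (inv x) = - ord_at R v x"
  using ord_at_mult[OF v x, of "inv x"] nonzero_inv[OF x] ord_at_one[OF v] by simp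

lemma ord_at_pow:
  assumes v: "v \<in> primes_of R" and x: "x \<in> carrier R" "x \<noteq> \<zero>"
  shows "ord_at R v (x [^] (n::nat)) = int n * ord_at R v x"
proof (induction n)
  case (Suc n)
  then show ?case using ord_at_mult[OF v _ _ x, of "x [^] n"] pow_nonzero[OF x] x by (simp add: algebra_simps)
qed (use ord_at_one[OF v] in simp)

lemma ord_at_one_plus:
  assumes v: "v \<in> primes_of R" and x: "x \<in> carrier R" "x \<noteq> \<zero>"
  shows "ord_at R v x > 0 \<Longrightarrow> \<one> \<oplus> x \<noteq> \<zero> \<and> ord_at R v (\<one> \<oplus> x) = 0"
    and "ord_at R v x < 0 \<Longrightarrow> \<one> \<oplus> x \<noteq> \<zero> \<and> ord_at R v (\<one> \<oplus> x) = ord_at R v x"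
proof -
  note V = primeD(1)[OF v]
  note nu = primeD(3)[OF v]
  note D = valuation_subringD[OF V]
  have pos: "\<one> \<oplus> x \<noteq> \<zero> \<and> ord_at R v (\<one> \<oplus> x) = 0"
    if x: "x \<in> carrier R" "x \<noteq> \<zero>" and o: "ord_at R v x > 0" for x
  proof -
    have "x \<in> nonunits R (prime_ring R v)" using ord_at_pos_iff[OF v x] o nu by simp
    then have u: "\<one> \<oplus> x \<in> prime_ring R v" "\<one> \<oplus> x \<notin> v"
      using unit_add_nonunit[OF V D(4) one_not_nonunit] nu by auto
    then have nz: "\<one> \<oplus> x \<noteq> \<zero>" using zero_nonunit[OF V] nu by metis
    have "\<one> \<oplus> x \<in> carrier R" using x by simp
    from ord_at_nonneg_iff[OF v this nz] ord_at_pos_iff[OF v this nz] u nz show ?thesis by simp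
  qed
  then show "ord_at R v x > 0 \<Longrightarrow> \<one> \<oplus> x \<noteq> \<zero> \<and> ord_at R v (\<one> \<oplus> x) = 0" using x by blast
  assume neg: "ord_at R v x < 0"
  note xi = nonzero_inv[OF x]
  have i: "\<one> \<oplus> inv x \<noteq> \<zero>" "ord_at R v (\<one> \<oplus> inv x) = 0"
    using pos[OF xi(1,2)] ord_at_inv[OF v x] neg by auto
  have e: "\<one> \<oplus> x = x \<otimes> (\<one> \<oplus> inv x)" using x xi by (simp add: r_distr a_comm)
  then show "\<one> \<oplus> x \<noteq> \<zero> \<and> ord_at R v (\<one> \<oplus> x) = ord_at R v x"
    using ord_at_mult[OF v x _ i(1)] i x xi(1) by (simp add: integral_iff)
qed

text \<open>
  A ring that properly contains a discrete valuation ring contains an element of negative order, and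
  its powers multiply every element into the smaller ring.
\<close>

lemma prime_ring_maximal:
  assumes v: "v \<in> primes_of R" and w: "w \<in> primes_of R" and sub: "prime_ring R v \<subseteq> prime_ring R w"
  shows "v = w"
proof -
  have "prime_ring R v = prime_ring R w"
  proof (rule ccontr)
    assume "prime_ring R v \<noteq> prime_ring R w"
    then obtain a where a: "a \<in> prime_ring R w" "a \<notin> prime_ring R v" using sub by auto
    note Dw = valuation_subringD[OF primeD(1)[OF w]]
    have ac: "a \<in> carrier R" using a Dw by auto
    have a0: "a \<noteq> \<zero>" using a valuation_subringD(3)[OF primeD(1)[OF v]] by auto
    have neg: "ord_at R v a < 0" using ord_at_nonneg_iff[OF v ac a0] a by simp
    have "c \<in> prime_ring R w" if c: "c \<in> carrier R" "c \<noteq> \<zero>" for c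
    proof -
      define k where "k = nat \<bar>ord_at R v c\<bar>"
      have ak: "a [^] k \<in> carrier R" "a [^] k \<noteq> \<zero>" using ac pow_nonzero[OF ac a0] by auto
      note aki = nonzero_inv[OF ak]
      have "ord_at R v (c \<otimes> inv (a [^] k)) = ord_at R v c - int k * ord_at R v a"
        using ord_at_mult[OF v c aki(1,2)] ord_at_inv[OF v ak] ord_at_pow[OF v ac a0] by simp
      moreover have "int k * ord_at R v a \<le> int k * (-1)" using neg by (intro mult_left_mono) auto
      ultimately have "ord_at R v (c \<otimes> inv (a [^] k)) \<ge> 0" by (simp add: k_def)
      then have "c \<otimes> inv (a [^] k) \<in> prime_ring R v"
        using ord_at_nonneg_iff[OF v] c aki by (simp add: integral_iff)
      then have "c \<otimes> inv (a [^] k) \<otimes> a [^] k \<in> prime_ring R w" using sub Dw(6,9) a(1) by blast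
      then show ?thesis using c ak aki by (simp add: m_assoc)
    qed
    then have "carrier R \<subseteq> prime_ring R w" using Dw(3) by auto
    then show False using primeD(2)[OF w] Dw(2) by auto
  qed
  then show ?thesis using primeD(3)[OF v] primeD(3)[OF w] by metis
qed

lemma separate_two_primes:
  assumes v: "v \<in> primes_of R" and w: "w \<in> primes_of R" and "v \<noteq> w"
  shows "\<exists>y \<in> carrier R - {\<zero>}. ord_at R v y < 0 \<and> ord_at R w y > 0"
proof -
  obtain a where a: "a \<in> prime_ring R v" "a \<notin> prime_ring R w" using prime_ring_maximal[OF v w] assms(3) by auto
  obtain b where b: "b \<in> prime_ring R w" "b \<notin> prime_ring R v" using prime_ring_maximal[OF w v] assms(3) by auto
  note Dv = valuation_subringD[OF primeD(1)[OF v]]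
  note Dw = valuation_subringD[OF primeD(1)[OF w]]
  have c: "a \<in> carrier R" "b \<in> carrier R" using a b Dv Dw by auto
  have nz: "a \<noteq> \<zero>" "b \<noteq> \<zero>" using a(2) b(2) Dv(3) Dw(3) by auto
  note ai = nonzero_inv[OF c(1) nz(1)]
  have "ord_at R v a \<ge> 0" "ord_at R w a < 0" "ord_at R w b \<ge> 0" "ord_at R v b < 0"
    using ord_at_nonneg_iff[OF v] ord_at_nonneg_iff[OF w] a b c nz by (auto simp: not_le[symmetric])
  then show ?thesis
    using ord_at_mult[OF v c(2) nz(2) ai(1,2)] ord_at_mult[OF w c(2) nz(2) ai(1,2)]
      ord_at_inv[OF v c(1) nz(1)] ord_at_inv[OF w c(1) nz(1)] c nz ai(1,2)
    by (intro bexI[of _ "b \<otimes> inv a"]) (auto simp: integral_iff)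
qed

text \<open>
  Weak approximation, in the form needed to produce independent elements.  When another prime \<open>w\<close> is added, a
  large power \<open>q\<close> of \<open>y\<close> controls the old primes and \<open>z\<close> controls \<open>v\<close> and \<open>w\<close>; if \<open>y\<close> has a pole at \<open>w\<close>,
  the factor \<open>q\<close> is replaced by \<open>q/(1 + q)\<close>, which has order 0 wherever \<open>q\<close> has a pole.
\<close>

lemma approximation:
  assumes "finite T" and v: "v \<in> primes_of R" and "T \<subseteq> primes_of R" "v \<notin> T"
  shows "\<exists>y \<in> carrier R - {\<zero>}. ord_at R v y < 0 \<and> (\<forall>t \<in> T. ord_at R t y > 0)"
  using assms(1,3,4)
proof (induction T)
  case empty
  obtain z where "z \<in> carrier R - {\<zero>}" "ord_at R v z = -1" using ord_at_surj[OF v] by blast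
  then show ?case by (intro bexI[of _ z]) auto
next
  case (insert w T)
  have w: "w \<in> primes_of R" "w \<noteq> v" and T: "\<And>t. t \<in> T \<Longrightarrow> t \<in> primes_of R" using insert by auto
  obtain y where y: "y \<in> carrier R" "y \<noteq> \<zero>" "ord_at R v y < 0" "\<And>t. t \<in> T \<Longrightarrow> ord_at R t y > 0"
    using insert by auto
  obtain z where z: "z \<in> carrier R" "z \<noteq> \<zero>" "ord_at R v z < 0" "ord_at R w z > 0"
    using separate_two_primes[OF v w(1)] w by auto
  \<comment> \<open>large enough to outweigh the orders of \<open>z\<close> at the primes in \<open>T\<close>\<close>
  define r where "r = Suc (nat (\<Sum>t \<in> T. \<bar>ord_at R t z\<bar>))"
  have r: "int r > \<bar>ord_at R t z\<bar>" if "t \<in> T" for t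
  proof -
    have "\<bar>ord_at R t z\<bar> \<le> (\<Sum>t \<in> T. \<bar>ord_at R t z\<bar>)" using insert(1) that by (intro member_le_sum) auto
    then show ?thesis by (simp add: r_def)
  qed
  let ?q = "y [^] r"
  have q: "?q \<in> carrier R" "?q \<noteq> \<zero>" using y pow_nonzero by auto
  have oq: "ord_at R u ?q = int r * ord_at R u y" if "u \<in> primes_of R" for u
    by (rule ord_at_pow[OF that y(1,2)])
  have "r > 0" by (simp add: r_def)
  then have r0: "int r > 0" by simp
  have qT: "ord_at R t ?q + ord_at R t z > 0" "ord_at R t ?q > 0" if "t \<in> T" for t
  proof -
    have "int r * ord_at R t y \<ge> int r * 1" using y(4)[OF that] by (intro mult_left_mono) auto
    then show "ord_at R t ?q + ord_at R t z > 0" "ord_at R t ?q > 0"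
      using oq[OF T[OF that]] r[OF that] r0 by linarith+
  qed
  have qv: "ord_at R v ?q < 0" using oq[OF v] y(3) r0 by (simp add: mult_pos_neg)
  consider "ord_at R w y > 0" | "ord_at R w y = 0" | "ord_at R w y < 0" by linarith
  then show ?case
  proof cases
    case 1
    then show ?thesis using y by (intro bexI[of _ y]) auto
  next
    case 2
    then have "ord_at R w ?q = 0" using oq[OF w(1)] by simp
    then show ?thesis
      using ord_at_mult[OF _ q z(1,2)] v w T qT qv q z by (intro bexI[of _ "?q \<otimes> z"]) (auto simp: integral_iff)
  next
    case 3
    have qw: "ord_at R w ?q < 0" using oq[OF w(1)] 3 r0 by (simp add: mult_pos_neg)
    have s: "\<one> \<oplus> ?q \<in> carrier R" "\<one> \<oplus> ?q \<noteq> \<zero>" using q ord_at_one_plus(2)[OF v q qv] by auto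
    note si = nonzero_inv[OF s]
    have zs: "z \<otimes> inv (\<one> \<oplus> ?q) \<in> carrier R" "z \<otimes> inv (\<one> \<oplus> ?q) \<noteq> \<zero>"
      using z si by (auto simp: integral_iff)
    have o: "ord_at R u (?q \<otimes> (z \<otimes> inv (\<one> \<oplus> ?q))) = ord_at R u ?q + ord_at R u z - ord_at R u (\<one> \<oplus> ?q)"
      if "u \<in> primes_of R" for u
      using ord_at_mult[OF that q zs] ord_at_mult[OF that z(1,2) si(1,2)] ord_at_inv[OF that s] by simp
    have "ord_at R v (?q \<otimes> (z \<otimes> inv (\<one> \<oplus> ?q))) < 0"
      using o[OF v] ord_at_one_plus(2)[OF v q qv] z by simp
    moreover have "ord_at R w (?q \<otimes> (z \<otimes> inv (\<one> \<oplus> ?q))) > 0"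
      using o[OF w(1)] ord_at_one_plus(2)[OF w(1) q qw] z by simp
    moreover have "ord_at R t (?q \<otimes> (z \<otimes> inv (\<one> \<oplus> ?q))) > 0" if "t \<in> T" for t
      using o[OF T[OF that]] ord_at_one_plus(1)[OF T[OF that] q qT(2)[OF that]] qT(1)[OF that] by simp
    ultimately show ?thesis
      using q zs by (intro bexI[of _ "?q \<otimes> (z \<otimes> inv (\<one> \<oplus> ?q))"]) (auto simp: integral_iff)
  qed
qed

text \<open>
  Let \<open>f v\<close> have a pole at the zero \<open>v\<close> of \<open>x\<close> and vanish at the other zeros under consideration.  In a linear
  relation over \<open>k(x)\<close> between such elements a term with unit coefficient dominates at its own prime.
  So there are at most as many zeros as the degree over \<open>k(x)\<close>.
\<close>

theorem finite_zeros:
  assumes x: "x \<in> carrier R" "x \<noteq> \<zero>"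
  shows "finite {v \<in> primes_of R. ord_at R v x > 0}"
proof (rule ccontr)
  assume inf: "infinite {v \<in> primes_of R. ord_at R v x > 0}"
  then obtain v0 where v0: "v0 \<in> primes_of R" "ord_at R v0 x > 0"
    using infinite_imp_nonempty by blast
  have "x \<in> nonunits R (prime_ring R v0)"
    using ord_at_pos_iff[OF v0(1) x] v0(2) primeD(3)[OF v0(1)] by simp
  from nonunit_transcendental[OF primeD(1)[OF v0(1)] this x(2)]
  obtain N where N: "\<And>ys. set ys \<subseteq> carrier R \<Longrightarrow> length ys > N \<Longrightarrow>
     (\<exists>es cs ds. length es = length ys \<and> length cs = length ys \<and> length ds = length ys \<and>
       set es \<subseteq> carrier R \<and> set cs \<subseteq> prime_subfield R \<and> set ds \<subseteq> simple_extension (prime_subfield R) x \<and>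
       combine es ys = \<zero> \<and> (\<exists>i < length ys. cs ! i \<noteq> \<zero>) \<and>
       (\<forall>i < length ys. es ! i = cs ! i \<oplus> x \<otimes> ds ! i))"
    using linear_relation[OF x(1)] by blast
  obtain B where B: "finite B" "card B = Suc N" "B \<subseteq> {v \<in> primes_of R. ord_at R v x > 0}"
    using infinite_arbitrarily_large[OF inf] by blast
  obtain vs where vs: "set vs = B" "distinct vs" using B(1) finite_distinct_list by blast
  have len: "length vs = Suc N" using vs B(2) distinct_card by fastforce
  have vp: "vs ! i \<in> primes_of R" "ord_at R (vs ! i) x > 0" if "i < length vs" for i
    using that nth_mem[OF that] vs B(3) by auto
  have "\<exists>y \<in> carrier R - {\<zero>}. ord_at R v y < 0 \<and> (\<forall>t \<in> B - {v}. ord_at R t y > 0)" if "v \<in> B" for v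
    using approximation[of "B - {v}" v] B that by auto
  then obtain f where f: "\<And>v. v \<in> B \<Longrightarrow> f v \<in> carrier R - {\<zero>} \<and> ord_at R v (f v) < 0 \<and> (\<forall>t \<in> B - {v}. ord_at R t (f v) > 0)"
    by metis
  let ?ys = "map f vs"
  have ysc: "set ?ys \<subseteq> carrier R" using f vs by auto
  obtain es cs ds where r: "length es = length ?ys" "length cs = length ?ys" "length ds = length ?ys"
       "set es \<subseteq> carrier R" "set cs \<subseteq> prime_subfield R" "set ds \<subseteq> simple_extension (prime_subfield R) x"
       "combine es ?ys = \<zero>" "\<exists>i < length ?ys. cs ! i \<noteq> \<zero>"
       "\<forall>i < length ?ys. es ! i = cs ! i \<oplus> x \<otimes> ds ! i"
    using N[OF ysc] len by auto
  obtain i where i: "i < length vs" "cs ! i \<noteq> \<zero>" using r(8) by auto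
  let ?v = "vs ! i"
  note vi = vp[OF i(1)]
  note V = primeD(1)[OF vi(1)]
  note nu = primeD(3)[OF vi(1)]
  note D = valuation_subringD[OF V]
  have xn: "x \<in> nonunits R (prime_ring R ?v)" using ord_at_pos_iff[OF vi(1) x] vi(2) nu by simp
  have cm: "cs ! j \<in> prime_subfield R" "ds ! j \<in> simple_extension (prime_subfield R) x"
      "es ! j = cs ! j \<oplus> x \<otimes> ds ! j" if "j < length vs" for j
    using r(2,3,5,6,9) nth_mem[of j cs] nth_mem[of j ds] that by auto
  note rc = relation_coeffs[OF V xn cm(1,2)]
  have viB: "?v \<in> B" using i vs by auto
  let ?w = "inv (f ?v)"
  have fv: "f ?v \<in> carrier R" "f ?v \<noteq> \<zero>" "ord_at R ?v (f ?v) < 0" using f[OF viB] by auto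
  note wi = nonzero_inv[OF fv(1,2)]
  have ow: "ord_at R ?v ?w > 0" using ord_at_inv[OF vi(1) fv(1,2)] fv(3) by simp
  have wn: "?w \<in> nonunits R (prime_ring R ?v)" using ord_at_pos_iff[OF vi(1) wi(1,2)] ow nu by simp
  have "es ! i \<otimes> ?ys ! i \<otimes> ?w \<in> nonunits R (prime_ring R ?v)"
  proof (rule combine_dominated[OF V r(1,4) ysc r(7)])
    show "i < length ?ys" "?w \<in> carrier R" using i wi by auto
    fix j assume "j < length ?ys" and ji: "j \<noteq> i"
    then have j: "j < length vs" by simp
    have jB: "vs ! j \<in> B" using j vs by auto
    have "vs ! j \<noteq> ?v" using ji j i vs(2) nth_eq_iff_index_eq by blast
    then have "ord_at R ?v (f (vs ! j)) > 0" using f[OF jB] viB by auto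
    then have fn: "f (vs ! j) \<in> nonunits R (prime_ring R ?v)" using ord_at_pos_iff[OF vi(1)] f[OF jB] nu by simp
    have "es ! j \<in> prime_ring R ?v" using rc(1)[OF j j] cm(3)[OF j] by simp
    then have "es ! j \<otimes> f (vs ! j) \<in> nonunits R (prime_ring R ?v)" using nonunits_mult(2)[OF V fn] by simp
    then show "es ! j \<otimes> ?ys ! j \<otimes> ?w \<in> nonunits R (prime_ring R ?v)"
      using nonunits_mult(1)[OF V _ nonunits_sub[OF wn]] j by simp
  qed
  moreover have "es ! i \<otimes> ?ys ! i \<otimes> ?w = es ! i"
  proof -
    have "es ! i \<in> carrier R" using rc(1)[OF i(1) i(1)] cm(3)[OF i(1)] D(11) by auto
    then show ?thesis using i fv wi by (simp add: m_assoc)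
  qed
  ultimately show False using rc(2)[OF i(1) i(1) i(2)] cm(3)[OF i(1)] by simp
qed

lemma finite_support:
  assumes x: "x \<in> carrier R" "x \<noteq> \<zero>"
  shows "finite {v \<in> primes_of R. ord_at R v x \<noteq> 0}"
proof -
  note i = nonzero_inv[OF x]
  have "{v \<in> primes_of R. ord_at R v x \<noteq> 0} =
     {v \<in> primes_of R. ord_at R v x > 0} \<union> {v \<in> primes_of R. ord_at R v (inv x) > 0}"
    using ord_at_inv[OF _ x] by auto
  then show ?thesis using finite_zeros[OF x] finite_zeros[OF i(1,2)] by simp
qed

text \<open>
  Every proper valuation subring is the ring of a prime, so \<open>x\<close> lies in all valuation subrings.
\<close>

lemma no_poles_imp_constant:
  assumes x: "x \<in> carrier R" and "\<And>v. v \<in> primes_of R \<Longrightarrow> x \<in> prime_ring R v"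
  shows "x \<in> field_of_constants R"
proof -
  have "x \<in> V" if V: "valuation_subring R V" for V
  proof (cases "V = carrier R")
    case False
    then show ?thesis using assms(2)[OF nonunits_prime[OF V False]] prime_ring_nonunits[OF V] by simp
  qed (use x in simp)
  then show ?thesis using x field_of_constants_eq by simp
qed

end

section \<open>Residue fields\<close>

lemma (in ring) finite_dimension_if_bounded:
  assumes k: "subfield k R" and bound: "\<And>Us. independent k Us \<Longrightarrow> length Us \<le> N"
  shows "finite_dimension k (carrier R)"
proof -
  define P where "P n \<longleftrightarrow> (\<exists>Us. independent k Us \<and> length Us = n)" for n
  have P0: "P 0" unfolding P_def using li_Nil by force
  have PN: "n \<le> N" if "P n" for n using that bound by (auto simp: P_def)
  define m where "m = (GREATEST n. P n)"
  have m: "P m" "\<And>n. P n \<Longrightarrow> n \<le> m"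
    unfolding m_def using P0 PN by (blast intro: GreatestI_nat Greatest_le_nat)+
  obtain Us where Us: "independent k Us" "length Us = m" using m(1) by (auto simp: P_def)
  have Uc: "set Us \<subseteq> carrier R" using independent_in_carrier[OF Us(1)] .
  have "carrier R \<subseteq> Span k Us"
  proof (rule ccontr)
    assume "\<not> carrier R \<subseteq> Span k Us"
    then obtain u where u: "u \<in> carrier R" "u \<notin> Span k Us" by auto
    then have "independent k (u # Us)" using li_Cons Us(1) by simp
    then have "P (Suc m)" using Us(2) by (auto simp: P_def intro!: exI[of _ "u # Us"])
    then show False using m(2) by fastforce
  qed
  then have "Span k Us = carrier R" using Span_in_carrier[OF subfieldE(3)[OF k] Uc] by auto
  then show ?thesis using dimension_independent[OF Us(1)] by (auto simp: finite_dimension_def)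
qed

lemma (in ring) subring_a_inv:
  assumes A: "subring A R" and a: "a \<in> A"
  shows "\<ominus>\<^bsub>R\<lparr>carrier := A\<rparr>\<^esub> a = \<ominus> a"
proof -
  interpret A: ring "R\<lparr>carrier := A\<rparr>" by (rule subring_is_ring[OF A])
  show ?thesis
    by (rule A.minus_equality) (use a subringE[OF A] in \<open>auto simp: l_neg subsetD\<close>)
qed

lemma (in ring) combine_subring:
  assumes "subring A R"
  shows "ring.combine (R\<lparr>carrier := A\<rparr>) es ys = combine es ys"
proof -
  interpret A: ring "R\<lparr>carrier := A\<rparr>" by (rule subring_is_ring[OF assms])
  show ?thesis by (induction es ys rule: combine.induct) auto
qed

context function_field
begin

lemma residue_field_hom:
  assumes v: "v \<in> primes_of R"
  defines "h \<equiv> \<lambda>a. v +>\<^bsub>local_ring R v\<^esub> a"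
  shows "field (residue_field R v)"
    and "ring_hom_ring (local_ring R v) (residue_field R v) h"
    and "subfield (h ` field_of_constants R) (residue_field R v)"
    and "\<And>a. a \<in> prime_ring R v \<Longrightarrow> h a = \<zero>\<^bsub>residue_field R v\<^esub> \<longleftrightarrow> a \<in> v"
    and "carrier (residue_field R v) = h ` prime_ring R v"
proof -
  let ?V = "prime_ring R v"
  note V = primeD(1)[OF v]
  note D = valuation_subringD[OF V]
  have loc: "local_ring R v = R\<lparr>carrier := ?V\<rparr>" by (rule primeD(4)[OF v])
  interpret W: domain "local_ring R v" unfolding loc by (rule subring_is_domain[OF D(1)])
  interpret m: maximalideal v "local_ring R v" by (rule primeD(5)[OF v])
  show fq: "field (residue_field R v)"
    unfolding residue_field_def by (rule m.quotient_is_field[OF W.is_cring])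
  show hom: "ring_hom_ring (local_ring R v) (residue_field R v) h"
    unfolding residue_field_def h_def by (rule m.rcos_ring_hom_ring)
  interpret h: ring_hom_ring "local_ring R v" "residue_field R v" h by (rule hom)
  interpret Q: field "residue_field R v" by (rule fq)
  have kV: "field_of_constants R \<subseteq> ?V" using field_of_constants_eq V by auto
  have "subfield (field_of_constants R) (local_ring R v)"
  proof (rule ring.subfield_iff(1)[OF W.ring_axioms])
    have "field (R\<lparr>carrier := field_of_constants R\<rparr>)" by (rule subfield_iff(2)[OF field_of_constants_subfield])
    then show "field (local_ring R v\<lparr>carrier := field_of_constants R\<rparr>)" by (simp add: loc)
    show "field_of_constants R \<subseteq> carrier (local_ring R v)" using kV by (simp add: loc)
  qed
  then show "subfield (h ` field_of_constants R) (residue_field R v)"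
    by (rule h.img_is_subfield(2)) simp
  have z: "\<zero>\<^bsub>residue_field R v\<^esub> = v" by (simp add: residue_field_def FactRing_def)
  show "h a = \<zero>\<^bsub>residue_field R v\<^esub> \<longleftrightarrow> a \<in> v" if a: "a \<in> ?V" for a
  proof
    assume "h a = \<zero>\<^bsub>residue_field R v\<^esub>"
    then have "v +>\<^bsub>local_ring R v\<^esub> a = v" using z by (simp add: h_def)
    moreover have "a \<in> v +>\<^bsub>local_ring R v\<^esub> a"
      by (rule abelian_subgroup.a_rcos_self[OF abelian_subgroupI3[OF m.is_additive_subgroup W.is_abelian_group]])
        (use a loc in simp)
    ultimately show "a \<in> v" by simp
  next
    assume "a \<in> v"
    then have "v +>\<^bsub>local_ring R v\<^esub> a = v"
      by (rule abelian_subgroup.a_rcos_const[OF abelian_subgroupI3[OF m.is_additive_subgroup W.is_abelian_group]])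
    then show "h a = \<zero>\<^bsub>residue_field R v\<^esub>" using z by (simp add: h_def)
  qed
  show "carrier (residue_field R v) = h ` ?V"
    by (auto simp: residue_field_def FactRing_def A_RCOSETS_def' h_def loc)
qed

text \<open>
  A linear relation between lifts, with coefficients that are constants modulo \<open>x\<close> for a uniformizer \<open>x\<close>,
  reduces to a relation between the residues.
\<close>

lemma residue_field_finite_dimension:
  assumes v: "v \<in> primes_of R"
  shows "ring.finite_dimension (residue_field R v)
     ((\<lambda>a. v +>\<^bsub>local_ring R v\<^esub> a) ` field_of_constants R) (carrier (residue_field R v))"
proof -
  let ?V = "prime_ring R v"
  define h where "h = (\<lambda>a. v +>\<^bsub>local_ring R v\<^esub> a)"
  note V = primeD(1)[OF v]
  note D = valuation_subringD[OF V]
  note nu = primeD(3)[OF v]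
  have loc: "local_ring R v = R\<lparr>carrier := ?V\<rparr>" by (rule primeD(4)[OF v])
  note H = residue_field_hom[OF v, folded h_def]
  interpret Q: field "residue_field R v" by (rule H(1))
  interpret h: ring_hom_ring "local_ring R v" "residue_field R v" h by (rule H(2))
  obtain x where x: "x \<in> carrier R - {\<zero>}" "ord_at R v x = 1" using ord_at_surj[OF v] by blast
  then have xn: "x \<in> nonunits R ?V" "x \<noteq> \<zero>" "x \<in> carrier R" using ord_at_pos_iff[OF v, of x] nu by auto
  obtain N where N: "\<And>ys. set ys \<subseteq> carrier R \<Longrightarrow> length ys > N \<Longrightarrow>
     (\<exists>es cs ds. length es = length ys \<and> length cs = length ys \<and> length ds = length ys \<and>
       set es \<subseteq> carrier R \<and> set cs \<subseteq> prime_subfield R \<and> set ds \<subseteq> simple_extension (prime_subfield R) x \<and>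
       combine es ys = \<zero> \<and> (\<exists>i < length ys. cs ! i \<noteq> \<zero>) \<and>
       (\<forall>i < length ys. es ! i = cs ! i \<oplus> x \<otimes> ds ! i))"
    using linear_relation[OF xn(3) nonunit_transcendental[OF V xn(1,2)]] by blast
  have kk: "prime_subfield R \<subseteq> field_of_constants R"
  proof
    fix c assume "c \<in> prime_subfield R"
    then show "c \<in> field_of_constants R"
      using field_of_constants_eq prime_subfield_subset_valuation valuation_subringD(11)[OF valuation_subring_carrier]
        valuation_subring_carrier by blast
  qed
  have "length Us \<le> N" if ind: "Q.independent (h ` field_of_constants R) Us" for Us
  proof (rule ccontr)
    assume "\<not> length Us \<le> N"
    then have long: "length Us > N" by simp
    have "set Us \<subseteq> h ` ?V" using Q.independent_in_carrier[OF ind] H(5) by simp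
    then have "\<forall>u \<in> set Us. \<exists>y \<in> ?V. u = h y" by auto
    then obtain g where g: "\<And>u. u \<in> set Us \<Longrightarrow> g u \<in> ?V \<and> u = h (g u)" by metis
    let ?ys = "map g Us"
    have ysV: "set ?ys \<subseteq> ?V" using g by auto
    then have ysc: "set ?ys \<subseteq> carrier R" using D(11) by auto
    have Us: "Us = map h ?ys" using g by (simp add: map_idI)
    obtain es cs ds where r: "length es = length ?ys" "length cs = length ?ys" "length ds = length ?ys"
       "set es \<subseteq> carrier R" "set cs \<subseteq> prime_subfield R" "set ds \<subseteq> simple_extension (prime_subfield R) x"
       "combine es ?ys = \<zero>" "\<exists>i < length ?ys. cs ! i \<noteq> \<zero>"
       "\<forall>i < length ?ys. es ! i = cs ! i \<oplus> x \<otimes> ds ! i"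
      using N[OF ysc] long by auto
    have cm: "cs ! j \<in> prime_subfield R" "ds ! j \<in> simple_extension (prime_subfield R) x"
      "es ! j = cs ! j \<oplus> x \<otimes> ds ! j" if "j < length es" for j
      using r(1,2,3,5,6,9) nth_mem[of j cs] nth_mem[of j ds] that by auto
    note rc = relation_coeffs[OF V xn(1) cm(1,2)]
    have esV: "set es \<subseteq> ?V" using rc(1) cm(3) by (auto simp: set_conv_nth)
    have hes: "h (es ! j) = h (cs ! j)" if j: "j < length es" for j
    proof -
      have "x \<otimes> ds ! j \<in> v" using rc(3)[OF j j] nu by simp
      moreover have V2: "x \<otimes> ds ! j \<in> ?V" using rc(3)[OF j j] nonunits_sub by auto
      ultimately have "h (x \<otimes> ds ! j) = \<zero>\<^bsub>residue_field R v\<^esub>" using H(4) by simp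
      moreover have cV: "cs ! j \<in> ?V" using cm(1)[OF j] prime_subfield_subset_valuation[OF V] by auto
      moreover have "h (cs ! j \<oplus> x \<otimes> ds ! j) = h (cs ! j) \<oplus>\<^bsub>residue_field R v\<^esub> h (x \<otimes> ds ! j)"
        using h.hom_add[of "cs ! j" "x \<otimes> ds ! j"] V2 cV by (simp add: loc)
      ultimately show ?thesis using cm(3)[OF j] h.hom_closed[of "cs ! j"] by (simp add: loc)
    qed
    have kset: "set (map h es) \<subseteq> h ` field_of_constants R"
    proof
      fix q assume "q \<in> set (map h es)"
      then obtain j where j: "j < length es" "q = h (es ! j)" by (auto simp: set_conv_nth)
      then have "q = h (cs ! j)" "cs ! j \<in> field_of_constants R" using hes cm(1) kk by auto
      then show "q \<in> h ` field_of_constants R" by blast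
    qed
    have "Q.combine (map h es) (map h ?ys) = h (ring.combine (local_ring R v) es ?ys)"
      using h.combine_hom[of es ?ys] esV ysV by (simp add: loc)
    also have "ring.combine (local_ring R v) es ?ys = \<zero>\<^bsub>local_ring R v\<^esub>"
      using combine_subring[OF D(1)] r(7) by (simp add: loc)
    finally have comb0: "Q.combine (map h es) Us = \<zero>\<^bsub>residue_field R v\<^esub>" using Us h.hom_zero by simp
    obtain i where i: "i < length es" "cs ! i \<noteq> \<zero>" using r(1,8) by auto
    have "es ! i \<notin> v" "es ! i \<in> ?V" using rc(2)[OF i(1) i(1) i(2)] rc(1)[OF i(1) i(1)] cm(3)[OF i(1)] nu by auto
    then have "h (es ! i) \<noteq> \<zero>\<^bsub>residue_field R v\<^esub>" using H(4) by simp
    moreover have "h (es ! i) \<in> set (take (length Us) (map h es))" using i r(1) by simp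
    ultimately have "\<not> set (take (length Us) (map h es)) \<subseteq> {\<zero>\<^bsub>residue_field R v\<^esub>}" by blast
    from Q.non_trivial_combine_imp_dependent[OF H(3) kset comb0 this] ind show False by simp
  qed
  then show ?thesis using Q.finite_dimension_if_bounded[OF H(3)] unfolding h_def by blast
qed

lemma prime_degree_pos:
  assumes v: "v \<in> primes_of R"
  shows "prime_degree R v > 0"
proof -
  define h where "h = (\<lambda>a. v +>\<^bsub>local_ring R v\<^esub> a)"
  note H = residue_field_hom[OF v, folded h_def]
  interpret Q: field "residue_field R v" by (rule H(1))
  have dim: "Q.dimension (prime_degree R v) (h ` field_of_constants R) (carrier (residue_field R v))"
    using Q.finite_dimensionE[OF H(3), of "carrier (residue_field R v)"] residue_field_finite_dimension[OF v]
    unfolding prime_degree_def h_def by metis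
  show ?thesis
  proof (rule ccontr)
    assume "\<not> prime_degree R v > 0"
    then have "carrier (residue_field R v) = {\<zero>\<^bsub>residue_field R v\<^esub>}"
      using Q.dimension_zero[OF H(3)] dim by simp
    then show False using Q.one_not_zero Q.one_closed by blast
  qed
qed

text \<open>
  A one-dimensional space over the constants that contains 1 consists of constants.  As the degree is
  given by a definite description, it is a dimension only because the residue field is already known
  to be finite over the constants.
\<close>

lemma degree_one_residues:
  assumes v: "v \<in> primes_of R" and deg: "prime_degree R v = 1" and a: "a \<in> prime_ring R v"
  shows "\<exists>c \<in> field_of_constants R. a \<ominus> c \<in> v"
proof -
  let ?V = "prime_ring R v"
  define h where "h = (\<lambda>a. v +>\<^bsub>local_ring R v\<^esub> a)"
  note V = primeD(1)[OF v]
  note D = valuation_subringD[OF V]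
  have loc: "local_ring R v = R\<lparr>carrier := ?V\<rparr>" by (rule primeD(4)[OF v])
  note H = residue_field_hom[OF v, folded h_def]
  interpret Q: field "residue_field R v" by (rule H(1))
  interpret h: ring_hom_ring "local_ring R v" "residue_field R v" h by (rule H(2))
  let ?k = "h ` field_of_constants R"
  have dim: "Q.dimension 1 ?k (carrier (residue_field R v))"
    using Q.finite_dimensionE[OF H(3), of "carrier (residue_field R v)"] residue_field_finite_dimension[OF v] deg
    unfolding prime_degree_def h_def by metis
  have ind: "Q.independent ?k [\<one>\<^bsub>residue_field R v\<^esub>]"
    by (rule Q.li_Cons) (auto intro: Q.li_Nil)
  have "Q.Span ?k [\<one>\<^bsub>residue_field R v\<^esub>] = carrier (residue_field R v)"
    using Q.independent_length_eq_dimension[OF H(3) dim ind] by simp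
  moreover have "h a \<in> carrier (residue_field R v)" using H(5) a by auto
  ultimately have "h a \<in> Q.line_extension ?k \<one>\<^bsub>residue_field R v\<^esub> {\<zero>\<^bsub>residue_field R v\<^esub>}" by simp
  then obtain c where c: "c \<in> field_of_constants R"
      "h a = h c \<otimes>\<^bsub>residue_field R v\<^esub> \<one>\<^bsub>residue_field R v\<^esub> \<oplus>\<^bsub>residue_field R v\<^esub> \<zero>\<^bsub>residue_field R v\<^esub>"
    unfolding Q.line_extension_mem_iff by blast
  have cV: "c \<in> ?V" using c(1) field_of_constants_eq V by auto
  have hc: "h c \<in> carrier (residue_field R v)" using H(5) cV by auto
  then have eq: "h a = h c" using c(2) by simp
  have "h (a \<oplus> \<ominus> c) = h a \<oplus>\<^bsub>residue_field R v\<^esub> h (\<ominus> c)"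
    using h.hom_add[of a "\<ominus> c"] a cV D(7) by (simp add: loc)
  also have "h (\<ominus> c) = \<ominus>\<^bsub>residue_field R v\<^esub> h c"
    using h.hom_a_inv[of c] subring_a_inv[OF D(1) cV] cV by (simp add: loc)
  finally have "h (a \<oplus> \<ominus> c) = \<zero>\<^bsub>residue_field R v\<^esub>" using eq hc by (simp add: Q.r_neg)
  then have "a \<oplus> \<ominus> c \<in> v" using H(4)[of "a \<oplus> \<ominus> c"] a cV D(5,7) by simp
  then show ?thesis using c(1) by (auto simp: a_minus_def)
qed

end

section \<open>Divisor classes\<close>

definition divisor_of :: "('a, 'b) ring_scheme \<Rightarrow> 'a \<Rightarrow> ('a set \<Rightarrow>\<^sub>0 int)" where
  "divisor_of K x = Abs_poly_mapping (\<lambda>v. if v \<in> primes_of K then ord_at K v x else 0)"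

lemma divisor_degree_superset:
  assumes "finite A" "Poly_Mapping.keys D \<subseteq> A"
  shows "divisor_degree K D = (\<Sum>v \<in> A. Poly_Mapping.lookup D v * int (prime_degree K v))"
  unfolding divisor_degree_def by (rule sum.mono_neutral_left) (use assms in \<open>auto simp: in_keys_iff\<close>)

lemma divisor_degree_add: "divisor_degree K (D + E) = divisor_degree K D + divisor_degree K E"
proof -
  let ?A = "Poly_Mapping.keys D \<union> Poly_Mapping.keys E"
  have "Poly_Mapping.keys (D + E) \<subseteq> ?A" by (rule keys_add)
  then show ?thesis
    using divisor_degree_superset[of ?A "D + E" K] divisor_degree_superset[of ?A D K] divisor_degree_superset[of ?A E K]
    by (simp add: lookup_add sum.distrib algebra_simps)
qed

lemma divisor_degree_cmul: "divisor_degree K (frag_cmul n D) = n * divisor_degree K D"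
  using divisor_degree_superset[of "Poly_Mapping.keys D" "frag_cmul n D"] keys_cmul[of n D]
  by (simp add: divisor_degree_def sum_distrib_left mult.assoc)

lemma divisor_degree_of: "divisor_degree K (frag_of v) = int (prime_degree K v)"
  by (simp add: divisor_degree_def)

context function_field
begin

lemma lookup_divisor_of:
  assumes "x \<in> carrier R" "x \<noteq> \<zero>"
  shows "Poly_Mapping.lookup (divisor_of R x) v = (if v \<in> primes_of R then ord_at R v x else 0)"
proof -
  have "{v. (if v \<in> primes_of R then ord_at R v x else 0) \<noteq> 0} = {v \<in> primes_of R. ord_at R v x \<noteq> 0}"
    by auto
  then show ?thesis unfolding divisor_of_def
    using finite_support[OF assms] by (subst lookup_Abs_poly_mapping) auto
qed

lemma keys_divisor_of:
  assumes "x \<in> carrier R" "x \<noteq> \<zero>"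
  shows "Poly_Mapping.keys (divisor_of R x) \<subseteq> primes_of R"
  using lookup_divisor_of[OF assms] by (auto simp: in_keys_iff split: if_splits)

lemma principal_divisors_eq: "principal_divisors R = divisor_of R ` (carrier R - {\<zero>})"
proof
  show "principal_divisors R \<subseteq> divisor_of R ` (carrier R - {\<zero>})"
  proof
    fix D assume D: "D \<in> principal_divisors R"
    then obtain x where x: "x \<in> carrier R - {\<zero>}" "\<And>v. v \<in> primes_of R \<Longrightarrow> Poly_Mapping.lookup D v = ord_at R v x"
      and k: "Poly_Mapping.keys D \<subseteq> primes_of R" by (auto simp: principal_divisors_def)
    have "D = divisor_of R x"
    proof (rule poly_mapping_eqI)
      fix v
      show "Poly_Mapping.lookup D v = Poly_Mapping.lookup (divisor_of R x) v"
        using lookup_divisor_of[of x v] x k by (auto simp: in_keys_iff)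
    qed
    then show "D \<in> divisor_of R ` (carrier R - {\<zero>})" using x(1) by blast
  qed
  show "divisor_of R ` (carrier R - {\<zero>}) \<subseteq> principal_divisors R"
    using keys_divisor_of lookup_divisor_of by (force simp: principal_divisors_def)
qed

lemma divisor_of_mult:
  assumes "x \<in> carrier R" "x \<noteq> \<zero>" "y \<in> carrier R" "y \<noteq> \<zero>"
  shows "divisor_of R (x \<otimes> y) = divisor_of R x + divisor_of R y"
  using assms lookup_divisor_of[of x] lookup_divisor_of[of y] lookup_divisor_of[of "x \<otimes> y"] ord_at_mult[OF _ assms]
  by (intro poly_mapping_eqI) (simp add: lookup_add integral_iff)

lemma divisor_of_inv:
  assumes "x \<in> carrier R" "x \<noteq> \<zero>"
  shows "divisor_of R (inv x) = - divisor_of R x"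
  using lookup_divisor_of[OF assms] lookup_divisor_of[OF nonzero_inv(1,2)[OF assms]] ord_at_inv[OF _ assms]
  by (intro poly_mapping_eqI) simp

lemma zero_principal_divisor: "0 \<in> principal_divisors R"
proof -
  have "divisor_of R \<one> = 0"
    by (intro poly_mapping_eqI) (simp add: lookup_divisor_of ord_at_one)
  then have "0 = divisor_of R \<one>" by simp
  then show ?thesis unfolding principal_divisors_eq by (rule image_eqI) simp
qed

lemma principal_divisors_add:
  assumes "D \<in> principal_divisors R" "E \<in> principal_divisors R"
  shows "D + E \<in> principal_divisors R"
proof -
  obtain x where x: "x \<in> carrier R" "x \<noteq> \<zero>" "D = divisor_of R x" using assms(1) principal_divisors_eq by auto
  obtain y where y: "y \<in> carrier R" "y \<noteq> \<zero>" "E = divisor_of R y" using assms(2) principal_divisors_eq by auto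
  have "D + E = divisor_of R (x \<otimes> y)" using x y divisor_of_mult[OF x(1,2) y(1,2)] by simp
  then show ?thesis unfolding principal_divisors_eq by (rule image_eqI) (use x y in \<open>simp add: integral_iff\<close>)
qed

lemma principal_divisors_minus:
  assumes "D \<in> principal_divisors R"
  shows "- D \<in> principal_divisors R"
proof -
  obtain x where x: "x \<in> carrier R" "x \<noteq> \<zero>" "D = divisor_of R x" using assms principal_divisors_eq by auto
  have "- D = divisor_of R (inv x)" using x divisor_of_inv[OF x(1,2)] by simp
  then show ?thesis
    unfolding principal_divisors_eq by (rule image_eqI) (use nonzero_inv[OF x(1,2)] in simp)
qed

lemma constant_ord_zero:
  assumes c: "c \<in> field_of_constants R" "c \<noteq> \<zero>" and v: "v \<in> primes_of R"
  shows "ord_at R v c = 0"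
proof -
  have cc: "c \<in> carrier R" using c field_of_constants_eq by auto
  have "c \<in> prime_ring R v" "c \<notin> v" using constant_unit[OF primeD(1)[OF v] c] primeD(3)[OF v] by auto
  then show ?thesis using ord_at_nonneg_iff[OF v cc c(2)] ord_at_pos_iff[OF v cc c(2)] by simp
qed

lemma not_supported_at_one_prime:
  assumes P: "P \<in> primes_of R" and x: "x \<in> carrier R" "x \<noteq> \<zero>"
    and zero: "\<And>v. v \<in> primes_of R \<Longrightarrow> v \<noteq> P \<Longrightarrow> ord_at R v x = 0"
  shows "ord_at R P x = 0"
proof -
  have *: "ord_at R P y = 0"
    if y: "y \<in> carrier R" "y \<noteq> \<zero>" and z: "\<And>v. v \<in> primes_of R \<Longrightarrow> v \<noteq> P \<Longrightarrow> ord_at R v y = 0"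
      and pos: "ord_at R P y \<ge> 0" for y
  proof -
    have "ord_at R v y \<ge> 0" if "v \<in> primes_of R" for v using z[OF that] pos by (cases "v = P") auto
    then have "y \<in> field_of_constants R"
      using no_poles_imp_constant[OF y(1)] ord_at_nonneg_iff[OF _ y] by blast
    then show ?thesis using constant_ord_zero[OF _ y(2) P] by simp
  qed
  note i = nonzero_inv[OF x]
  show ?thesis
  proof (cases "ord_at R P x \<ge> 0")
    case True
    then show ?thesis using *[OF x zero] by blast
  next
    case False
    then have "ord_at R P (inv x) = 0"
      using *[OF i(1,2)] zero ord_at_inv[OF _ x] P by simp
    then show ?thesis using ord_at_inv[OF P x] by simp
  qed
qed

text \<open>
  If \<open>x\<close> had degree \<open>d \<noteq> 0\<close>, then \<open>D = e div(x) - d P\<close>, with \<open>e\<close> the degree of \<open>P\<close>, would have degree 0.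
  As there are finitely many classes, two different multiples of \<open>D\<close> would be equivalent, so a nonzero multiple
  of \<open>P\<close> would be the divisor of a function.  That function or its inverse has no poles, so it is constant.
\<close>

theorem degree_of_principal_divisor:
  assumes fin: "class_number R \<noteq> 0" and P: "P \<in> primes_of R" and x: "x \<in> carrier R" "x \<noteq> \<zero>"
  shows "divisor_degree R (divisor_of R x) = 0"
proof (rule ccontr)
  let ?H = "principal_divisors R" and ?G = "degree_zero_divisors R"
  define d where "d = divisor_degree R (divisor_of R x)"
  assume "divisor_degree R (divisor_of R x) \<noteq> 0"
  then have d: "d \<noteq> 0" by (simp add: d_def)
  define e where "e = prime_degree R P"
  have e: "e > 0" unfolding e_def by (rule prime_degree_pos[OF P])
  define D where "D = frag_cmul (int e) (divisor_of R x) + frag_cmul (- d) (frag_of P)"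
  have Dk: "Poly_Mapping.keys D \<subseteq> primes_of R"
  proof
    fix v assume "v \<in> Poly_Mapping.keys D"
    then have "v \<in> Poly_Mapping.keys (divisor_of R x) \<union> Poly_Mapping.keys (frag_of P)"
      using keys_add[of "frag_cmul (int e) (divisor_of R x)" "frag_cmul (- d) (frag_of P)"]
        keys_cmul[of "int e" "divisor_of R x"] keys_cmul[of "- d" "frag_of P"] unfolding D_def by blast
    then show "v \<in> primes_of R" using keys_divisor_of[OF x] P by (auto simp: keys_frag_of)
  qed
  have "divisor_degree R D = 0"
    by (simp add: D_def divisor_degree_add divisor_degree_cmul divisor_degree_of d_def e_def del: minus_frag_cmul)
  then have nD: "frag_cmul (int n) D \<in> carrier ?G" for n
    using Dk keys_cmul[of "int n" D] by (auto simp: degree_zero_divisors_def divisor_degree_cmul)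
  have coset: "?H #>\<^bsub>?G\<^esub> E = {h + E | h. h \<in> ?H}" for E
    by (auto simp: r_coset_def degree_zero_divisors_def)
  have "card (rcosets\<^bsub>?G\<^esub> ?H) \<noteq> 0" using fin by (simp add: class_number_def order_def FactGroup_def)
  then have "finite (rcosets\<^bsub>?G\<^esub> ?H)" using card.infinite[of "rcosets\<^bsub>?G\<^esub> ?H"] by argo
  moreover have "range (\<lambda>n. ?H #>\<^bsub>?G\<^esub> frag_cmul (int n) D) \<subseteq> rcosets\<^bsub>?G\<^esub> ?H"
    using nD by (auto simp: RCOSETS_def)
  ultimately have "finite (range (\<lambda>n. ?H #>\<^bsub>?G\<^esub> frag_cmul (int n) D))"
    by (rule finite_subset[rotated])
  then have "\<not> inj (\<lambda>n. ?H #>\<^bsub>?G\<^esub> frag_cmul (int n) D)"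
    using finite_imageD[of "\<lambda>n. ?H #>\<^bsub>?G\<^esub> frag_cmul (int n) D" UNIV] infinite_UNIV_nat by argo
  then obtain i j where ij: "i \<noteq> j" "?H #>\<^bsub>?G\<^esub> frag_cmul (int i) D = ?H #>\<^bsub>?G\<^esub> frag_cmul (int j) D"
    unfolding inj_def by blast
  have H0: "0 \<in> ?H" by (rule zero_principal_divisor)
  then have "frag_cmul (int i) D \<in> ?H #>\<^bsub>?G\<^esub> frag_cmul (int j) D" using ij(2) coset by force
  then obtain h where h: "h \<in> ?H" "frag_cmul (int i) D = h + frag_cmul (int j) D" using coset by auto
  obtain y where y: "y \<in> carrier R" "y \<noteq> \<zero>" "h = divisor_of R y" using h(1) principal_divisors_eq by auto
  define xi where "xi = x [^] (i * e)"
  define xj where "xj = x [^] (j * e)"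
  have xs: "xi \<in> carrier R" "xi \<noteq> \<zero>" "xj \<in> carrier R" "xj \<noteq> \<zero>"
    using x pow_nonzero[OF x] by (auto simp: xi_def xj_def)
  note ii = nonzero_inv[OF xs(1,2)]
  \<comment> \<open>the divisor of \<open>z\<close> is \<open>(j - i) d P\<close>\<close>
  define z where "z = y \<otimes> (xj \<otimes> inv xi)"
  have z: "z \<in> carrier R" "z \<noteq> \<zero>" using y xs ii by (auto simp: z_def integral_iff)
  have oz: "ord_at R v z = ord_at R v y + int (j * e) * ord_at R v x - int (i * e) * ord_at R v x"
    if v: "v \<in> primes_of R" for v
    using ord_at_mult[OF v y(1,2), of "xj \<otimes> inv xi"] ord_at_mult[OF v xs(3,4) ii(1,2)] ord_at_inv[OF v xs(1,2)]
      ord_at_pow[OF v x] xs ii unfolding z_def by (simp add: xi_def xj_def integral_iff)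
  have lk: "(int i - int j) * (int e * ord_at R v x - d * (if v = P then 1 else 0)) = ord_at R v y" if v: "v \<in> primes_of R" for v
  proof -
    have "Poly_Mapping.lookup (frag_cmul (int i) D) v = Poly_Mapping.lookup (h + frag_cmul (int j) D) v" using h(2) by simp
    then show ?thesis
      using lookup_divisor_of[OF y(1,2)] lookup_divisor_of[OF x] v
      by (simp add: y(3) D_def lookup_add algebra_simps lookup_frag_of del: minus_frag_cmul split: if_splits)
  qed
  have oz': "ord_at R v z = - ((int i - int j) * d * (if v = P then 1 else 0))" if v: "v \<in> primes_of R" for v
    using oz[OF v] lk[OF v] by (simp add: algebra_simps)
  have "ord_at R P z = 0" by (rule not_supported_at_one_prime[OF P z]) (use oz' in auto)
  then show False using oz'[OF P] d ij(1) by simp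
qed

text \<open>
  The divisor of \<open>x\<close> divided by \<open>s\<close> has degree 0, and its class is killed by \<open>s\<close> and by the class number,
  which are coprime; so it is the divisor of some \<open>a\<close>, and \<open>x / a\<^sup>s\<close> has neither zeros nor poles.
\<close>

theorem divisible_divisor_is_power:
  assumes s: "Factorial_Ring.prime s" "\<not> s dvd class_number R" and P: "P \<in> primes_of R"
    and x: "x \<in> carrier R" "x \<noteq> \<zero>" and div: "\<And>v. v \<in> primes_of R \<Longrightarrow> int s dvd ord_at R v x"
  shows "\<exists>u \<in> field_of_constants R. \<exists>a \<in> carrier R - {\<zero>}. x = u \<otimes> a [^] s"
proof -
  let ?H = "principal_divisors R" and ?G = "degree_zero_divisors R" and ?A = "divisor_group R"
  have fin: "class_number R \<noteq> 0" using s(2) by (metis dvd_0_right)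
  have s0: "s > 0" using prime_gt_0_nat[OF s(1)] .
  define E where "E = Abs_poly_mapping (\<lambda>v. if v \<in> primes_of R then ord_at R v x div int s else 0)"
  have lE: "Poly_Mapping.lookup E v = (if v \<in> primes_of R then ord_at R v x div int s else 0)" for v
    unfolding E_def
  proof (subst lookup_Abs_poly_mapping)
    show "finite {v. (if v \<in> primes_of R then ord_at R v x div int s else 0) \<noteq> 0}"
      by (rule finite_subset[OF _ finite_support[OF x]]) (auto split: if_splits)
  qed simp
  have Ek: "Poly_Mapping.keys E \<subseteq> primes_of R" using lE by (auto simp: in_keys_iff split: if_splits)
  have sE: "frag_cmul (int s) E = divisor_of R x"
  proof (rule poly_mapping_eqI)
    fix v
    show "Poly_Mapping.lookup (frag_cmul (int s) E) v = Poly_Mapping.lookup (divisor_of R x) v"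
      using lE lookup_divisor_of[OF x, of v] div by simp
  qed
  have "int s * divisor_degree R E = 0"
    using degree_of_principal_divisor[OF fin P x] divisor_degree_cmul[of R "int s" E] sE by simp
  then have EG: "E \<in> carrier ?G" using s0 Ek by (simp add: degree_zero_divisors_def)
  interpret A: comm_group ?A by (rule abelian_free_Abelian_group)
  have G0: "subgroup {D \<in> carrier ?A. divisor_degree R D = 0} ?A"
  proof (rule A.subgroupI)
    show "{D \<in> carrier ?A. divisor_degree R D = 0} \<noteq> {}"
      by (auto intro!: exI[of _ 0] simp: divisor_degree_def)
    show "inv\<^bsub>?A\<^esub> D \<in> {D \<in> carrier ?A. divisor_degree R D = 0}"
      if "D \<in> {D \<in> carrier ?A. divisor_degree R D = 0}" for D
      using that divisor_degree_cmul[of R "-1" D] by simp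
    show "D \<otimes>\<^bsub>?A\<^esub> D' \<in> {D \<in> carrier ?A. divisor_degree R D = 0}"
      if "D \<in> {D \<in> carrier ?A. divisor_degree R D = 0}" "D' \<in> {D \<in> carrier ?A. divisor_degree R D = 0}" for D D'
      using that keys_add[of D D'] by (auto simp: divisor_degree_add)
  qed auto
  have G: "comm_group ?G"
    unfolding degree_zero_divisors_def 
    by (intro group.group_comm_groupI A.subgroup_imp_group[OF G0]) (auto simp: add.commute)
  interpret G: comm_group ?G by (rule G)
  have Hsub: "?H \<subseteq> carrier ?G"
    using degree_of_principal_divisor[OF fin P] keys_divisor_of
    unfolding principal_divisors_eq by (auto simp: degree_zero_divisors_def)
  have H0: "0 \<in> ?H" by (rule zero_principal_divisor)
  have "subgroup ?H ?G"
  proof (rule G.subgroupI[OF Hsub])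
    show "?H \<noteq> {}" using H0 by auto
    show "inv\<^bsub>?G\<^esub> D \<in> ?H" if D: "D \<in> ?H" for D
    proof -
      have mD: "- D \<in> ?H" by (rule principal_divisors_minus[OF D])
      have "inv\<^bsub>?G\<^esub> D = - D"
        by (rule G.inv_equality) (use D mD Hsub in \<open>auto simp: degree_zero_divisors_def\<close>)
      then show ?thesis using mD by simp
    qed
    show "D \<otimes>\<^bsub>?G\<^esub> D' \<in> ?H" if "D \<in> ?H" "D' \<in> ?H" for D D'
      using principal_divisors_add[OF that] by (simp add: degree_zero_divisors_def)
  qed
  then have Hn: "?H \<lhd> ?G" by (rule G.subgroup_imp_normal)
  interpret N: normal ?H ?G by (rule Hn)
  interpret Q: group "?G Mod ?H" by (rule N.factorgroup_is_group)
  let ?c = "?H #>\<^bsub>?G\<^esub> E"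
  have cQ: "?c \<in> carrier (?G Mod ?H)" using EG by (auto simp: FactGroup_def RCOSETS_def)
  have "E [^]\<^bsub>?G\<^esub> s = frag_cmul (int s) E"
  proof -
    have "E [^]\<^bsub>?G\<^esub> s = E [^]\<^bsub>?A\<^esub> s"
      unfolding degree_zero_divisors_def using A.nat_pow_consistent by simp
    then show ?thesis using Ek by simp
  qed
  then have Es: "E [^]\<^bsub>?G\<^esub> s \<in> ?H" using sE x principal_divisors_eq by auto
  have "?c [^]\<^bsub>?G Mod ?H\<^esub> s = ?H #>\<^bsub>?G\<^esub> (E [^]\<^bsub>?G\<^esub> s)"
    using hom_nat_pow[OF N.r_coset_hom_Mod EG G.is_group Q.is_group] by simp
  also have "\<dots> = \<one>\<^bsub>?G Mod ?H\<^esub>"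
    using G.coset_join2[OF _ N.subgroup_axioms Es] Es Hsub by (auto simp: FactGroup_def)
  finally have "Q.ord ?c dvd s" using Q.pow_eq_id[OF cQ] by blast
  moreover have "Q.ord ?c dvd class_number R" using Q.ord_dvd_group_order[OF cQ] by (simp add: class_number_def)
  ultimately have "Q.ord ?c dvd 1"
    using s prime_imp_coprime[OF s] by (meson coprime_common_divisor)
  then have "?c [^]\<^bsub>?G Mod ?H\<^esub> (1::nat) = \<one>\<^bsub>?G Mod ?H\<^esub>" using Q.pow_eq_id[OF cQ] by blast
  then have "?c = \<one>\<^bsub>?G Mod ?H\<^esub>" using Q.nat_pow_eone[OF cQ] by (simp only:)
  then have "?c = ?H" by (simp only: one_FactGroup)
  then have "E \<in> ?H" using G.coset_join1[OF _ EG N.subgroup_axioms] by blast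
  then obtain a where a: "a \<in> carrier R" "a \<noteq> \<zero>" "E = divisor_of R a" using principal_divisors_eq by auto
  have as: "a [^] s \<in> carrier R" "a [^] s \<noteq> \<zero>" using a pow_nonzero by auto
  note ai = nonzero_inv[OF as]
  define u where "u = x \<otimes> inv (a [^] s)"
  have uc: "u \<in> carrier R" "u \<noteq> \<zero>" using x ai by (auto simp: u_def integral_iff)
  have "u \<in> prime_ring R v" if v: "v \<in> primes_of R" for v
  proof -
    have "ord_at R v a = ord_at R v x div int s"
      using lookup_divisor_of[OF a(1,2), of v] lE[of v] v a(3) by simp
    then have "ord_at R v (a [^] s) = ord_at R v x" using ord_at_pow[OF v a(1,2)] div[OF v] by simp
    then have "ord_at R v u = 0" using ord_at_mult[OF v x ai(1,2)] ord_at_inv[OF v as] by (simp add: u_def)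
    then show ?thesis using ord_at_nonneg_iff[OF v uc] by simp
  qed
  then have "u \<in> field_of_constants R" by (rule no_poles_imp_constant[OF uc(1)])
  moreover have "x = u \<otimes> a [^] s" using x as ai by (simp add: u_def m_assoc)
  ultimately show ?thesis using a by blast
qed

end

section \<open>Power differences and roots of unity\<close>

text \<open>
  The cofactor of \<open>a - b\<close> in \<open>a\<^sup>n - b\<^sup>n\<close>.
\<close>

primrec power_quotient :: "('a, 'b) ring_scheme \<Rightarrow> 'a \<Rightarrow> 'a \<Rightarrow> nat \<Rightarrow> 'a" where
  "power_quotient K a b 0 = \<zero>\<^bsub>K\<^esub>"
| "power_quotient K a b (Suc n) = a [^]\<^bsub>K\<^esub> n \<oplus>\<^bsub>K\<^esub> b \<otimes>\<^bsub>K\<^esub> power_quotient K a b n"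

context field
begin

lemma power_quotient_closed:
  assumes A: "subring A R" and "a \<in> A" "b \<in> A"
  shows "power_quotient R a b n \<in> A"
proof (induction n)
  case (Suc n)
  have "a [^] n \<in> A" using assms subringE(3,6)[OF A] by (induction n) auto
  then show ?case using Suc assms subringE(6,7)[OF A] by simp
qed (use subringE(2)[OF A] in simp)

lemma power_diff_factor:
  assumes c: "a \<in> carrier R" "b \<in> carrier R"
  shows "a [^] n \<ominus> b [^] n = (a \<ominus> b) \<otimes> power_quotient R a b n"
proof (induction n)
  case 0
  then show ?case using c by (simp add: a_minus_def r_neg)
next
  case (Suc n)
  have q: "power_quotient R a b n \<in> carrier R" by (rule power_quotient_closed[OF carrier_is_subring c])
  have p: "a [^] n \<in> carrier R" "b [^] n \<in> carrier R" using c by auto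
  have "(a \<ominus> b) \<otimes> power_quotient R a b (Suc n)
     = (a \<ominus> b) \<otimes> a [^] n \<oplus> b \<otimes> ((a \<ominus> b) \<otimes> power_quotient R a b n)"
    using c q p by (simp add: r_distr m_lcomm)
  also have "\<dots> = (a \<ominus> b) \<otimes> a [^] n \<oplus> b \<otimes> (a [^] n \<ominus> b [^] n)" using Suc by simp
  also have "\<dots> = (a \<otimes> a [^] n \<oplus> \<ominus> (b \<otimes> a [^] n)) \<oplus> (b \<otimes> a [^] n \<oplus> \<ominus> (b \<otimes> b [^] n))"
    using c p by (simp add: a_minus_def l_distr r_distr l_minus r_minus)
  also have "\<dots> = a \<otimes> a [^] n \<oplus> \<ominus> (b \<otimes> b [^] n)"
    using c p by (simp add: a_assoc r_neg1)
  also have "\<dots> = a [^] Suc n \<ominus> b [^] Suc n" using c p by (simp add: a_minus_def m_comm)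
  finally show ?case by simp
qed

text \<open>
  The cofactor is congruent to \<open>n b\<^bsup>n-1\<^esup>\<close> modulo \<open>a - b\<close>, so it is a unit at a zero of \<open>a - b\<close>
  where \<open>b\<close> is a unit, if the characteristic does not divide \<open>n\<close>.
\<close>

lemma power_quotient_mod:
  assumes V: "valuation_subring R V" and a: "a \<in> V" and b: "b \<in> V" and ab: "a \<ominus> b \<in> nonunits R V"
  shows "power_quotient R a b (Suc n) \<ominus> [Suc n] \<cdot> (b [^] n) \<in> nonunits R V"
proof (induction n)
  case 0
  have "power_quotient R a b (Suc 0) \<ominus> [Suc 0] \<cdot> (b [^] (0::nat)) = \<zero>"
    using valuation_subringD(11)[OF V b] by (simp add: a_minus_def r_neg)
  then show ?case using zero_nonunit[OF V] by simp
next
  case (Suc n)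
  note D = valuation_subringD[OF V]
  let ?q = "power_quotient R a b (Suc n)"
  have qV: "?q \<in> V" by (rule power_quotient_closed[OF D(1) a b])
  have c: "a \<in> carrier R" "b \<in> carrier R" "?q \<in> carrier R" using a b qV D(11) by auto
  have n1: "a [^] Suc n \<ominus> b [^] Suc n \<in> nonunits R V"
    unfolding power_diff_factor[OF c(1,2)] by (rule nonunits_mult(1)[OF V ab qV])
  have n2: "b \<otimes> (?q \<ominus> [Suc n] \<cdot> (b [^] n)) \<in> nonunits R V" by (rule nonunits_mult(2)[OF V Suc b])
  have e: "b \<otimes> ([Suc n] \<cdot> (b [^] n)) = [Suc n] \<cdot> (b [^] Suc n)"
    using c by (simp add: add_pow_rdistr m_comm del: add.nat_pow_Suc)
  have cs: "[Suc n] \<cdot> (b [^] n) \<in> carrier R" "[Suc n] \<cdot> (b [^] Suc n) \<in> carrier R" "a [^] Suc n \<in> carrier R"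
    "b [^] Suc n \<in> carrier R" using c by auto
  have "power_quotient R a b (Suc (Suc n)) \<ominus> [Suc (Suc n)] \<cdot> (b [^] Suc n)
    = (a [^] Suc n \<oplus> b \<otimes> ?q) \<ominus> ([Suc n] \<cdot> (b [^] Suc n) \<oplus> b [^] Suc n)"
    by simp
  also have "\<dots> = (a [^] Suc n \<ominus> b [^] Suc n) \<oplus> (b \<otimes> ?q \<ominus> [Suc n] \<cdot> (b [^] Suc n))"
  proof -
    have "(x \<oplus> y) \<ominus> (z \<oplus> w) = (x \<ominus> w) \<oplus> (y \<ominus> z)"
      if "x \<in> carrier R" "y \<in> carrier R" "z \<in> carrier R" "w \<in> carrier R" for x y z w
      using that by (simp add: a_minus_def minus_add a_ac)
    then show ?thesis using cs c by (meson m_closed)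
  qed
  also have "b \<otimes> ?q \<ominus> [Suc n] \<cdot> (b [^] Suc n) = b \<otimes> (?q \<ominus> [Suc n] \<cdot> (b [^] n))"
    unfolding e[symmetric] using c cs by (simp only: a_minus_def r_distr r_minus a_inv_closed)
  finally show ?case using nonunits_add[OF V n1 n2] by simp
qed

lemma eval_monic_binomial:
  assumes "c \<in> carrier R" "z \<in> carrier R"
  shows "eval (\<one> # replicate n \<zero> @ [c]) z = z [^] Suc n \<oplus> c"
  using assms eval_replicate[of "[c]" z n] by simp

lemma eval_all_ones:
  assumes "z \<in> carrier R"
  shows "eval (replicate n \<one>) z = power_quotient R z \<one> n"
  using assms power_quotient_closed[OF carrier_is_subring assms one_closed] by (induction n) auto

lemma finite_roots_of_unity:
  assumes "n > 0"
  shows "finite {z \<in> carrier R. z [^] (n::nat) = \<one>}"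
proof -
  obtain m where m: "n = Suc m" using assms by (cases n) auto
  let ?p = "\<one> # replicate m \<zero> @ [\<ominus> \<one>]"
  have p: "?p \<in> carrier (poly_ring R)" "?p \<noteq> []"
    unfolding univ_poly_carrier[symmetric] polynomial_def by auto
  have "{z \<in> carrier R. z [^] n = \<one>} \<subseteq> {z. is_root ?p z}"
  proof
    fix z assume "z \<in> {z \<in> carrier R. z [^] n = \<one>}"
    then have z: "z \<in> carrier R" "z [^] n = \<one>" by auto
    have "eval ?p z = \<zero>" using eval_monic_binomial[of "\<ominus> \<one>" z m] z m by (simp add: r_neg)
    then show "z \<in> {z. is_root ?p z}" using z by (simp add: is_root_def)
  qed
  then show ?thesis using finite_number_of_roots[OF p(1)] finite_subset by blast
qed

end

lemma (in algebraically_closed) exists_eval_root: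
  assumes "set p \<subseteq> carrier L" "lead_coeff p \<noteq> \<zero>" "length p \<ge> 2"
  shows "\<exists>x \<in> carrier L. eval p x = \<zero>"
proof -
  have p: "p \<in> carrier (poly_ring L)" using assms by (auto simp: univ_poly_carrier[symmetric] polynomial_def)
  have "size (roots p) = degree p" using roots_over_carrier[OF p] by (simp add: splitted_def)
  then have "roots p \<noteq> {#}" using assms(3) by auto
  then obtain x where "x \<in># roots p" by blast
  then have "is_root p x" using roots_mem_iff_is_root[OF p] by simp
  then show ?thesis by (auto simp: is_root_def)
qed

lemma (in algebraically_closed) exists_nth_root:
  assumes u: "u \<in> carrier L" and n: "n > 0"
  shows "\<exists>x \<in> carrier L. x [^] (n::nat) = u"
proof -
  obtain m where m: "n = Suc m" using n by (cases n) auto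
  let ?p = "\<one> # replicate m \<zero> @ [\<ominus> u]"
  have "set ?p \<subseteq> carrier L" using u by (auto simp: set_replicate_conv_if)
  then obtain x where x: "x \<in> carrier L" "eval ?p x = \<zero>" using exists_eval_root[of ?p] by auto
  then have "x [^] n \<ominus> u = \<zero>" using eval_monic_binomial[of "\<ominus> u" x m] u m by (simp add: a_minus_def)
  then have "x [^] n = u" using eq_of_diff[of "x [^] n" u] x u by simp
  then show ?thesis using x by blast
qed

context finite_char_field
begin

lemma multiple_unit:
  assumes V: "valuation_subring R V" and u: "u \<in> V - nonunits R V" and n: "\<not> l dvd n"
  shows "[(n::nat)] \<cdot> u \<in> V - nonunits R V"
proof -
  note D = valuation_subringD[OF V]
  have c: "u \<in> carrier R" using u D(11) by auto
  obtain m :: nat where m: "[n] \<cdot> \<one> \<otimes> [m] \<cdot> \<one> = \<one>" using multiple_inverse[OF n] by blast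
  have nV: "[n] \<cdot> \<one> \<in> V" "[m] \<cdot> \<one> \<in> V" using multiple_in_subring[OF D(1)] by auto
  have "[n] \<cdot> \<one> \<notin> nonunits R V" using nonunits_mult(1)[OF V _ nV(2), of "[n] \<cdot> \<one>"] m one_not_nonunit by auto
  then have "[n] \<cdot> \<one> \<otimes> u \<in> V - nonunits R V" using unit_mult[OF V nV(1)] u nV D(6) by auto
  moreover have "[n] \<cdot> \<one> \<otimes> u = [n] \<cdot> u" using c by (simp add: add_pow_ldistr)
  ultimately show ?thesis by simp
qed

lemma primitive_root_exists:
  assumes cl: "algebraically_closed R" and p: "Factorial_Ring.prime p" "p \<noteq> l"
  shows "\<exists>z \<in> carrier R. z [^] p = \<one> \<and> z \<noteq> \<one>"
proof -
  interpret C: algebraically_closed R by (rule cl)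
  have p2: "p \<ge> 2" using prime_ge_2_nat[OF p(1)] .
  have "lead_coeff (replicate p \<one>) \<noteq> \<zero>" using p2 by (cases p) auto
  moreover have "set (replicate p \<one>) \<subseteq> carrier R" by auto
  ultimately obtain z where z: "z \<in> carrier R" "eval (replicate p \<one>) z = \<zero>"
    using C.exists_eval_root[of "replicate p \<one>"] p2 by auto
  have q: "power_quotient R z \<one> p = \<zero>" using z eval_all_ones by simp
  then have "z [^] p \<ominus> \<one> [^] p = \<zero>" using power_diff_factor[OF z(1) one_closed, of p] z by simp
  then have "z [^] p = \<one>" using eq_of_diff[of "z [^] p" \<one>] z by simp
  moreover have "z \<noteq> \<one>"
  proof
    assume "z = \<one>"
    moreover have "power_quotient R \<one> \<one> n = [n] \<cdot> \<one>" for n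
      by (induction n) (auto simp: a_comm)
    ultimately have "[p] \<cdot> \<one> = \<zero>" using q by simp
    then have "l dvd p" using multiple_eq_zero_iff by simp
    then show False using p l_prime primes_dvd_imp_eq by blast
  qed
  ultimately show ?thesis using z by blast
qed

end

context function_field
begin

lemma ord_at_minus_constant_pole:
  assumes v: "v \<in> primes_of R" and a: "a \<in> carrier R" "a \<notin> prime_ring R v"
    and d: "d \<in> field_of_constants R" "d \<noteq> \<zero>"
  shows "a \<ominus> d \<noteq> \<zero>" "ord_at R v (a \<ominus> d) = ord_at R v a"
proof -
  note D = valuation_subringD[OF primeD(1)[OF v]]
  have a0: "a \<noteq> \<zero>" using a D(3) by auto
  have dc: "d \<in> carrier R" "\<ominus> d \<noteq> \<zero>" using d field_of_constants_eq by (auto simp: minus_equality)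
  have md: "\<ominus> d \<in> field_of_constants R" using subringE(5)[OF subfieldE(1)[OF field_of_constants_subfield]] d by blast
  note ai = nonzero_inv[OF a(1) a0]
  have neg: "ord_at R v a < 0" using ord_at_nonneg_iff[OF v a(1) a0] a by simp
  let ?y = "\<ominus> d \<otimes> inv a"
  have y: "?y \<in> carrier R" "?y \<noteq> \<zero>" using dc ai by (auto simp: integral_iff)
  have "ord_at R v ?y = - ord_at R v a"
    using ord_at_mult[OF v _ dc(2) ai(1,2)] constant_ord_zero[OF md dc(2) v] ord_at_inv[OF v a(1) a0] dc by simp
  then have o: "\<one> \<oplus> ?y \<noteq> \<zero>" "ord_at R v (\<one> \<oplus> ?y) = 0" using ord_at_one_plus(1)[OF v y] neg by auto
  have "a \<otimes> (\<one> \<oplus> ?y) = a \<oplus> \<ominus> d \<otimes> (inv a \<otimes> a)" using a dc ai(1) by (simp add: r_distr m_ac l_minus r_minus)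
  then have e: "a \<ominus> d = a \<otimes> (\<one> \<oplus> ?y)" using dc ai by (simp add: a_minus_def)
  show "a \<ominus> d \<noteq> \<zero>" unfolding e using a a0 o y by (simp add: integral_iff)
  show "ord_at R v (a \<ominus> d) = ord_at R v a" unfolding e using ord_at_mult[OF v a(1) a0 _ o(1)] o(2) y by simp
qed

text \<open>
  At a zero of \<open>a - d\<close> the cofactor in \<open>a\<^sup>r - d\<^sup>r = b\<^sup>s\<close> is a unit, so \<open>a - d\<close> has the order of \<open>b\<^sup>s\<close>.
  At a pole the orders of \<open>a\<^sup>r\<close> and \<open>b\<^sup>s\<close> agree, and \<open>s\<close> is prime to \<open>r\<close>.
\<close>

lemma catalan_factor_divisor:
  assumes v: "v \<in> primes_of R" and a: "a \<in> carrier R" and b: "b \<in> carrier R" "b \<noteq> \<zero>"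
    and d: "d \<in> field_of_constants R" "d \<noteq> \<zero>" and r: "Factorial_Ring.prime r" "r \<noteq> l"
    and s: "Factorial_Ring.prime s" "r \<noteq> s"
    and eq: "a [^] r \<ominus> d [^] r = b [^] s" and nz: "a \<ominus> d \<noteq> \<zero>"
  shows "int s dvd ord_at R v (a \<ominus> d)"
proof -
  let ?V = "prime_ring R v"
  note V = primeD(1)[OF v]
  note D = valuation_subringD[OF V]
  note nu = primeD(3)[OF v]
  have dc: "d \<in> carrier R" using d field_of_constants_eq by auto
  obtain n where n: "r = Suc n" using prime_gt_0_nat[OF r(1)] by (cases r) auto
  have ob: "ord_at R v (b [^] s) = int s * ord_at R v b" by (rule ord_at_pow[OF v b])
  have x: "a \<ominus> d \<in> carrier R" using a dc by simp
  show ?thesis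
  proof (cases "a \<in> ?V")
    case True
    have dV: "d \<in> ?V" "d \<notin> nonunits R ?V" using constant_unit[OF V d] by auto
    have xV: "a \<ominus> d \<in> ?V" using True dV D(8) by auto
    show ?thesis
    proof (cases "a \<ominus> d \<in> v")
      case False
      then have "ord_at R v (a \<ominus> d) = 0"
        using ord_at_nonneg_iff[OF v x nz] ord_at_pos_iff[OF v x nz] xV by simp
      then show ?thesis by simp
    next
      case xv: True
      let ?q = "power_quotient R a d r"
      have qV: "?q \<in> ?V" by (rule power_quotient_closed[OF D(1) True dV(1)])
      have qc: "?q \<in> carrier R" using qV D(11) by auto
      have "d [^] k \<in> ?V - nonunits R ?V" for k :: nat
        using dV D(4,6) one_not_nonunit unit_mult[OF V] by (induction k) auto
      moreover have "\<not> l dvd r" using r l_prime primes_dvd_imp_eq by blast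
      ultimately have u: "[r] \<cdot> (d [^] n) \<in> ?V - nonunits R ?V" by (rule multiple_unit[OF V])
      have m: "?q \<ominus> [r] \<cdot> (d [^] n) \<in> nonunits R ?V"
        unfolding n using power_quotient_mod[OF V True dV(1)] xv nu by simp
      have "[r] \<cdot> (d [^] n) \<oplus> (?q \<ominus> [r] \<cdot> (d [^] n)) = ?q"
        using qc dc by (simp add: a_minus_def r_neg1 a_lcomm r_neg)
      moreover have "[r] \<cdot> (d [^] n) \<oplus> (?q \<ominus> [r] \<cdot> (d [^] n)) \<notin> nonunits R ?V"
        using unit_add_nonunit(2)[OF V _ _ m] u by blast
      ultimately have "?q \<notin> nonunits R ?V" by simp
      then have qn: "?q \<notin> v" "?q \<noteq> \<zero>" using nu zero_nonunit[OF V] by auto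
      have "ord_at R v ?q = 0"
        using ord_at_nonneg_iff[OF v qc qn(2)] ord_at_pos_iff[OF v qc qn(2)] qV qn by simp
      then have "ord_at R v (a [^] r \<ominus> d [^] r) = ord_at R v (a \<ominus> d)"
        unfolding power_diff_factor[OF a dc] using ord_at_mult[OF v x nz qc qn(2)] by simp
      then have "ord_at R v (a \<ominus> d) = int s * ord_at R v b" using eq ob by simp
      then show ?thesis by simp
    qed
  next
    case False
    have a0: "a \<noteq> \<zero>" using False D(3) by auto
    have "a [^] r \<notin> ?V" using valuation_subring_root_closed[OF V a] False prime_gt_0_nat[OF r(1)] by blast
    moreover have dr: "d [^] r \<in> field_of_constants R" "d [^] r \<noteq> \<zero>"
    proof -
      have "d [^] k \<in> field_of_constants R" for k :: nat
        using subringE(3,6)[OF subfieldE(1)[OF field_of_constants_subfield]] d by (induction k) auto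
      then show "d [^] r \<in> field_of_constants R" .
      show "d [^] r \<noteq> \<zero>" by (rule pow_nonzero[OF dc d(2)])
    qed
    ultimately have "ord_at R v (a [^] r \<ominus> d [^] r) = int r * ord_at R v a"
      using ord_at_minus_constant_pole(2)[OF v _ _ dr, of "a [^] r"] a ord_at_pow[OF v a a0] by simp
    then have "int r * ord_at R v a = int s * ord_at R v b" using eq ob by simp
    then have "int s dvd int r * ord_at R v a" by (rule dvdI)
    moreover have "coprime (int s) (int r)" using r(1) s primes_coprime by (simp add: coprime_commute)
    ultimately have "int s dvd ord_at R v a" by (simp add: coprime_dvd_mult_right_iff)
    then show ?thesis using ord_at_minus_constant_pole(2)[OF v a False d] by simp
  qed
qed

end

section \<open>Constant extensions and the prime of degree 1\<close>

lemma (in ring) combine_in_subring: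
  assumes A: "subring A R" and "set ks \<subseteq> A" "set us \<subseteq> A"
  shows "combine ks us \<in> A"
  using assms(2,3)
  by (induction ks us rule: combine.induct) (use subringE(2,6,7)[OF A] in auto)

context field
begin

lemma m_inv_subfield:
  assumes K: "subfield K R" and x: "x \<in> K" "x \<noteq> \<zero>"
  shows "inv\<^bsub>R\<lparr>carrier := K\<rparr>\<^esub> x = inv x"
proof -
  interpret K: field "R\<lparr>carrier := K\<rparr>" by (rule subfield_iff(2)[OF K])
  have "inv x \<in> K" "x \<otimes> inv x = \<one>" using subfield_m_inv[OF K, of x] x by auto
  then show ?thesis using K.inv_unique_field(1)[of x "inv x"] x by simp
qed

lemma a_minus_subfield:
  assumes K: "subfield K R" and y: "y \<in> K"
  shows "x \<ominus>\<^bsub>R\<lparr>carrier := K\<rparr>\<^esub> y = x \<ominus> y"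
  using subring_a_inv[OF subfieldE(1)[OF K] y] by (simp add: a_minus_def)

lemma subring_restrict:
  assumes K: "subfield K R" and A: "subring A R"
  shows "subring (A \<inter> K) (R\<lparr>carrier := K\<rparr>)"
proof -
  interpret K: field "R\<lparr>carrier := K\<rparr>" by (rule subfield_iff(2)[OF K])
  have "ring (R\<lparr>carrier := A \<inter> K\<rparr>)" by (intro subring_is_ring subring_inter A subfieldE(1)[OF K])
  then show ?thesis using K.subring_iff[of "A \<inter> K"] by simp
qed

lemma valuation_restrict:
  assumes K: "subfield K R" and V: "valuation_subring R V"
  shows "valuation_subring (R\<lparr>carrier := K\<rparr>) (V \<inter> K)"
    and "nonunits (R\<lparr>carrier := K\<rparr>) (V \<inter> K) = nonunits R V \<inter> K"
proof -
  have i: "inv\<^bsub>R\<lparr>carrier := K\<rparr>\<^esub> x = inv x" "inv x \<in> K" if "x \<in> K" "x \<noteq> \<zero>" for x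
    using m_inv_subfield[OF K that] subfield_m_inv(1)[OF K] that by auto
  note D = valuation_subringD[OF V]
  show "valuation_subring (R\<lparr>carrier := K\<rparr>) (V \<inter> K)"
    unfolding valuation_subring_def
  proof (intro conjI ballI impI subring_restrict[OF K D(1)])
    fix x assume "x \<in> carrier (R\<lparr>carrier := K\<rparr>)" "x \<notin> V \<inter> K"
    then have x: "x \<in> K" "x \<notin> V" by auto
    then have "x \<noteq> \<zero>" "x \<in> carrier R" using D(3) subfieldE(3)[OF K] by auto
    then show "inv\<^bsub>R\<lparr>carrier := K\<rparr>\<^esub> x \<in> V \<inter> K" using i[OF x(1)] D(10) x by auto
  qed
  show "nonunits (R\<lparr>carrier := K\<rparr>) (V \<inter> K) = nonunits R V \<inter> K"
    using i by (auto simp: nonunits_def)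
qed

lemma generate_field_restrict:
  assumes K: "subfield K R" and S: "S \<subseteq> K"
  shows "generate_field (R\<lparr>carrier := K\<rparr>) S = generate_field R S"
  using subfield_gen_equality[OF K S] by simp

lemma prime_subfield_restrict:
  assumes K: "subfield K R"
  shows "prime_subfield (R\<lparr>carrier := K\<rparr>) = prime_subfield R"
  unfolding prime_subfield_def by (rule generate_field_restrict[OF K]) simp

lemma field_of_constants_restrict:
  assumes K: "subfield K R"
  shows "field_of_constants (R\<lparr>carrier := K\<rparr>) = field_of_constants R \<inter> K"
  using prime_subfield_restrict[OF K] algebraic_consistent[OF subfieldE(1)[OF K]] subfieldE(3)[OF K]
  by (auto simp: field_of_constants_def)

lemma add_pow_restrict: "[(n::nat)] \<cdot>\<^bsub>R\<lparr>carrier := K\<rparr>\<^esub> x = [n] \<cdot> x"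
  by (simp add: add_pow_def nat_pow_def)

end

text \<open>
  All fields of the argument are subfields of an algebraic closure of \<open>F\<close>, and their valuation subrings are
  obtained by restriction from valuation subrings of that closure.
\<close>

locale degree_one_place = algebraic_closure R F for R (structure) and F +
  fixes l :: nat and P
  assumes gff: "global_function_field l (R\<lparr>carrier := F\<rparr>)"
    and P: "P \<in> primes_of (R\<lparr>carrier := F\<rparr>)" "prime_degree (R\<lparr>carrier := F\<rparr>) P = 1"

sublocale degree_one_place \<subseteq> finite_char_field R l
proof unfold_locales
  show "Factorial_Ring.prime l" using gff by (simp add: global_function_field_def)
  show "[l] \<cdot> \<one> = \<zero>" using gff add_pow_restrict by (simp add: global_function_field_def)
qed

sublocale degree_one_place \<subseteq> FF: function_field "R\<lparr>carrier := F\<rparr>" l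
proof -
  have "field (R\<lparr>carrier := F\<rparr>)" by (rule subfield_iff(2)[OF subfield_axioms])
  then show "function_field (R\<lparr>carrier := F\<rparr>) l"
    using gff by (simp add: function_field_def function_field_axioms_def)
qed

context degree_one_place
begin

abbreviation "constants \<equiv> field_of_constants R"
abbreviation "Rinf \<equiv> prime_ring (R\<lparr>carrier := F\<rparr>) P"

lemma F_sub: "subfield F R" "subring F R" "F \<subseteq> carrier R"
  using subfield_axioms subfieldE(1,3)[OF subfield_axioms] by auto

lemma constants_sub: "subfield constants R" "subring constants R" "constants \<subseteq> carrier R"
  using field_of_constants_subfield subfieldE(1,3)[OF field_of_constants_subfield] by auto

lemma kappa_eq: "field_of_constants (R\<lparr>carrier := F\<rparr>) = constants \<inter> F"
  by (rule field_of_constants_restrict[OF F_sub(1)])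

lemma kappa_sub: "subfield (constants \<inter> F) R"
proof -
  have "field (R\<lparr>carrier := F\<rparr>\<lparr>carrier := field_of_constants (R\<lparr>carrier := F\<rparr>)\<rparr>)"
    by (rule FF.subfield_iff(2)[OF FF.field_of_constants_subfield])
  then show ?thesis using subfield_iff(1)[of "constants \<inter> F"] kappa_eq F_sub(3) by auto
qed

lemma constant_rootI:
  assumes "x \<in> carrier R" "x [^] (n::nat) \<in> constants" "n > 0"
  shows "x \<in> constants"
  using assms valuation_subring_root_closed unfolding field_of_constants_eq by blast

text \<open>
  A transcendence basis of \<open>F\<close> remains one, because \<open>F\<close> and then the whole algebraic closure are contained in
  every valuation subring that contains \<open>k(t)\<close>.
\<close>

lemma extension_is_function_field:
  assumes mu: "finite \<mu>" "\<mu> \<subseteq> carrier R"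
  shows "global_function_field l (R\<lparr>carrier := generate_field R (F \<union> \<mu>)\<rparr>)"
proof -
  define K where "K = generate_field R (F \<union> \<mu>)"
  have FK: "F \<subseteq> K" and muK: "\<mu> \<subseteq> K" by (auto simp: K_def intro: generate_field.incl)
  have K: "subfield K R" unfolding K_def by (rule generate_field_is_subfield) (use mu F_sub in auto)
  obtain S where S: "finite S" "S \<subseteq> F" "F = generate_field (R\<lparr>carrier := F\<rparr>) S"
    using gff by (auto simp: global_function_field_def)
  obtain t where t: "t \<in> F" "(ring.transcendental (R\<lparr>carrier := F\<rparr>) over prime_subfield (R\<lparr>carrier := F\<rparr>)) t"
    and alg: "\<And>x. x \<in> F \<Longrightarrow> (ring.algebraic (R\<lparr>carrier := F\<rparr>) over generate_field (R\<lparr>carrier := F\<rparr>) {t}) x"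
    using gff by (auto simp: global_function_field_def)
  have FS: "F = generate_field R S" using S generate_field_restrict[OF F_sub(1) S(2)] by simp
  have SK: "S \<union> \<mu> \<subseteq> K" using S(2) FK muK by auto
  have Kc: "K \<subseteq> carrier R" by (rule subfieldE(3)[OF K])
  have "F \<subseteq> generate_field R (S \<union> \<mu>)" unfolding FS by (rule mono_generate_field) (use SK Kc in auto)
  then have "K \<subseteq> generate_field R (S \<union> \<mu>)"
    unfolding K_def
    by (intro generate_field_min_subfield1 generate_field_is_subfield) (use SK Kc F_sub mu in \<open>auto intro: generate_field.incl\<close>)
  moreover have "generate_field R (S \<union> \<mu>) \<subseteq> K" using generate_field_min_subfield1[OF _ K SK] SK Kc by auto
  ultimately have gen: "K = generate_field (R\<lparr>carrier := K\<rparr>) (S \<union> \<mu>)"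
    using generate_field_restrict[OF K SK] by auto
  have tK: "t \<in> K" "t \<in> carrier R" using t FK Kc by auto
  have tr: "(transcendental over prime_subfield R) t"
    using t(2) transcendental_consistent[OF F_sub(2)] prime_subfield_restrict[OF F_sub(1)] by simp
  have Et: "subfield (generate_field R {t}) R" by (rule generate_field_is_subfield) (use tK in auto)
  have algF: "(algebraic over generate_field R {t}) x" if "x \<in> F" for x
    using alg[OF that] algebraic_consistent[OF F_sub(2)] generate_field_restrict[OF F_sub(1), of "{t}"] t(1) by simp
  have algK: "(algebraic over generate_field R {t}) x" if x: "x \<in> carrier R" for x
  proof -
    have "x \<in> V" if V: "valuation_subring R V" "generate_field R {t} \<subseteq> V" for V
    proof -
      have "F \<subseteq> V" using algF algebraic_iff_valuation_subrings[OF Et] V F_sub(3) by blast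
      then show ?thesis
        using algebraic_extension[OF x] algebraic_iff_valuation_subrings[OF F_sub(1) x] V by blast
    qed
    then show ?thesis using algebraic_iff_valuation_subrings[OF Et x] by blast
  qed
  have algK': "(ring.algebraic (R\<lparr>carrier := K\<rparr>) over generate_field (R\<lparr>carrier := K\<rparr>) {t}) x" if "x \<in> K" for x
    using algK[of x] that Kc algebraic_consistent[OF subfieldE(1)[OF K]] generate_field_restrict[OF K, of "{t}"] tK by auto
  have tr': "(ring.transcendental (R\<lparr>carrier := K\<rparr>) over prime_subfield (R\<lparr>carrier := K\<rparr>)) t"
    using tr transcendental_consistent[OF subfieldE(1)[OF K]] prime_subfield_restrict[OF K] by simp
  have "global_function_field l (R\<lparr>carrier := K\<rparr>)"
    unfolding global_function_field_def
  proof (intro conjI)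
    show "field (R\<lparr>carrier := K\<rparr>)" by (rule subfield_iff(2)[OF K])
    show "Factorial_Ring.prime l" by (rule l_prime)
    show "[l] \<cdot>\<^bsub>R\<lparr>carrier := K\<rparr>\<^esub> \<one>\<^bsub>R\<lparr>carrier := K\<rparr>\<^esub> = \<zero>\<^bsub>R\<lparr>carrier := K\<rparr>\<^esub>"
      using char_l add_pow_restrict by simp
    show "\<exists>S. finite S \<and> S \<subseteq> carrier (R\<lparr>carrier := K\<rparr>) \<and> carrier (R\<lparr>carrier := K\<rparr>) = generate_field (R\<lparr>carrier := K\<rparr>) S"
      using gen SK S(1) mu(1) by (intro exI[of _ "S \<union> \<mu>"]) auto
    show "\<exists>t\<in>carrier (R\<lparr>carrier := K\<rparr>). (ring.transcendental (R\<lparr>carrier := K\<rparr>) over prime_subfield (R\<lparr>carrier := K\<rparr>)) t \<and>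
      (\<forall>x\<in>carrier (R\<lparr>carrier := K\<rparr>). (ring.algebraic (R\<lparr>carrier := K\<rparr>) over generate_field (R\<lparr>carrier := K\<rparr>) {t}) x)"
      using tK tr' algK' by (intro bexI[of _ t]) auto
  qed
  then show ?thesis by (simp add: K_def)
qed

text \<open>
  The field \<open>F k'\<close> generated by \<open>F\<close> and the algebraic closure \<open>k'\<close> of the constants.  The description by
  linear combinations is the one that makes the primes over \<open>P\<close> visible.
\<close>

definition compositum :: "'a set" where
  "compositum = (\<Union>us \<in> {us. set us \<subseteq> constants}. Span F us)"

lemma compositumE:
  assumes "z \<in> compositum"
  obtains us fs where "set us \<subseteq> constants" "set fs \<subseteq> F" "length fs = length us" "z = combine fs us"
proof -
  obtain us where us: "set us \<subseteq> constants" "z \<in> Span F us" using assms by (auto simp: compositum_def)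
  have "set us \<subseteq> carrier R" using us(1) constants_sub(3) by blast
  from us(2)[unfolded Span_mem_iff_length_version[OF F_sub(1) this]] show thesis using us(1) that by blast
qed

lemma compositumI:
  assumes "set us \<subseteq> constants" "set fs \<subseteq> F" "length fs = length us"
  shows "combine fs us \<in> compositum"
proof -
  have "set us \<subseteq> carrier R" using assms(1) constants_sub(3) by blast
  from Span_mem_iff_length_version[OF F_sub(1) this] have "combine fs us \<in> Span F us"
    using assms(2,3) by blast
  then show ?thesis using assms(1) unfolding compositum_def by blast
qed

lemma compositum_carrier: "compositum \<subseteq> carrier R"
  unfolding compositum_def using Span_subgroup_props(1)[OF F_sub(1)] constants_sub(3) by blast

lemma compositum_add:
  assumes "a \<in> compositum" "b \<in> compositum"
  shows "a \<oplus> b \<in> compositum"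
proof -
  obtain us where us: "set us \<subseteq> constants" "a \<in> Span F us" using assms by (auto simp: compositum_def)
  obtain vs where vs: "set vs \<subseteq> constants" "b \<in> Span F vs" using assms by (auto simp: compositum_def)
  have c: "set us \<subseteq> carrier R" "set vs \<subseteq> carrier R" using us vs constants_sub(3) by auto
  have "a \<in> Span F (us @ vs)" using mono_Span_append(1)[OF F_sub(1) c] us by auto
  moreover have "b \<in> Span F (us @ vs)" using mono_Span_append(2)[OF F_sub(1) c(2,1)] vs by auto
  ultimately have "a \<oplus> b \<in> Span F (us @ vs)"
    using Span_subgroup_props(3)[OF F_sub(1), of "us @ vs" a b] c by (simp only: set_append Un_subset_iff)
  moreover have "set (us @ vs) \<subseteq> constants" using us vs by simp
  ultimately show ?thesis unfolding compositum_def by blast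
qed

lemma compositum_smult:
  assumes "a \<in> compositum" "k \<in> F"
  shows "k \<otimes> a \<in> compositum"
proof -
  obtain us where us: "set us \<subseteq> constants" "a \<in> Span F us" using assms(1) by (auto simp: compositum_def)
  have "set us \<subseteq> carrier R" using us(1) constants_sub(3) by blast
  from Span_smult_closed[OF F_sub(1) this assms(2) us(2)] have "k \<otimes> a \<in> Span F us" .
  then show ?thesis using us(1) unfolding compositum_def by blast
qed

lemma compositum_constant_mult:
  assumes a: "a \<in> compositum" and w: "w \<in> constants"
  shows "a \<otimes> w \<in> compositum"
proof -
  obtain us fs where u: "set us \<subseteq> constants" "set fs \<subseteq> F" "length fs = length us" "a = combine fs us"
    using compositumE[OF a] by blast
  have c: "set fs \<subseteq> carrier R" "set us \<subseteq> carrier R" "w \<in> carrier R"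
    using u(1,2) F_sub(3) constants_sub(3) w by blast+
  have "a \<otimes> w = combine fs (map (\<lambda>u. u \<otimes> w) us)" unfolding u(4) by (rule combine_l_distr[OF c])
  moreover have "set (map (\<lambda>u. u \<otimes> w) us) \<subseteq> constants" using u(1) subringE(6)[OF constants_sub(2) _ w] by auto
  ultimately show ?thesis using compositumI[of "map (\<lambda>u. u \<otimes> w) us" fs] u by simp
qed

lemma zero_compositum: "\<zero> \<in> compositum"
  using compositumI[of "[]" "[]"] by simp

lemma compositum_mult:
  assumes a: "a \<in> compositum" and b: "b \<in> compositum"
  shows "a \<otimes> b \<in> compositum"
proof -
  obtain us fs where u: "set us \<subseteq> constants" "set fs \<subseteq> F" "length fs = length us" "b = combine fs us"
    using compositumE[OF b] by blast
  have ac: "a \<in> carrier R" using a compositum_carrier by auto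
  have "a \<otimes> combine fs us \<in> compositum"
    using u(1,2)
  proof (induction fs us rule: combine.induct)
    case (1 k Ks u Us)
    have c: "k \<in> carrier R" "u \<in> carrier R" "set Ks \<subseteq> carrier R" "set Us \<subseteq> carrier R"
      using 1(2,3) F_sub(3) constants_sub(3) by auto
    have "a \<otimes> combine (k # Ks) (u # Us) = k \<otimes> (a \<otimes> u) \<oplus> a \<otimes> combine Ks Us"
      using c ac by (simp add: r_distr m_lcomm)
    moreover have "k \<otimes> (a \<otimes> u) \<in> compositum"
      by (intro compositum_smult compositum_constant_mult a) (use 1(2,3) in auto)
    ultimately show ?case using 1 compositum_add by auto
  qed (use zero_compositum ac in auto)
  then show ?thesis using u by simp
qed

lemma F_compositum: "F \<subseteq> compositum"
proof
  fix f assume f: "f \<in> F"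
  have "combine [f] [\<one>] \<in> compositum" by (rule compositumI) (use f subringE(3)[OF constants_sub(2)] in auto)
  then show "f \<in> compositum" using f F_sub(3) by (simp add: subsetD)
qed

lemma constants_compositum: "constants \<subseteq> compositum"
proof
  fix c assume c: "c \<in> constants"
  have "combine [\<one>] [c] \<in> compositum" by (rule compositumI) (use c subringE(3)[OF F_sub(2)] in auto)
  then show "c \<in> compositum" using c constants_sub(3) by (simp add: subsetD)
qed

lemma compositum_subfield: "subfield compositum R"
proof -
  have sub: "subring compositum R"
  proof (rule subringI)
    show "compositum \<subseteq> carrier R" by (rule compositum_carrier)
    show "\<one> \<in> compositum" using F_compositum subringE(3)[OF F_sub(2)] by auto
    show "\<ominus> h \<in> compositum" if h: "h \<in> compositum" for h
    proof -
      have "\<ominus> \<one> \<in> F" using subringE(3,5)[OF F_sub(2)] by auto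
      then have "\<ominus> \<one> \<otimes> h \<in> compositum" using compositum_smult[OF h] by simp
      then show ?thesis using h compositum_carrier by (simp add: l_minus subsetD)
    qed
  qed (use compositum_mult compositum_add in auto)
  show ?thesis
  proof (rule subfieldI'[OF sub])
    fix z assume z: "z \<in> compositum - {\<zero>}"
    then have zc: "z \<in> carrier R" using compositum_carrier by auto
    have "subfield (simple_extension F z) R"
      using simple_extension_is_subfield[OF F_sub(1) zc] algebraic_extension[OF zc] by simp
    then have "inv z \<in> simple_extension F z"
      using subfield_m_inv(1) simple_extension_mem[OF F_sub(2) zc] z by blast
    also have "\<dots> \<subseteq> compositum"
      by (rule simple_extension_subring_incl[OF sub F_compositum]) (use z in auto)
    finally show "inv z \<in> compositum" .
  qed
qed

text \<open>
  Dependent constants can be eliminated from the combination, because the coefficients of a relation between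
  constants over the constants in \<open>F\<close> are absorbed by \<open>F\<close>.
\<close>

lemma compositum_independent:
  assumes "z \<in> compositum"
  shows "\<exists>ws fs. set ws \<subseteq> constants \<and> independent (constants \<inter> F) ws \<and> set fs \<subseteq> F \<and>
     length fs = length ws \<and> z = combine fs ws"
proof -
  let ?k = "constants \<inter> F"
  obtain us where us: "set us \<subseteq> constants" "z \<in> Span F us" using assms by (auto simp: compositum_def)
  have uc: "set us \<subseteq> carrier R" using us constants_sub(3) by auto
  obtain ws where ws: "set ws \<subseteq> carrier R" "independent ?k ws" "Span ?k ws = Span ?k us"
    using filter_base[OF kappa_sub uc] by blast
  have "set ws \<subseteq> constants"
  proof
    fix w assume "w \<in> set ws"
    then have "w \<in> Span ?k us" using Span_base_incl[OF kappa_sub ws(1)] ws(3) by auto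
    then obtain ks where "set ks \<subseteq> ?k" "w = combine ks us"
      using Span_mem_iff_length_version[OF kappa_sub uc] by blast
    then show "w \<in> constants" using combine_in_subring[OF constants_sub(2)] us(1) by auto
  qed
  moreover have "set us \<subseteq> Span F ws"
  proof
    fix u assume "u \<in> set us"
    then have "u \<in> Span ?k ws" using Span_base_incl[OF kappa_sub uc] ws(3) by auto
    then obtain ks where "set ks \<subseteq> ?k" "length ks = length ws" "u = combine ks ws"
      using Span_mem_iff_length_version[OF kappa_sub ws(1)] by blast
    then show "u \<in> Span F ws" using Span_mem_iff_length_version[OF F_sub(1) ws(1)] by blast
  qed
  then have "z \<in> Span F ws" using mono_Span_subset[OF F_sub(1) _ ws(1)] us(2) by blast
  ultimately show ?thesis using Span_mem_iff_length_version[OF F_sub(1) ws(1)] ws(2) by blast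
qed

lemma combine_congruent:
  assumes V: "valuation_subring R V"
    and "set gs \<subseteq> carrier R" "set ws \<subseteq> V" "\<And>g. g \<in> set gs \<Longrightarrow> c g \<in> carrier R \<and> g \<ominus> c g \<in> nonunits R V"
  shows "combine gs ws \<ominus> combine (map c gs) ws \<in> nonunits R V"
  using assms(2-4)
proof (induction gs ws rule: combine.induct)
  case (1 g gs w ws)
  note D = valuation_subringD[OF V]
  have IH: "combine gs ws \<ominus> combine (map c gs) ws \<in> nonunits R V" using 1 by simp
  have m: "(g \<ominus> c g) \<otimes> w \<in> nonunits R V" using nonunits_mult(1)[OF V] 1(3,4) by simp
  have cc: "g \<in> carrier R" "w \<in> carrier R" "c g \<in> carrier R" using 1(2-4) D(11) by auto
  have cs: "combine gs ws \<in> carrier R" "combine (map c gs) ws \<in> carrier R"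
    using 1(2-4) D(2) by (auto intro!: combine_in_carrier)
  have "combine (g # gs) (w # ws) \<ominus> combine (map c (g # gs)) (w # ws)
     = (g \<ominus> c g) \<otimes> w \<oplus> (combine gs ws \<ominus> combine (map c gs) ws)"
    using cc cs by (simp add: a_minus_def l_distr l_minus minus_add a_ac)
  then show ?case using nonunits_add[OF V m IH] by simp
qed (use zero_nonunit[OF V] in \<open>auto simp: a_minus_def\<close>)

lemma nonunits_over_infinity:
  assumes V: "valuation_subring R V" "V \<inter> F = Rinf"
  shows "P \<subseteq> nonunits R V"
  using valuation_restrict(2)[OF F_sub(1) V(1)] V(2) FF.primeD(3)[OF P(1)] by auto

text \<open>
  Here the degree of \<open>P\<close> matters.  Divide by the coefficient of smallest order; the new coefficients are
  congruent modulo \<open>P\<close> to constants in \<open>F\<close>, one of them nonzero, so by independence the combination is congruent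
  to a nonzero constant and is a unit.  Hence the order of a combination is the minimum of the orders
  of its coefficients, which determines the valuation on the compositum.
\<close>

lemma over_infinity_iff:
  assumes V: "valuation_subring R V" "V \<inter> F = Rinf"
    and ws: "set ws \<subseteq> constants" "independent (constants \<inter> F) ws"
    and fs: "set fs \<subseteq> F" "length fs = length ws"
  shows "combine fs ws \<in> V \<longleftrightarrow> set fs \<subseteq> Rinf"
proof
  note D = valuation_subringD[OF V(1)]
  have wsV: "set ws \<subseteq> V" using ws(1) V(1) by (auto simp: field_of_constants_eq)
  show "combine fs ws \<in> V" if "set fs \<subseteq> Rinf"
    using combine_in_subring[OF D(1) _ wsV] that V(2) by auto
  assume zV: "combine fs ws \<in> V"
  define z where "z = combine fs ws"
  define I where "I = {i. i < length fs \<and> fs ! i \<noteq> \<zero>}"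
  note DF = FF.valuation_subringD[OF FF.primeD(1)[OF P(1)]]
  have zeroR: "\<zero> \<in> Rinf" using DF(3) by simp
  have fsc: "set fs \<subseteq> carrier R" and wsc: "set ws \<subseteq> carrier R" using fs F_sub(3) ws constants_sub(3) by auto
  have fm: "fs ! i \<in> F" if "i < length fs" for i using fs(1) nth_mem[OF that] by auto
  show "set fs \<subseteq> Rinf"
  proof (cases "I = {}")
    case True
    then show ?thesis using zeroR by (auto simp: I_def set_conv_nth)
  next
    case False
    let ?o = "\<lambda>i. ord_at (R\<lparr>carrier := F\<rparr>) P (fs ! i)"
    have fin: "finite (?o ` I)" by (simp add: I_def)
    \<comment> \<open>\<open>i0\<close> is the index of a nonzero coefficient of smallest order at \<open>P\<close>\<close>
    have "Min (?o ` I) \<in> ?o ` I" using Min_in[OF fin] False by simp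
    then obtain i0 where i0: "i0 \<in> I" "?o i0 = Min (?o ` I)" by auto
    have least: "?o i0 \<le> ?o i" if "i \<in> I" for i using i0(2) Min_le[OF fin] that by simp
    define f0 where "f0 = fs ! i0"
    have f0: "f0 \<in> F" "f0 \<noteq> \<zero>" "f0 \<in> carrier R" using i0(1) fm F_sub(3) by (auto simp: I_def f0_def)
    note f0i = nonzero_inv[OF f0(3,2)]
    have if0: "inv f0 \<in> F" using subfield_m_inv(1)[OF F_sub(1)] f0 by auto
    define gs where "gs = map ((\<otimes>) (inv f0)) fs"
    have gR: "set gs \<subseteq> Rinf"
    proof
      fix g assume "g \<in> set gs"
      then obtain i where i: "i < length fs" "g = inv f0 \<otimes> fs ! i" by (auto simp: gs_def set_conv_nth)
      show "g \<in> Rinf"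
      proof (cases "fs ! i = \<zero>")
        case True
        then show ?thesis using i f0i zeroR by simp
      next
        case nz: False
        then have "?o i0 \<le> ?o i" using least[of i] i(1) by (simp add: I_def)
        moreover have "ord_at (R\<lparr>carrier := F\<rparr>) P (inv f0) = - ?o i0"
          using FF.ord_at_inv[OF P(1), of f0] f0 m_inv_subfield[OF F_sub(1) f0(1,2)] by (simp add: f0_def)
        ultimately have "ord_at (R\<lparr>carrier := F\<rparr>) P (inv f0 \<otimes> fs ! i) \<ge> 0"
          using FF.ord_at_mult[OF P(1), of "inv f0" "fs ! i"] if0 f0i(2) fm[OF i(1)] nz by simp
        moreover have "inv f0 \<otimes> fs ! i \<in> F" "inv f0 \<otimes> fs ! i \<noteq> \<zero>"
          using subringE(6)[OF F_sub(2) if0 fm[OF i(1)]] f0i(1,2) nz fm[OF i(1)] F_sub(3) by (auto simp: integral_iff)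
        ultimately show ?thesis using FF.ord_at_nonneg_iff[OF P(1), of "inv f0 \<otimes> fs ! i"] i(2) by simp
      qed
    qed
    have "\<forall>g \<in> Rinf. \<exists>c. c \<in> constants \<inter> F \<and> g \<ominus> c \<in> P"
    proof
      fix g assume g: "g \<in> Rinf"
      obtain c where "c \<in> constants \<inter> F" "g \<ominus>\<^bsub>R\<lparr>carrier := F\<rparr>\<^esub> c \<in> P"
        using FF.degree_one_residues[OF P g] kappa_eq by auto
      then show "\<exists>c. c \<in> constants \<inter> F \<and> g \<ominus> c \<in> P" using a_minus_subfield[OF F_sub(1), of c g] by auto
    qed
    then obtain c where c: "\<And>g. g \<in> Rinf \<Longrightarrow> c g \<in> constants \<inter> F \<and> g \<ominus> c g \<in> P" by metis
    have gsc: "set gs \<subseteq> carrier R" using fsc f0i(1) by (auto simp: gs_def)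
    have cong: "combine gs ws \<ominus> combine (map c gs) ws \<in> nonunits R V"
      by (rule combine_congruent[OF V(1) gsc wsV]) (use c gR nonunits_over_infinity[OF V] constants_sub(3) in auto)
    have cset: "set (map c gs) \<subseteq> constants \<inter> F" using c gR by auto
    have g1: "gs ! i0 = \<one>" "i0 < length gs" using f0i(4) i0(1) by (auto simp: gs_def I_def f0_def)
    then have oneR: "\<one> \<in> Rinf" using gR nth_mem[of i0 gs] by auto
    have "c \<one> \<noteq> \<zero>"
    proof
      assume "c \<one> = \<zero>"
      then have "\<one> \<in> P" using c[OF oneR] by (simp add: a_minus_def)
      then show False using nonunits_over_infinity[OF V] one_not_nonunit by blast
    qed
    then have "\<not> set (take (length ws) (map c gs)) \<subseteq> {\<zero>}"
    proof -
      have "map c gs ! i0 \<in> set (take (length ws) (map c gs))"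
        using g1(2) fs(2) nth_mem[of i0 "map c gs"] by (simp add: gs_def)
      then show ?thesis using \<open>c \<one> \<noteq> \<zero>\<close> g1 by auto
    qed
    then have nz: "combine (map c gs) ws \<noteq> \<zero>"
      using independent_imp_trivial_combine[OF kappa_sub ws(2) cset] by blast
    have "combine (map c gs) ws \<in> constants"
      using combine_in_subring[OF constants_sub(2) _ ws(1)] cset by auto
    then have u: "combine (map c gs) ws \<in> V" "combine (map c gs) ws \<notin> nonunits R V"
      using constant_unit[OF V(1) _ nz] by auto
    have cs: "combine gs ws \<in> carrier R" "combine (map c gs) ws \<in> carrier R"
      using gsc wsc u D(11) by auto
    have "combine (map c gs) ws \<oplus> (combine gs ws \<ominus> combine (map c gs) ws) = combine gs ws"
      using cs by (simp add: a_minus_def a_lcomm r_neg)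
    then have y: "combine gs ws \<in> V" "combine gs ws \<notin> nonunits R V"
      using unit_add_nonunit[OF V(1) u cong] by auto
    have zc: "z \<in> carrier R" using zV D(11) by (simp add: z_def)
    have gz: "combine gs ws = inv f0 \<otimes> z"
      unfolding gs_def z_def by (rule combine_r_distr[OF fsc wsc f0i(1), symmetric])
    note yi = unit_inv_mem[OF V(1) y]
    have yc: "inv (combine gs ws) \<in> carrier R" "combine gs ws \<otimes> inv (combine gs ws) = \<one>"
      using nonzero_inv[OF cs(1) yi(1)] by auto
    have cancel: "f0 \<otimes> (inv f0 \<otimes> z \<otimes> y) = z \<otimes> y" if y: "y \<in> carrier R" for y
      using m_assoc[OF f0(3) f0i(1), of "z \<otimes> y"] m_assoc[OF f0i(1) zc y] f0i(3) zc y by simp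
    have "f0 = f0 \<otimes> (combine gs ws \<otimes> inv (combine gs ws))" using yc f0 by simp
    also have "\<dots> = z \<otimes> inv (combine gs ws)" using cancel[OF yc(1)] gz by simp
    also have "\<dots> \<in> V" using D(6) zV yi(2) by (simp add: z_def)
    finally have f0V: "f0 \<in> V" .
    show ?thesis
    proof
      fix f assume f: "f \<in> set fs"
      then have "inv f0 \<otimes> f \<in> V" using gR V(2) by (auto simp: gs_def)
      then have "f0 \<otimes> (inv f0 \<otimes> f) \<in> V" using D(6) f0V by simp
      moreover have "f0 \<otimes> (inv f0 \<otimes> f) = f" using f fsc f0 f0i by (auto simp: m_assoc[symmetric])
      ultimately show "f \<in> Rinf" using V(2) f fs(1) by auto
    qed
  qed
qed

lemma over_infinity_unique:
  assumes "valuation_subring R V" "V \<inter> F = Rinf" "valuation_subring R W" "W \<inter> F = Rinf"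
    and z: "z \<in> compositum"
  shows "z \<in> V \<longleftrightarrow> z \<in> W"
proof -
  obtain ws fs where "set ws \<subseteq> constants" "independent (constants \<inter> F) ws" "set fs \<subseteq> F"
     "length fs = length ws" "z = combine fs ws"
    using compositum_independent[OF z] by blast
  then show ?thesis using over_infinity_iff assms by metis
qed

text \<open>
  The elements of the compositum whose poles all lie over \<open>P\<close>, where a pole is a valuation subring of the
  algebraic closure that omits the element, and lies over the place that it induces on \<open>F\<close>.
\<close>

definition integral_outside :: "'a set" where
  "integral_outside = {z \<in> compositum. \<forall>V. valuation_subring R V \<and> V \<inter> F \<noteq> Rinf \<longrightarrow> z \<in> V}"

lemma integral_outside_subring: "subring integral_outside R"
proof -
  note M = subringE[OF subfieldE(1)[OF compositum_subfield]]
  show ?thesis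
    by (rule subringI) (use M valuation_subringD(4-7) in \<open>auto simp: integral_outside_def\<close>)
qed

lemma constants_integral_outside: "constants \<subseteq> integral_outside"
  using constants_compositum by (auto simp: integral_outside_def field_of_constants_eq)

text \<open>
  There is at most one place of the compositum over \<open>P\<close>, and one of \<open>z\<close>, \<open>z'\<close> has no pole there.  Having no pole
  anywhere it is constant, and then so is the other one.
\<close>

lemma units_outside_constant:
  assumes z: "z \<in> integral_outside" "z' \<in> integral_outside" and zz: "z \<otimes> z' \<in> constants" "z \<otimes> z' \<noteq> \<zero>"
  shows "z \<in> constants"
proof -
  have zM: "z \<in> compositum" "z' \<in> compositum" using z by (auto simp: integral_outside_def)
  have zc: "z \<in> carrier R" "z' \<in> carrier R" using zM compositum_carrier by auto
  have nz: "z \<noteq> \<zero>" "z' \<noteq> \<zero>" using zz zc by auto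
  have const: "y \<in> constants" if y: "y \<in> integral_outside" and V: "valuation_subring R V" "V \<inter> F = Rinf" "y \<in> V" for y V
  proof -
    have yM: "y \<in> compositum" using y by (simp add: integral_outside_def)
    have "y \<in> W" if W: "valuation_subring R W" for W
      using over_infinity_unique[OF V(1,2) W _ yM] V(3) y W by (cases "W \<inter> F = Rinf") (auto simp: integral_outside_def)
    then show ?thesis using yM compositum_carrier by (auto simp: field_of_constants_eq)
  qed
  show ?thesis
  proof (cases "\<exists>V. valuation_subring R V \<and> V \<inter> F = Rinf")
    case False
    then show ?thesis using z zc by (auto simp: integral_outside_def field_of_constants_eq)
  next
    case True
    then obtain V where V: "valuation_subring R V" "V \<inter> F = Rinf" by auto
    note D = valuation_subringD[OF V(1)]
    show ?thesis
    proof (cases "z \<in> V")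
      case True
      then show ?thesis using const[OF z(1) V] by simp
    next
      case False
      note zi = nonzero_inv[OF zc(1) nz(1)]
      have "inv z \<in> V" using D(10) zc False by auto
      moreover have "z \<otimes> z' \<in> V" using zz(1) V(1) by (simp add: field_of_constants_eq)
      ultimately have "inv z \<otimes> (z \<otimes> z') \<in> V" by (rule D(6))
      then have "z' \<in> V" using zi zc by (simp add: m_assoc[symmetric])
      then have z': "z' \<in> constants" using const[OF z(2) V] by simp
      have "inv z' \<in> constants" using subfield_m_inv(1)[OF constants_sub(1)] z' nz by auto
      then have "(z \<otimes> z') \<otimes> inv z' \<in> constants" using subringE(6)[OF constants_sub(2)] zz(1) by auto
      then show ?thesis using zc nonzero_inv[OF zc(2) nz(2)] by (simp add: m_assoc)
    qed
  qed
qed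

text \<open>
  The factors \<open>u - w\<close> and \<open>u - e w\<close> of the left hand side, with \<open>e \<noteq> 1\<close> a root of unity, divide a nonzero
  constant, so they are constant, and they determine \<open>u\<close> and \<open>w\<close>.
\<close>

lemma power_difference_constant:
  assumes u: "u \<in> integral_outside" and w: "w \<in> integral_outside"
    and s: "Factorial_Ring.prime s" "s \<noteq> l" and c: "u [^] s \<ominus> w [^] s \<in> constants" "u [^] s \<ominus> w [^] s \<noteq> \<zero>"
  shows "u \<in> constants" "w \<in> constants"
proof -
  note O = subringE[OF integral_outside_subring]
  note C = subringE[OF constants_sub(2)]
  have uw: "u \<in> carrier R" "w \<in> carrier R" using u w O(1) by auto
  have s0: "s > 0" using prime_gt_0_nat[OF s(1)] .
  obtain e where e: "e \<in> carrier R" "e [^] s = \<one>" "e \<noteq> \<one>"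
    using primitive_root_exists[OF algebraically_closed_axioms s] by blast
  have eC: "e \<in> constants" by (rule constant_rootI[OF e(1) _ s0]) (use e C in simp)
  have factor: "u \<ominus> \<eta> \<otimes> w \<in> constants" if h: "\<eta> \<in> constants" "\<eta> [^] s = \<one>" for \<eta>
  proof -
    have hc: "\<eta> \<in> carrier R" using h C(1) by auto
    have hw: "\<eta> \<otimes> w \<in> integral_outside" using O(6) h constants_integral_outside w by auto
    have d: "u \<ominus> \<eta> \<otimes> w \<in> integral_outside" using O u hw by (auto simp: a_minus_def)
    have q: "power_quotient R u (\<eta> \<otimes> w) s \<in> integral_outside"
      by (rule power_quotient_closed[OF integral_outside_subring u hw])
    have "(\<eta> \<otimes> w) [^] s = w [^] s" using hc uw h by (simp add: nat_pow_distrib)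
    then have "(u \<ominus> \<eta> \<otimes> w) \<otimes> power_quotient R u (\<eta> \<otimes> w) s = u [^] s \<ominus> w [^] s"
      using power_diff_factor[OF uw(1), of "\<eta> \<otimes> w" s] hc uw by simp
    then show ?thesis using units_outside_constant[OF d q] c by simp
  qed
  have f1: "u \<ominus> w \<in> constants" using factor[of \<one>] C uw by simp
  have fe: "u \<ominus> e \<otimes> w \<in> constants" using factor[OF eC e(2)] .
  have "(u \<ominus> w) \<ominus> (u \<ominus> e \<otimes> w) = (e \<ominus> \<one>) \<otimes> w"
  proof -
    have ew: "e \<otimes> w \<in> carrier R" using e uw by simp
    have "(u \<ominus> w) \<ominus> (u \<ominus> e \<otimes> w) = (u \<oplus> \<ominus> u) \<oplus> (e \<otimes> w \<oplus> \<ominus> w)"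
      using uw ew by (simp add: a_minus_def minus_add a_ac)
    then show ?thesis using uw e by (simp add: r_neg a_minus_def l_distr l_minus)
  qed
  moreover have "(u \<ominus> w) \<ominus> (u \<ominus> e \<otimes> w) \<in> constants" using C(5,7) f1 fe by (auto simp: a_minus_def)
  ultimately have ew: "(e \<ominus> \<one>) \<otimes> w \<in> constants" by simp
  have e1: "e \<ominus> \<one> \<in> constants" "e \<ominus> \<one> \<noteq> \<zero>" using C eC e eq_of_diff[of e \<one>] by (auto simp: a_minus_def)
  have e1c: "e \<ominus> \<one> \<in> carrier R" using e1 C(1) by auto
  have "inv (e \<ominus> \<one>) \<in> constants" using subfield_m_inv(1)[OF constants_sub(1)] e1 by auto
  then have "inv (e \<ominus> \<one>) \<otimes> ((e \<ominus> \<one>) \<otimes> w) \<in> constants" using C(6) ew by auto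
  then show w': "w \<in> constants" using nonzero_inv[OF e1c e1(2)] uw e1c by (simp add: m_assoc[symmetric])
  have "(u \<ominus> w) \<oplus> w \<in> constants" using C(7) f1 w' by auto
  then show "u \<in> constants" using uw by (simp add: a_minus_def a_assoc l_neg)
qed

text \<open>
  A valuation subring of the algebraic closure induces on \<open>F\<close> either \<open>F\<close> itself or the ring of a prime; the
  latter differs from \<open>P\<close> by assumption.
\<close>

lemma regular_outside_integral:
  assumes g: "g \<in> regular_outside (R\<lparr>carrier := F\<rparr>) P"
  shows "g \<in> F" "g \<in> integral_outside"
proof -
  show gF: "g \<in> F" using g by (simp add: regular_outside_def)
  have "g \<in> V" if V: "valuation_subring R V" "V \<inter> F \<noteq> Rinf" for V
  proof (cases "V \<inter> F = F")
    case True
    then show ?thesis using gF by auto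
  next
    case False
    note W = valuation_restrict(1)[OF F_sub(1) V(1)]
    let ?v = "nonunits (R\<lparr>carrier := F\<rparr>) (V \<inter> F)"
    have v: "?v \<in> primes_of (R\<lparr>carrier := F\<rparr>)" using FF.nonunits_prime[OF W] False by simp
    have pr: "prime_ring (R\<lparr>carrier := F\<rparr>) ?v = V \<inter> F" by (rule FF.prime_ring_nonunits[OF W])
    then have "?v \<noteq> P" using V(2) by auto
    then have "g = \<zero> \<or> ord_at (R\<lparr>carrier := F\<rparr>) ?v g \<ge> 0" using g v by (simp add: regular_outside_def)
    then show ?thesis
      using FF.ord_at_nonneg_iff[OF v, of g] gF pr valuation_subringD(3)[OF V(1)] by auto
  qed
  then show "g \<in> integral_outside" using gF F_compositum by (auto simp: integral_outside_def)
qed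

text \<open>
  The common form of the two factorizations: \<open>d1\<close> and \<open>d2\<close> are two roots of \<open>T\<^sup>r = d1\<^sup>r\<close>, and \<open>a - d1\<close>
  and \<open>a - d2\<close> are both \<open>s\<close>-th powers over the algebraically closed constants.  Their difference is
  constant.
\<close>

theorem catalan_constant:
  assumes a: "a \<in> F" "a \<in> integral_outside" and b: "b \<in> F"
    and mu: "finite \<mu>" "\<mu> \<subseteq> constants"
    and d: "d1 \<in> generate_field R (F \<union> \<mu>)" "d2 \<in> generate_field R (F \<union> \<mu>)" "d1 \<in> constants" "d2 \<in> constants"
      "d1 \<noteq> d2" "d1 \<noteq> \<zero>" "d2 \<noteq> \<zero>" "d1 [^] r = d2 [^] r"
    and r: "Factorial_Ring.prime r" "r \<noteq> l" and s: "Factorial_Ring.prime s" "s \<noteq> l" "r \<noteq> s"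
    and h: "\<not> s dvd class_number (R\<lparr>carrier := generate_field R (F \<union> \<mu>)\<rparr>)"
    and eq: "a [^] r \<ominus> d1 [^] r = b [^] s"
  shows "a \<in> constants"
proof (rule ccontr)
  assume na: "a \<notin> constants"
  define K where "K = generate_field R (F \<union> \<mu>)"
  let ?K = "R\<lparr>carrier := K\<rparr>"
  note C = subringE[OF constants_sub(2)]
  have muc: "\<mu> \<subseteq> carrier R" using mu C(1) by auto
  have FK: "F \<subseteq> K" by (auto simp: K_def intro: generate_field.incl)
  have K: "subfield K R" unfolding K_def by (rule generate_field_is_subfield) (use muc F_sub in auto)
  note KS = subringE[OF subfieldE(1)[OF K]]
  interpret K: function_field ?K l
    using extension_is_function_field[OF mu(1) muc] subfield_iff(2)[OF K]
    by (simp add: function_field_def function_field_axioms_def K_def)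
  have constK: "field_of_constants ?K = constants \<inter> K" by (rule field_of_constants_restrict[OF K])
  have KM: "K \<subseteq> compositum"
    unfolding K_def
    by (rule generate_field_min_subfield1[OF _ compositum_subfield])
      (use F_sub muc F_compositum constants_compositum mu in auto)
  have aK: "a \<in> K" "b \<in> K" "a \<in> carrier R" "b \<in> carrier R" using a b FK KS(1) by auto
  have dK: "d1 \<in> K" "d2 \<in> K" using d by (auto simp: K_def)
  have r0: "r > 0" "s > 0" using prime_gt_0_nat[OF r(1)] prime_gt_0_nat[OF s(1)] by auto
  have powC: "z [^] (n::nat) \<in> constants" if "z \<in> constants" for z n
    using that C(3,6) by (induction n) auto
  have b0: "b \<noteq> \<zero>"
  proof
    assume "b = \<zero>"
    then have "a [^] r \<ominus> d1 [^] r = \<zero>" using eq r0 by (simp add: nat_pow_zero)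
    moreover have "d1 [^] r \<in> carrier R" "a [^] r \<in> carrier R" using d C(1) aK by auto
    ultimately have "a [^] r = d1 [^] r" using eq_of_diff by blast
    then have "a \<in> constants" using constant_rootI[OF aK(3) _ r0(1)] powC[OF d(3)] by simp
    then show False using na by simp
  qed
  obtain V where V: "valuation_subring R V" "a \<notin> V" using na aK by (auto simp: field_of_constants_eq)
  have "V \<inter> K \<noteq> carrier ?K" using V(2) aK by auto
  then have PK: "nonunits ?K (V \<inter> K) \<in> primes_of ?K"
    using K.nonunits_prime[OF valuation_restrict(1)[OF K V(1)]] by simp
  have powK: "z [^]\<^bsub>?K\<^esub> (n::nat) = z [^] n" for z n by (simp add: nat_pow_def)
  have decomp: "\<exists>U \<in> integral_outside. U [^] s = a \<ominus> d \<and> U \<notin> constants"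
    if d': "d \<in> K" "d \<in> constants" "d \<noteq> \<zero>" "d [^] r = d1 [^] r" for d
  proof -
    have dc: "d \<in> carrier R" using d' C(1) by auto
    have x: "a \<ominus> d \<in> K" "a \<ominus> d \<in> carrier R" using KS(5,7) aK d' dc by (auto simp: a_minus_def)
    have lift: "a \<in> constants" if "a \<ominus> d \<in> constants"
    proof -
      have "(a \<ominus> d) \<oplus> d \<in> constants" using C(7) that d' by auto
      then show ?thesis using aK dc by (simp add: a_minus_def a_assoc l_neg)
    qed
    have nz: "a \<ominus> d \<noteq> \<zero>" using lift na C(2) by auto
    have mK: "a \<ominus>\<^bsub>?K\<^esub> d = a \<ominus> d" by (rule a_minus_subfield[OF K d'(1)])
    have dr: "d [^] r \<in> K" using d'(1) KS(3,6) by (induction r) auto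
    have eqK: "a [^]\<^bsub>?K\<^esub> r \<ominus>\<^bsub>?K\<^esub> d [^]\<^bsub>?K\<^esub> r = b [^]\<^bsub>?K\<^esub> s"
      using eq d'(4) a_minus_subfield[OF K dr] by (simp add: powK)
    have "int s dvd ord_at ?K v (a \<ominus> d)" if v: "v \<in> primes_of ?K" for v
      using K.catalan_factor_divisor[OF v _ _ _ _ _ r s(1,3) eqK] aK b0 d' constK nz mK by simp
    then obtain u y where u: "u \<in> field_of_constants ?K" and y: "y \<in> K" "y \<noteq> \<zero>" and xu: "a \<ominus> d = u \<otimes> y [^] s"
      using K.divisible_divisor_is_power[OF s(1) _ PK, of "a \<ominus> d"] h x nz by (auto simp: K_def[symmetric] powK)
    have uC: "u \<in> constants" "u \<in> carrier R" using u constK C(1) by auto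
    obtain \<alpha> where al: "\<alpha> \<in> carrier R" "\<alpha> [^] s = u" using exists_nth_root[OF uC(2) r0(2)] by blast
    have alC: "\<alpha> \<in> constants" using constant_rootI[OF al(1) _ r0(2)] al uC by simp
    let ?U = "\<alpha> \<otimes> y"
    have yc: "y \<in> carrier R" using y KS(1) by auto
    have Us: "?U [^] s = a \<ominus> d" using al yc xu by (simp add: nat_pow_distrib)
    have "?U \<in> compositum" using compositum_mult alC constants_compositum y(1) KM by auto
    moreover have "?U \<in> W" if W: "valuation_subring R W" "W \<inter> F \<noteq> Rinf" for W
    proof -
      note D = valuation_subringD[OF W(1)]
      have "a \<in> W" using a(2) W by (simp add: integral_outside_def)
      moreover have "d \<in> W" using d'(2) W(1) by (simp add: field_of_constants_eq)
      ultimately have "?U [^] s \<in> W" using D(8) Us by simp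
      then show ?thesis using valuation_subring_root_closed[OF W(1) _ _ r0(2)] al yc by simp
    qed
    ultimately have "?U \<in> integral_outside" by (simp add: integral_outside_def)
    moreover have "?U \<notin> constants" using powC[of ?U s] Us lift na by auto
    ultimately show ?thesis using Us by blast
  qed
  obtain u where u: "u \<in> integral_outside" "u [^] s = a \<ominus> d1" "u \<notin> constants"
    using decomp[OF dK(1) d(3,6)] by blast
  obtain w where w: "w \<in> integral_outside" "w [^] s = a \<ominus> d2"
    using decomp[OF dK(2) d(4,7)] d(8) by auto
  have dc: "d1 \<in> carrier R" "d2 \<in> carrier R" using d C(1) by auto
  have diff: "(a \<ominus> d1) \<ominus> (a \<ominus> d2) = d2 \<ominus> d1"
  proof -
    have "(a \<ominus> d1) \<ominus> (a \<ominus> d2) = (a \<oplus> \<ominus> a) \<oplus> (d2 \<oplus> \<ominus> d1)"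
      using aK dc by (simp add: a_minus_def minus_add a_ac)
    then show ?thesis using aK dc by (simp add: r_neg a_minus_def)
  qed
  have "d2 \<ominus> d1 \<in> constants" using C(5,7) d by (auto simp: a_minus_def)
  moreover have "d2 \<ominus> d1 \<noteq> \<zero>" using eq_of_diff[OF _ dc(2,1)] d(5) by auto
  ultimately have "u \<in> constants"
    using power_difference_constant(1)[OF u(1) w(1) s(1,2)] u(2) w(2) diff by simp
  then show False using u(3) by simp
qed

end

section \<open>Catalan's equation\<close>

context degree_one_place
begin

lemma roots_of_unity_constants: "n > 0 \<Longrightarrow> {z \<in> carrier R. z [^] (n::nat) = \<one>} \<subseteq> constants"
proof
  fix z assume n: "n > 0" and "z \<in> {z \<in> carrier R. z [^] n = \<one>}"
  then have "z \<in> carrier R" "z [^] n \<in> constants" using subringE(3)[OF constants_sub(2)] by auto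
  then show "z \<in> constants" using n by (rule constant_rootI)
qed

text \<open>
  The second root is \<open>e d1\<close>.  The alternative for \<open>d1\<close> allows \<open>-1\<close>, which is in \<open>F\<close> but need not be an \<open>n\<close>-th root
  of unity for odd \<open>n\<close>.
\<close>

lemma catalan_over_roots_of_unity:
  assumes a: "a \<in> regular_outside (R\<lparr>carrier := F\<rparr>) P" and b: "b \<in> F" and n: "n > 0"
    and d: "d1 \<in> carrier R" "d1 [^] n = \<one> \<or> d1 \<in> F \<inter> constants" "d1 \<noteq> \<zero>"
    and e: "e \<in> carrier R" "e [^] n = \<one>" "e [^] r = \<one>" "e \<noteq> \<one>"
    and r: "Factorial_Ring.prime r" "r \<noteq> l" and s: "Factorial_Ring.prime s" "s \<noteq> l" "r \<noteq> s"
    and h: "\<not> s dvd class_number (adjoin_roots_of_unity R F n)"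
    and eq: "a [^] r \<ominus> d1 [^] r = b [^] s"
  shows "a \<in> constants"
proof -
  let ?mu = "{z \<in> carrier R. z [^] (n::nat) = \<one>}"
  let ?K = "generate_field R (F \<union> ?mu)"
  note C = subringE[OF constants_sub(2)]
  have mu: "finite ?mu" "?mu \<subseteq> constants" using finite_roots_of_unity[OF n] roots_of_unity_constants[OF n] by auto
  have KS: "subring ?K R"
    by (intro subfieldE(1) generate_field_is_subfield) (use F_sub in auto)
  have d1: "d1 \<in> ?K" "d1 \<in> constants" using d mu(2) by (auto intro: generate_field.incl)
  have eK: "e \<in> ?K" "e \<in> constants" using e mu(2) by (auto intro: generate_field.incl)
  have e0: "e \<noteq> \<zero>" using e(2) n by (auto simp: nat_pow_zero)
  show ?thesis
  proof (rule catalan_constant[OF regular_outside_integral[OF a] b mu d1(1) _ d1(2) _ _ d(3) _ _ r s _ eq])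
    show "e \<otimes> d1 \<in> ?K" by (rule subringE(6)[OF KS eK(1) d1(1)])
    show "e \<otimes> d1 \<in> constants" by (rule C(6)[OF eK(2) d1(2)])
    show "d1 \<noteq> e \<otimes> d1"
    proof
      assume "d1 = e \<otimes> d1"
      then have "\<one> \<otimes> d1 = e \<otimes> d1" using d(1) by simp
      then show False using m_rcancel[OF d(3) d(1), of \<one> e] e by (simp del: l_one)
    qed
    show "e \<otimes> d1 \<noteq> \<zero>" using e e0 d by (simp add: integral_iff)
    show "d1 [^] r = (e \<otimes> d1) [^] r" using e d by (simp add: nat_pow_distrib)
    show "\<not> s dvd class_number (R\<lparr>carrier := ?K\<rparr>)" using h by (simp add: adjoin_roots_of_unity_def)
  qed
qed

lemma odd_pow_minus_one:
  assumes "odd (n::nat)"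
  shows "(\<ominus> \<one>) [^] n = \<ominus> \<one>"
proof -
  obtain k where k: "n = 2 * k + 1" using assms oddE by blast
  have "(\<ominus> \<one>) [^] (2 * k) = ((\<ominus> \<one>) [^] (2::nat)) [^] k" by (simp add: nat_pow_pow)
  also have "(\<ominus> \<one>) [^] (2::nat) = \<one>" by (simp add: numeral_2_eq_2 l_minus)
  finally show ?thesis using k by simp
qed

text \<open>
  If \<open>q\<close> is prime to the class number of \<open>F(\<mu>\<^sub>p)\<close>, factor \<open>x\<^sup>p - 1\<close>.  Otherwise factor \<open>y\<^sup>q + 1\<close> as
  \<open>y\<^sup>q - (-1)\<^sup>q\<close> for odd \<open>q\<close> and as \<open>y\<^sup>2 - i\<^sup>2\<close> for \<open>q = 2\<close>; the latter needs the fourth roots of unity.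
\<close>

theorem catalan_prime_exponents:
  assumes x: "x \<in> regular_outside (R\<lparr>carrier := F\<rparr>) P" and y: "y \<in> regular_outside (R\<lparr>carrier := F\<rparr>) P"
    and p: "Factorial_Ring.prime p" "p \<noteq> l" and q: "Factorial_Ring.prime q" "q \<noteq> l"
    and cond2: "p \<noteq> q \<longrightarrow> \<not> q dvd class_number (adjoin_roots_of_unity R F p) \<or> \<not> p dvd class_number (adjoin_roots_of_unity R F q)"
    and cond3: "q = 2 \<and> p \<noteq> 2 \<and> q dvd class_number (adjoin_roots_of_unity R F p) \<longrightarrow>
       \<not> p dvd class_number (adjoin_roots_of_unity R F 4)"
    and eq: "x [^] p \<ominus> y [^] q = \<one>"
  shows "x \<in> constants" "y \<in> constants"
proof -
  note C = subringE[OF constants_sub(2)]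
  note X = regular_outside_integral[OF x]
  note Y = regular_outside_integral[OF y]
  have c: "x \<in> carrier R" "y \<in> carrier R" using X Y F_sub(3) by auto
  have p0: "p > 0" "q > 0" using prime_gt_0_nat p(1) q(1) by auto
  have cp: "x [^] p \<in> carrier R" "y [^] q \<in> carrier R" using c by auto
  have eq1: "x [^] p \<ominus> \<one> = y [^] q"
  proof -
    have "x [^] p = (x [^] p \<ominus> y [^] q) \<oplus> y [^] q" using cp by (simp add: a_minus_def a_assoc l_neg)
    then have "x [^] p = y [^] q \<oplus> \<one>" unfolding eq using cp by (simp add: a_comm)
    then show ?thesis using cp by (simp add: a_minus_def a_assoc r_neg)
  qed
  have eq2: "y [^] q \<ominus> (\<ominus> \<one>) = x [^] p"
    unfolding eq1[symmetric] using cp by (simp add: a_minus_def a_assoc l_neg)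
  have powC: "z [^] (n::nat) \<in> constants" if "z \<in> constants" for z n
    using that C(3,6) by (induction n) auto
  have xy: "y \<in> constants" if "x \<in> constants"
  proof -
    have "x [^] p \<ominus> \<one> \<in> constants" using powC[OF that] C(3,5,7) by (auto simp: a_minus_def)
    then show ?thesis using constant_rootI[OF c(2) _ p0(2)] eq1 by simp
  qed
  have yx: "x \<in> constants" if "y \<in> constants"
  proof -
    have "y [^] q \<ominus> (\<ominus> \<one>) \<in> constants" using powC[OF that] C(3,5,7) by (auto simp: a_minus_def)
    then show ?thesis using constant_rootI[OF c(1) _ p0(1)] eq2 by simp
  qed
  have "x \<in> constants \<or> y \<in> constants"
  proof (cases "p = q")
    case True
    then have "x \<in> constants"
      using power_difference_constant(1)[OF X(2) Y(2) p] eq C(3) by simp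
    then show ?thesis by simp
  next
    case pq: False
    show ?thesis
    proof (cases "q dvd class_number (adjoin_roots_of_unity R F p)")
      case False
      obtain e where e: "e \<in> carrier R" "e [^] p = \<one>" "e \<noteq> \<one>"
        using primitive_root_exists[OF algebraically_closed_axioms p] by blast
      have oc: "\<one> \<in> carrier R" using C(1,3) by blast
      have "x \<in> constants"
        by (rule catalan_over_roots_of_unity[OF x Y(1) p0(1) oc _ one_not_zero e(1,2,2,3) p q pq False])
          (use eq1 in auto)
      then show ?thesis by simp
    next
      case True
      have hq: "\<not> p dvd class_number (adjoin_roots_of_unity R F q)" using cond2 pq True by blast
      obtain e where e: "e \<in> carrier R" "e [^] q = \<one>" "e \<noteq> \<one>"
        using primitive_root_exists[OF algebraically_closed_axioms q] by blast
      have m1: "\<ominus> \<one> \<in> F \<inter> constants" "\<ominus> \<one> \<noteq> \<zero>" "\<ominus> \<one> \<in> carrier R"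
        using C(3,5) subringE(3,5)[OF F_sub(2)] by (auto simp: minus_equality)
      have "y \<in> constants"
      proof (cases "q = 2")
        case False
        then have "odd q" using q(1) prime_odd_nat prime_ge_2_nat[OF q(1)] by fastforce
        then have "y [^] q \<ominus> (\<ominus> \<one>) [^] q = x [^] p" using eq2 odd_pow_minus_one by simp
        then show ?thesis
          using catalan_over_roots_of_unity[OF y X(1) p0(2) m1(3) _ m1(2) e(1,2,2,3) q p _ hq] m1(1) pq by blast
      next
        case q2: True
        have h4: "\<not> p dvd class_number (adjoin_roots_of_unity R F 4)" using cond3 q2 pq True by blast
        obtain i where i: "i \<in> carrier R" "i [^] (2::nat) = \<ominus> \<one>" using exists_nth_root[OF m1(3), of 2] by auto
        have "i [^] (4::nat) = (i [^] (2::nat)) [^] (2::nat)" using i(1) by (simp add: nat_pow_pow)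
        then have i4: "i [^] (4::nat) = \<one>" using i(2) by (simp add: numeral_2_eq_2 l_minus)
        have i0: "i \<noteq> \<zero>" using i4 by (auto simp: nat_pow_zero)
        have "e [^] (4::nat) = (e [^] (2::nat)) [^] (2::nat)" using e(1) by (simp add: nat_pow_pow)
        then have e4: "e [^] (4::nat) = \<one>" using e(2) q2 by simp
        have eq3: "y [^] q \<ominus> i [^] q = x [^] p" using eq2 i(2) q2 by simp
        show ?thesis
          using catalan_over_roots_of_unity[OF y X(1) _ i(1) _ i0 e(1) e4 e(2,3) q p _ h4 eq3] i4 pq by auto
      qed
      then show ?thesis by simp
    qed
  qed
  then show "x \<in> constants" "y \<in> constants" using xy yx by auto
qed

lemma regular_outside_pow:
  assumes g: "g \<in> regular_outside (R\<lparr>carrier := F\<rparr>) P"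
  shows "g [^] (n::nat) \<in> regular_outside (R\<lparr>carrier := F\<rparr>) P"
proof -
  have gF: "g \<in> F" using g by (simp add: regular_outside_def)
  have "g [^] n \<in> F" using gF subringE(3,6)[OF F_sub(2)] by (induction n) auto
  moreover have "g [^] n = \<zero> \<or> ord_at (R\<lparr>carrier := F\<rparr>) v (g [^] n) \<ge> 0"
    if v: "v \<in> primes_of (R\<lparr>carrier := F\<rparr>)" "v \<noteq> P" for v
  proof (cases "g = \<zero>")
    case True
    then show ?thesis using FF.ord_at_one[OF v(1)] by (cases n) auto
  next
    case False
    have "ord_at (R\<lparr>carrier := F\<rparr>) v g \<ge> 0" using g v False by (auto simp: regular_outside_def)
    moreover have "g [^]\<^bsub>R\<lparr>carrier := F\<rparr>\<^esub> n = g [^] n" by (simp add: nat_pow_def)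
    ultimately show ?thesis using FF.ord_at_pow[OF v(1), of g n] gF False by simp
  qed
  ultimately show ?thesis by (simp add: regular_outside_def)
qed

end

theorem theorem1p1:
  fixes L :: "('a, 'b) ring_scheme" (structure)
    and F P_inf \<kappa> O_F :: "'a set"
    and l p q :: nat
    and h :: "nat \<Rightarrow> nat"
  assumes closure: "algebraic_closure L F"
    and function_field: "global_function_field l (L\<lparr>carrier := F\<rparr>)"
    and P_inf: "P_inf \<in> primes_of (L\<lparr>carrier := F\<rparr>)" "prime_degree (L\<lparr>carrier := F\<rparr>) P_inf = 1"
    and O_F: "O_F = regular_outside (L\<lparr>carrier := F\<rparr>) P_inf"
    and \<kappa>: "\<kappa> = field_of_constants (L\<lparr>carrier := F\<rparr>)"
    and h: "\<And>r. h r = class_number (adjoin_roots_of_unity L F r)"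
    and primes: "Factorial_Ring.prime p" "Factorial_Ring.prime q"
    and cond1: "p \<noteq> l \<and> q \<noteq> l"
    and cond2: "p \<noteq> q \<longrightarrow> \<not> q dvd h p \<or> \<not> p dvd h q"
    and cond3: "q = 2 \<and> p \<noteq> 2 \<and> q dvd h p \<longrightarrow> \<not> p dvd h 4"
  shows "(\<forall>x \<in> O_F. \<forall>y \<in> O_F. x [^] p \<ominus> y [^] q = \<one> \<longrightarrow> x \<in> \<kappa> \<and> y \<in> \<kappa>) \<and>
    (\<forall>m n :: nat. m > 1 \<and> n > 1 \<and> p dvd m \<and> q dvd n \<longrightarrow>
       (\<forall>x \<in> O_F. \<forall>y \<in> O_F. x [^] m \<ominus> y [^] n = \<one> \<longrightarrow> x \<in> \<kappa> \<and> y \<in> \<kappa>))"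
proof -
  interpret degree_one_place L F l P_inf
    using closure function_field P_inf by (simp add: degree_one_place_def degree_one_place_axioms_def)
  have F: "g \<in> F" "g \<in> carrier L" if "g \<in> O_F" for g
    using that F_sub(3) by (auto simp: O_F regular_outside_def)
  have main: "x \<in> constants \<and> y \<in> constants"
    if "x \<in> O_F" "y \<in> O_F" "x [^] p \<ominus> y [^] q = \<one>" for x y
    using catalan_prime_exponents[of x y p q] that primes cond1 cond2 cond3 unfolding O_F h by blast
  have general: "x \<in> \<kappa> \<and> y \<in> \<kappa>"
    if xy: "x \<in> O_F" "y \<in> O_F" and eq: "x [^] m \<ominus> y [^] n = \<one>" and mn: "m > 1" "n > 1" "p dvd m" "q dvd n"
    for x y and m n :: nat
  proof -
    obtain m' where m': "m = m' * p" using mn(3) by (metis dvdE mult.commute)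
    obtain n' where n': "n = n' * q" using mn(4) by (metis dvdE mult.commute)
    have pos: "m' > 0" "n' > 0" using m' n' mn(1,2) by (auto intro!: Nat.gr0I)
    have O: "x [^] m' \<in> O_F" "y [^] n' \<in> O_F" using regular_outside_pow xy by (auto simp: O_F)
    have "(x [^] m') [^] p \<ominus> (y [^] n') [^] q = \<one>"
      using eq F(2)[OF xy(1)] F(2)[OF xy(2)] by (simp add: nat_pow_pow m' n')
    then have "x [^] m' \<in> constants" "y [^] n' \<in> constants" using main[OF O] by auto
    then have "x \<in> constants" "y \<in> constants" using constant_rootI pos F(2) xy by auto
    then show ?thesis using F(1) xy kappa_eq by (simp add: \<kappa>)
  qed
  have "p > 1" "q > 1" using primes prime_gt_1_nat by auto
  then show ?thesis using general by simp
qed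

end
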